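(* Let $n\ge 1$, let $D=B(0,r_0)\subset\mathbb{R}^n$ be an open ball centered at $0$, and let $f$ be a convex $C^2$ function on a neighborhood of the closed ball $\bar D$ with $f(0)=0$ and $\nabla f(0)=0$. Let $\phi:\mathbb{R}^n\to\mathbb{R}$ be a $C^1$ function supported in $D$. Let $g_1,\dots,g_q$ be finitely many real analytic functions defined on a neighborhood of $\bar D$, none identically zero. Suppose that for some $C>0$ and some $0<\alpha<1$ the estimate $$m\big(\{x\in S':\pi(x)\in\bar D,\ s(v)\le x\cdot v\le s(v)+|t|^{-1}\}\big)\le C|t|^{-\alpha}$$ holds for all real $t\neq0$ and all $v\in\mathbb{R}^{n+1}$ with $|v|=1$ and $v_{n+1}\ge0$. Then there exists a constant $C'$ such that $|I(\lambda)|\le C'|\lambda|^{-\alpha}$ for all $\lambda\in\mathbb{R}^{n+1}$ with $\lambda\ne0$.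
   Context: Here $S'\subset\mathbb{R}^{n+1}$ is the hypersurface which, over the neighborhood of $\bar D$ on which $f$ is defined, is the graph $x_{n+1}=f(x_1,\dots,x_n)$; only the portion of $S'$ above $\bar D$ matters. $\pi:\mathbb{R}^{n+1}\to\mathbb{R}^n$ is the projection onto the first $n$ coordinates, and $m$ is Euclidean surface measure ($n$-dimensional) on $S'$. For $\lambda=(\lambda_1,\dots,\lambda_{n+1})\in\mathbb{R}^{n+1}$, $$I(\lambda)=\int_{\{x\in\mathbb{R}^n:\ g_i(x)<0\text{ for all }i\}}e^{-i\lambda_1x_1-\dots-i\lambda_nx_n-i\lambda_{n+1}f(x_1,\dots,x_n)}\,\phi(x_1,\dots,x_n)\,dx_1\cdots dx_n ,$$ where, since $\phi$ is supported in $D$, only points $x\in D$ contribute. For $v\in\mathbb{R}^{n+1}$ with $|v|=1$ and $v_{n+1}\ge0$, $$s(v)=\min\{x\cdot v : x\in S',\ \pi(x)\in\bar D\}.$$ *)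

theory Defs
  imports "HOL-Analysis.Analysis"
begin

text \<open>
  Throughout, \<open>\<real>\<^sup>n\<close> is \<^typ>\<open>real ^ 'n\<close> and \<open>\<real>\<^sup>n\<^sup>+\<^sup>1\<close> is the product \<^typ>\<open>(real ^ 'n) \<times> real\<close>,
  whose library norm and inner product are the Euclidean ones.  The projection to the first
  \<open>n\<close> coordinates is \<^const>\<open>fst\<close> and the last coordinate is \<^const>\<open>snd\<close>.
\<close>

definition C1_on :: "'a::real_normed_vector set \<Rightarrow> ('a \<Rightarrow> 'b::real_normed_vector) \<Rightarrow> bool"
  where "C1_on U f \<longleftrightarrow>
    (\<exists>f' :: 'a \<Rightarrow> 'a \<Rightarrow>\<^sub>L 'b.
       (\<forall>x\<in>U. (f has_derivative blinfun_apply (f' x)) (at x)) \<and> continuous_on U f')"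

definition C2_on :: "'a::real_normed_vector set \<Rightarrow> ('a \<Rightarrow> 'b::real_normed_vector) \<Rightarrow> bool"
  where "C2_on U f \<longleftrightarrow>
    (\<exists>f' :: 'a \<Rightarrow> 'a \<Rightarrow>\<^sub>L 'b.
       (\<forall>x\<in>U. (f has_derivative blinfun_apply (f' x)) (at x)) \<and> C1_on U f')"

definition gradient :: "('a::real_inner \<Rightarrow> real) \<Rightarrow> 'a \<Rightarrow> 'a"
  where "gradient f x = (THE D. GDERIV f x :> D)"

text \<open>
  Real analyticity in several variables: near every point, \<open>g\<close> is the sum of a power series
  indexed by multi-indices \<open>k\<close>.  (\<^const>\<open>has_sum\<close> is unconditional summation, that is,
  absolute convergence here.)
\<close>

definition real_analytic_on :: "(real ^ 'n) set \<Rightarrow> (real ^ 'n \<Rightarrow> real) \<Rightarrow> bool"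
  where "real_analytic_on U g \<longleftrightarrow>
    (\<forall>a\<in>U. \<exists>r>0. \<exists>c :: ('n \<Rightarrow> nat) \<Rightarrow> real. \<forall>x\<in>ball a r.
       ((\<lambda>k. c k * (\<Prod>i\<in>UNIV. (x $ i - a $ i) ^ k i)) has_sum g x) UNIV)"

definition graph_over :: "'a set \<Rightarrow> ('a \<Rightarrow> 'b) \<Rightarrow> ('a \<times> 'b) set"
  where "graph_over U f = (\<lambda>x. (x, f x)) ` U"

text \<open>
  The \<open>n\<close>-dimensional Euclidean surface measure on the graph of \<open>f\<close> over \<open>U\<close>, as a measure on
  the Borel sets of the ambient space: the image under \<open>x \<mapsto> (x, f x)\<close> of
  \<open>sqrt (1 + \<bar>\<nabla>f x\<bar>\<^sup>2) dx\<close>.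
\<close>

definition graph_measure :: "'a::euclidean_space set \<Rightarrow> ('a \<Rightarrow> real) \<Rightarrow> ('a \<times> real) measure"
  where "graph_measure U f =
    distr (density (restrict_space lborel U) (\<lambda>x. ennreal (sqrt (1 + (norm (gradient f x))\<^sup>2))))
      borel (\<lambda>x. (x, f x))"

text \<open>
  The minimum of \<open>p \<bullet> v\<close> over the part of the hypersurface \<open>S\<close> above \<open>K\<close>.
  \<^const>\<open>Min\<close> is meant for finite sets, hence the infimum; lemma \<open>support_min_attained\<close> below
  shows that it is a minimum.
\<close>

definition support_min ::
    "('a::euclidean_space \<times> real) set \<Rightarrow> 'a set \<Rightarrow> 'a \<times> real \<Rightarrow> real"
  where "support_min S K v = (INF p \<in> {p \<in> S. fst p \<in> K}. p \<bullet> v)"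

text \<open>
  The domain of integration is intersected with the ball \<open>D\<close> containing the support of \<open>\<phi>\<close>,
  because the \<open>g i\<close> are only meaningful near \<open>closure D\<close>.
\<close>

definition oscillatory_integral ::
    "'a::euclidean_space set \<Rightarrow> nat \<Rightarrow> (nat \<Rightarrow> 'a \<Rightarrow> real) \<Rightarrow> ('a \<Rightarrow> real) \<Rightarrow> ('a \<Rightarrow> real)
      \<Rightarrow> 'a \<times> real \<Rightarrow> complex"
  where "oscillatory_integral D q g f \<phi> \<xi> =
    (LINT x : {x \<in> D. \<forall>i\<in>{1..q}. g i x < 0} | lborel.
       exp (- \<i> * complex_of_real (\<xi> \<bullet> (x, f x))) * complex_of_real (\<phi> x))"

lemma C2_on_imp_C1_on:
  assumes "C2_on U f" shows "C1_on U f"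
  using assms unfolding C1_on_def C2_on_def
  by (meson has_derivative_continuous continuous_at_imp_continuous_on)

lemma C1_on_imp_continuous_on:
  assumes "C1_on U f" shows "continuous_on U f"
  using assms unfolding C1_on_def
  by (meson has_derivative_continuous continuous_at_imp_continuous_on)

lemma gradient_eqI:
  assumes "GDERIV f x :> D" shows "gradient f x = D"
  unfolding gradient_def
proof (rule the_equality)
  fix D' assume "GDERIV f x :> D'"
  then have "(\<lambda>h. h \<bullet> D') = (\<lambda>h. h \<bullet> D)"
    using assms has_derivative_unique unfolding gderiv_def by blast
  then have "h \<bullet> (D' - D) = 0" for h
    by (simp add: inner_diff_right fun_eq_iff)
  then show "D' = D"
    using inner_eq_zero_iff[of "D' - D"] by simp
qed (fact assms)

lemma gradient_eq_sum_Basis: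
  fixes f :: "'a::euclidean_space \<Rightarrow> real"
  assumes "(f has_derivative F) (at x)"
  shows "gradient f x = (\<Sum>b\<in>Basis. F b *\<^sub>R b)"
proof (rule gradient_eqI)
  interpret F: bounded_linear F
    using assms by (rule has_derivative_bounded_linear)
  have "F h = h \<bullet> (\<Sum>b\<in>Basis. F b *\<^sub>R b)" for h
    using F.scaleR[of "h \<bullet> _"] F.sum[of "\<lambda>b. (h \<bullet> b) *\<^sub>R b" Basis]
    by (simp add: euclidean_representation inner_sum_right mult.commute)
  then have "F = (\<lambda>h. h \<bullet> (\<Sum>b\<in>Basis. F b *\<^sub>R b))" by (rule ext)
  then show "GDERIV f x :> (\<Sum>b\<in>Basis. F b *\<^sub>R b)"
    unfolding gderiv_def using assms by simp
qed

lemma continuous_on_gradient: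
  fixes f :: "'a::euclidean_space \<Rightarrow> real"
  assumes "C1_on U f" shows "continuous_on U (gradient f)"
proof -
  obtain f' :: "'a \<Rightarrow> 'a \<Rightarrow>\<^sub>L real" where
    f': "\<And>x. x \<in> U \<Longrightarrow> (f has_derivative blinfun_apply (f' x)) (at x)" "continuous_on U f'"
    using assms unfolding C1_on_def by blast
  have "continuous_on U (\<lambda>x. \<Sum>b\<in>Basis. blinfun_apply (f' x) b *\<^sub>R b)"
    by (intro continuous_intros f'(2))
  then show ?thesis
    using gradient_eq_sum_Basis[OF f'(1)] by (simp cong: continuous_on_cong)
qed

lemma emeasure_graph_measure:
  fixes f :: "'a::euclidean_space \<Rightarrow> real"
  assumes "open U" "C1_on U f" and A: "A \<in> sets borel"
  shows "emeasure (graph_measure U f) A =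
    (\<integral>\<^sup>+x \<in> {x \<in> U. (x, f x) \<in> A}. ennreal (sqrt (1 + (norm (gradient f x))\<^sup>2)) \<partial>lborel)"
proof -
  let ?w = "\<lambda>x. ennreal (sqrt (1 + (norm (gradient f x))\<^sup>2))"
  let ?B = "{x \<in> U. (x, f x) \<in> A}"
  have U: "U \<in> sets lborel" using assms(1) by simp
  have restr: "measurable (restrict_space lborel U) N = measurable (restrict_space borel U) N"
    for N :: "'c measure"
    by (rule measurable_cong_sets) (simp_all add: sets_restrict_space)
  have w: "?w \<in> borel_measurable (restrict_space lborel U)"
  proof -
    have "(\<lambda>x. sqrt (1 + (norm (gradient f x))\<^sup>2)) \<in> borel_measurable (restrict_space borel U)"
      by (intro borel_measurable_continuous_on_restrict continuous_intros
          continuous_on_gradient assms(2))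
    then show ?thesis unfolding restr by measurable
  qed
  have g: "(\<lambda>x. (x, f x)) \<in> measurable (restrict_space lborel U) borel"
    unfolding restr
    by (intro borel_measurable_continuous_on_restrict continuous_intros
          C1_on_imp_continuous_on assms(2))
  have B: "(\<lambda>x. (x, f x)) -` A \<inter> space (restrict_space lborel U) = ?B"
    by (auto simp: space_restrict_space)
  have B': "?B \<in> sets (restrict_space lborel U)"
    using measurable_sets[OF g A] unfolding B .
  have "emeasure (graph_measure U f) A
      = (\<integral>\<^sup>+x. ?w x * indicator ?B x \<partial>restrict_space lborel U)"
    unfolding graph_measure_def using g w B B' A
    by (subst emeasure_distr) (simp_all add: emeasure_density)
  also have "\<dots> = (\<integral>\<^sup>+x. ?w x * indicator ?B x * indicator U x \<partial>lborel)"
    using U by (subst nn_integral_restrict_space) simp_all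
  also have "\<dots> = (\<integral>\<^sup>+x\<in>?B. ?w x \<partial>lborel)"
    by (intro nn_integral_cong) (auto simp: indicator_def)
  finally show ?thesis .
qed

lemma support_min_attained:
  fixes K :: "'a::euclidean_space set"
  assumes "compact K" "K \<noteq> {}" "K \<subseteq> U" "continuous_on U f"
  obtains p where "p \<in> graph_over U f" "fst p \<in> K" "support_min (graph_over U f) K v = p \<bullet> v"
    "\<And>p'. p' \<in> graph_over U f \<Longrightarrow> fst p' \<in> K \<Longrightarrow> p \<bullet> v \<le> p' \<bullet> v"
proof -
  have "continuous_on K (\<lambda>x. (x, f x) \<bullet> v)"
    using assms(3,4) by (intro continuous_intros) (auto intro: continuous_on_subset)
  then obtain x where x: "x \<in> K" "\<And>y. y \<in> K \<Longrightarrow> (x, f x) \<bullet> v \<le> (y, f y) \<bullet> v"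
    using continuous_attains_inf[OF assms(1,2)] by blast
  have eq: "{p \<in> graph_over U f. fst p \<in> K} = (\<lambda>x. (x, f x)) ` K"
    using assms(3) unfolding graph_over_def by auto
  have "support_min (graph_over U f) K v = (x, f x) \<bullet> v"
    unfolding support_min_def eq by (rule cInf_eq_minimum) (use x in auto)
  moreover have "(x, f x) \<in> graph_over U f"
    using x(1) assms(3) unfolding graph_over_def by auto
  moreover have "(x, f x) \<bullet> v \<le> p' \<bullet> v" if "p' \<in> graph_over U f" "fst p' \<in> K" for p'
    using x(2)[of "fst p'"] that unfolding graph_over_def by auto
  ultimately show ?thesis
    using x(1) that[of "(x, f x)"] by simp
qed

end

theory Submission
  imports Defs
begin

text \<open>
  Let \<open>v = \<xi> / \<bar>\<xi>\<bar>\<close>, \<open>P x = v \<bullet> (x, f x)\<close>, and let \<open>a\<close> minimize the convex function \<open>P\<close> on the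
  closed ball.  Averaging the integral over the dilations \<open>y \<mapsto> a + \<tau> y\<close> with \<open>1 \<le> \<tau> < 2\<close> reduces it
  to one-dimensional integrals over pieces of rays.  Along such a piece the derivative of the phase is
  monotone and at least \<open>P (a + y) - P a\<close>, so van der Corput's argument bounds the integral by a
  constant times \<open>min 1 (1 / (\<bar>\<xi>\<bar> (P (a + y) - P a)))\<close>, provided that the number of pieces is bounded
  independently of the ray.  A dyadic decomposition according to the size of \<open>P (a + y) - P a\<close>
  and the sublevel set hypothesis then give the result; the sum converges because \<open>\<alpha> < 1\<close>.

  That an analytic function \<open>g\<close> changes sign boundedly often on the line segments in a compact set is
  seen by expanding \<open>g (z + y + s w) = \<Sum>k. c k (y, w) * s ^ k\<close>.  By Hironaka division, finitely many
  coefficients dominate all the others near the origin: \<open>\<bar>c k\<bar> \<le> K * (\<Sum>j\<le>d. \<bar>c j\<bar>)\<close>.  Hence for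
  the largest of them, \<open>c J\<close> say, the \<open>J\<close>-th derivative in \<open>s\<close> does not vanish for small \<open>s\<close>.
\<close>

section \<open>Division of convergent power series\<close>

text \<open>The obstacle is uniformity: the minimizer \<open>a\<close> moves with \<open>v\<close>,
  possibly to the boundary of the ball, so rays start at arbitrary points and the number of pieces
  must be bounded for all of them at once. Lines near one on which some \<open>g\<close> vanishes
  identically are the hard case, since the order of vanishing of the restriction jumps there. A
  purely algebraic Noetherian argument would write each coefficient \<open>c k\<close> as a
  combination of finitely many, but with a polydisc and constants depending on \<open>k\<close>;
  therefore the division is done with estimates at a fixed radius. Dilations about \<open>a\<close>
  replace polar coordinates because the weight \<open>\<tau> ^ n\<close> and its derivative are
  bounded for \<tau> between 1 and 2, and because the resulting majorant is a function of the point
  \<open>x = a + y\<close>, to which the sublevel hypothesis applies directly. The lower bound for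
  the derivative of the phase asks for no critical point: with \<open>h t = P (a + t y)\<close>,
  convexity gives
  \<open>t * h' t \<ge> P (a + t y) - P a \<ge> t * (P (a + y) - P a)\<close>.\<close>

lemma incseq_subseq_nat:
  fixes s :: "nat \<Rightarrow> nat"
  obtains r where "strict_mono r" "incseq (s \<circ> r)"
proof -
  obtain r where r: "strict_mono r" "monoseq (\<lambda>n. s (r n))"
    using seq_monosub by blast
  show ?thesis
  proof (cases "incseq (\<lambda>n. s (r n))")
    case True
    then show ?thesis using that r by (simp add: o_def)
  next
    case False
    then have dec: "decseq (\<lambda>n. s (r n))"
      using r(2) monoseq_iff by blast
    \<comment> \<open>A decreasing sequence of naturals is constant from the place where its least
      value occurs, hence nondecreasing from there on.\<close>
    obtain N where N: "\<And>n. s (r N) \<le> s (r n)"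
      using ex_has_least_nat[of "\<lambda>_. True" _ "\<lambda>n. s (r n)"] by auto
    have "s (r (N + n)) = s (r N)" for n
      using N[of "N + n"] decseqD[OF dec, of N "N + n"] by simp
    then have "incseq (s \<circ> (\<lambda>n. r (N + n)))" by (simp add: incseq_def)
    moreover have "strict_mono (\<lambda>n. r (N + n))"
      using r(1) by (simp add: strict_mono_def)
    ultimately show ?thesis using that by blast
  qed
qed

lemma incseq_subseq_nat_family:
  fixes s :: "'i \<Rightarrow> nat \<Rightarrow> nat"
  assumes "finite I"
  shows "\<exists>r. strict_mono r \<and> (\<forall>i\<in>I. incseq (s i \<circ> r))"
  using assms
proof induction
  case empty
  then show ?case using strict_mono_id by blast
next
  case (insert i I)
  then obtain r where r: "strict_mono r" "\<forall>i\<in>I. incseq (s i \<circ> r)" by blast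
  obtain r' where r': "strict_mono r'" "incseq ((s i \<circ> r) \<circ> r')"
    using incseq_subseq_nat by blast
  have "incseq (s j \<circ> (r \<circ> r'))" if "j \<in> I" for j
    using r(2) that r'(1) unfolding incseq_def by (simp add: strict_mono_less_eq)
  then have "\<forall>j\<in>insert i I. incseq (s j \<circ> (r \<circ> r'))"
    using r'(2) by (simp add: o_assoc)
  then show ?case using strict_mono_o[OF r(1) r'(1)] by blast
qed

text \<open>
  A power series in finitely many variables is coded as a function on the natural numbers: the
  multi-index \<open>k\<close> becomes the number \<open>\<Prod>i. p i ^ k i\<close> for distinct primes \<open>p i\<close>.  Then divisibility of
  monomials is divisibility of numbers, multiplication of series is Dirichlet convolution, the linear
  order of the numbers is a monomial order, and a point of a polydisc is a completely multiplicative
  function bounded by a power of \<open>n\<close>.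
\<close>

definition smooth :: "nat set \<Rightarrow> nat set"
  where "smooth P = {n. n > 0 \<and> (\<forall>p. prime p \<longrightarrow> p dvd n \<longrightarrow> p \<in> P)}"

lemma smooth_mult: "m * n \<in> smooth P \<longleftrightarrow> m \<in> smooth P \<and> n \<in> smooth P"
  unfolding smooth_def by (auto simp: prime_dvd_mult_iff)

text \<open>The elements of \<open>B\<close> are minimal for divisibility, so none divides another.
  In a sequence of distinct elements of \<open>B\<close>, the exponents of the finitely many primes
  in \<open>P\<close> would all be nondecreasing along a common subsequence, and an earlier term
  would divide a later one.\<close>

lemma dickson_smooth:
  assumes "finite P" "A \<subseteq> smooth P"
  obtains B where "finite B" "B \<subseteq> A" "\<And>a. a \<in> A \<Longrightarrow> \<exists>b\<in>B. b dvd a"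
proof -
  define B where "B = {a \<in> A. \<forall>b\<in>A. b dvd a \<longrightarrow> b = a}"
  have cover: "\<exists>b\<in>B. b dvd a" if "a \<in> A" for a
    using that
  proof (induction a rule: less_induct)
    case (less a)
    show ?case
    proof (cases "a \<in> B")
      case False
      then obtain b where b: "b \<in> A" "b dvd a" "b \<noteq> a" using less.prems unfolding B_def by blast
      have "a > 0" using less.prems assms(2) unfolding smooth_def by auto
      then have "b < a" using b dvd_imp_le nat_less_le by blast
      then show ?thesis using less.IH b dvd_trans by blast
    qed (use dvd_refl in blast)
  qed
  have "finite B"
  proof (rule ccontr)
    assume "infinite B"
    then obtain s :: "nat \<Rightarrow> nat" where s: "inj s" "range s \<subseteq> B"
      using infinite_countable_subset by blast
    obtain r where r: "strict_mono r" "\<forall>p\<in>P. incseq ((\<lambda>n. multiplicity p (s n)) \<circ> r)"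
      using incseq_subseq_nat_family[OF assms(1), of "\<lambda>p n. multiplicity p (s n)"] by blast
    have sB: "s n \<in> B" for n using s(2) by blast
    then have S: "s n \<in> smooth P" for n using assms(2) unfolding B_def by blast
    have "s (r 0) dvd s (r 1)"
    proof (rule multiplicity_le_imp_dvd)
      show "s (r 0) \<noteq> 0" using S[of "r 0"] unfolding smooth_def by auto
      show "multiplicity p (s (r 0)) \<le> multiplicity p (s (r 1))" if "prime p" for p
      proof (cases "p \<in> P")
        case True
        then show ?thesis using r(2) unfolding incseq_def by simp
      next
        case False
        then have "\<not> p dvd s (r 0)" using S[of "r 0"] that unfolding smooth_def by auto
        then show ?thesis by (simp add: not_dvd_imp_multiplicity_0)
      qed
    qed
    then have "s (r 0) = s (r 1)" using sB unfolding B_def by blast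
    then have "r 0 = r 1" using s(1) by (simp add: inj_eq)
    then show False using strict_monoD[OF r(1), of 0 1] by simp
  qed
  then show ?thesis using that[of B] cover unfolding B_def by blast
qed

section \<open>Evaluation of coded power series\<close>

text \<open>Grouping the pairs \<open>(d, m)\<close> by their product \<open>n = d * m\<close> is a
  bijection only for positive numbers; the pairs with a zero factor drop out because
  \<open>a 0 = b 0 = 0\<close>.\<close>

lemma has_sum_mult_divisors:
  fixes a b :: "nat \<Rightarrow> real"
  assumes "(\<lambda>n. \<bar>a n\<bar>) summable_on UNIV" "(\<lambda>n. \<bar>b n\<bar>) summable_on UNIV" "a 0 = 0" "b 0 = 0"
  shows "((\<lambda>n. \<Sum>d | d dvd n. a d * b (n div d)) has_sum (infsum a UNIV * infsum b UNIV)) UNIV"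
proof -
  let ?f = "\<lambda>(d, m). a d * b m"
  have sa: "a summable_on UNIV" and sb: "b summable_on UNIV"
    using assms(1,2) abs_summable_summable[of a UNIV] abs_summable_summable[of b UNIV] by simp_all
  have "(\<lambda>x. norm (?f x)) summable_on UNIV \<times> UNIV"
  proof (rule summable_on_SigmaI[where g = "\<lambda>d. \<bar>a d\<bar> * infsum (\<lambda>n. \<bar>b n\<bar>) UNIV"])
    show "((\<lambda>y. norm (?f (x, y))) has_sum \<bar>a x\<bar> * (\<Sum>\<^sub>\<infinity>n. \<bar>b n\<bar>)) UNIV" for x
      using has_sum_cmult_right[OF has_sum_infsum[OF assms(2)], of "\<bar>a x\<bar>"] by (simp add: abs_mult)
  qed (auto intro!: summable_on_cmult_left assms)
  then have "?f summable_on UNIV \<times> UNIV" by (rule abs_summable_summable)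
  then have "(?f has_sum infsum a UNIV * infsum b UNIV) (UNIV \<times> UNIV)"
    by (rule has_sum_SigmaI[rotated 2])
      (auto intro!: has_sum_cmult_right has_sum_cmult_left has_sum_infsum sa sb)
  then have "(?f has_sum infsum a UNIV * infsum b UNIV) ({0<..} \<times> {0<..})"
    by (subst (asm) has_sum_cong_neutral[where T = "{0<..} \<times> {0<..}" and g = ?f])
      (use assms(3,4) in \<open>auto intro!: gr0I\<close>)
  then have "((\<lambda>(n, d). a d * b (n div d)) has_sum infsum a UNIV * infsum b UNIV)
      (Sigma {0<..} (\<lambda>n. {d. d dvd n}))"
    by (subst has_sum_reindex_bij_witness[where j = "\<lambda>(n, d). (d, n div d)" and i = "\<lambda>(d, m). (d * m, d)"
          and h = ?f and T = "{0<..} \<times> {0<..}", OF _ _ _ _ _ refl])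
      (auto simp: dvd_div_eq_0_iff intro: dvd_pos_nat elim!: dvdE)
  then have "((\<lambda>n. \<Sum>d | d dvd n. a d * b (n div d)) has_sum (infsum a UNIV * infsum b UNIV)) {0<..}"
    by (rule has_sum_SigmaD) (auto intro!: has_sum_finiteI)
  then show ?thesis
    by (subst (asm) has_sum_cong_neutral[where T = UNIV]) auto
qed

text \<open>Under the prime coding this is a Cauchy estimate on the polydisc with radii
  \<open>p i powr - \<sigma>\<close>, so raising \<sigma> shrinks the polydisc. Since
  \<open>0 powr \<sigma> = 0\<close> for every \<sigma>, it also forces \<open>a 0 = 0\<close>: the
  number 0 codes no monomial.\<close>

definition poly_bounded :: "real \<Rightarrow> real \<Rightarrow> (nat \<Rightarrow> real) \<Rightarrow> bool"
  where "poly_bounded M \<sigma> a \<longleftrightarrow> (\<forall>n. \<bar>a n\<bar> \<le> M * real n powr \<sigma>)"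

text \<open>These stand for the points of the closed polydisc with radii
  \<open>p i powr - \<sigma>\<close>; \<open>\<psi> n\<close> is the value at the point of the
  monomial coded by \<open>n\<close>.\<close>

definition mult_chars :: "real \<Rightarrow> (nat \<Rightarrow> real) set"
  where "mult_chars \<sigma> =
    {\<psi>. (\<forall>m n. \<psi> (m * n) = \<psi> m * \<psi> n) \<and> (\<forall>n. \<bar>\<psi> n\<bar> \<le> real n powr - \<sigma>)}"

definition series_at :: "(nat \<Rightarrow> real) \<Rightarrow> (nat \<Rightarrow> real) \<Rightarrow> real"
  where "series_at \<psi> a = (\<Sum>\<^sub>\<infinity>n. a n * \<psi> n)"

lemma poly_bounded_zero: "poly_bounded M \<sigma> a \<Longrightarrow> a 0 = 0"
  unfolding poly_bounded_def by (metis abs_le_zero_iff mult_zero_right of_nat_0 powr_0)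

lemma poly_bounded_nonneg: "poly_bounded M \<sigma> a \<Longrightarrow> 0 \<le> M"
  unfolding poly_bounded_def by (metis abs_ge_zero mult.right_neutral of_nat_1 order_trans powr_one_eq_one)

lemma powr_nat_mono: "\<sigma> \<le> \<tau> \<Longrightarrow> real n powr \<sigma> \<le> real n powr \<tau>"
  by (cases "n = 0") (auto intro: powr_mono)

lemma poly_bounded_mono:
  assumes "poly_bounded M \<sigma> a" "M \<le> M'" "\<sigma> \<le> \<sigma>'"
  shows "poly_bounded M' \<sigma>' a"
  unfolding poly_bounded_def
proof
  fix n
  have "\<bar>a n\<bar> \<le> M * real n powr \<sigma>" using assms(1) unfolding poly_bounded_def by blast
  also have "\<dots> \<le> M' * real n powr \<sigma>'"
    using assms poly_bounded_nonneg[OF assms(1)] by (intro mult_mono powr_nat_mono) auto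
  finally show "\<bar>a n\<bar> \<le> M' * real n powr \<sigma>'" .
qed

lemma mult_chars_antimono: "\<sigma> \<le> \<tau> \<Longrightarrow> mult_chars \<tau> \<subseteq> mult_chars \<sigma>"
  unfolding mult_chars_def using powr_nat_mono[of "- \<tau>" "- \<sigma>"] by (auto intro: order_trans)

lemma summable_on_inverse_square: "(\<lambda>n. real n powr -2) summable_on UNIV"
proof -
  have "summable (\<lambda>n. real n powr -2)" using summable_real_powr_iff[of "-2"] by simp
  then have "(\<lambda>n. real n powr -2) summable_on UNIV"
    by (intro norm_summable_imp_summable_on) auto
  then show ?thesis .
qed

lemma sum_inverse_square_le: "finite E \<Longrightarrow> (\<Sum>n\<in>E. real n powr -2) \<le> (\<Sum>\<^sub>\<infinity>n. real n powr -2)"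
  by (rule finite_sum_le_infsum[OF summable_on_inverse_square]) auto

text \<open>The gap of 2 between the growth of the coefficients and the decay of the character
  leaves the summable majorant \<open>n powr -2\<close>, which is the same for all \<psi>. The
  shifts by 2 below serve the same purpose.\<close>

lemma poly_bounded_char:
  assumes "poly_bounded M \<sigma> a" "\<psi> \<in> mult_chars (\<sigma> + 2)"
  shows "\<bar>a n * \<psi> n\<bar> \<le> M * real n powr -2"
proof -
  have "\<bar>a n * \<psi> n\<bar> \<le> (M * real n powr \<sigma>) * real n powr - (\<sigma> + 2)"
    unfolding abs_mult using assms unfolding poly_bounded_def mult_chars_def
    by (intro mult_mono) (auto intro: order_trans[OF abs_ge_zero])
  also have "\<dots> = M * (real n powr \<sigma> * real n powr - (\<sigma> + 2))" by simp
  also have "real n powr \<sigma> * real n powr - (\<sigma> + 2) = real n powr -2"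
    by (subst powr_add[symmetric]) simp
  finally show ?thesis .
qed

lemma poly_bounded_summable:
  assumes "poly_bounded M \<sigma> a" "\<psi> \<in> mult_chars (\<sigma> + 2)"
  shows "(\<lambda>n. \<bar>a n * \<psi> n\<bar>) summable_on UNIV"
  using summable_on_comparison_test[OF summable_on_cmult_right[OF summable_on_inverse_square]
      poly_bounded_char[OF assms]] by auto

lemma series_at_has_sum:
  assumes "poly_bounded M \<sigma> a" "\<psi> \<in> mult_chars (\<sigma> + 2)"
  shows "((\<lambda>n. a n * \<psi> n) has_sum series_at \<psi> a) UNIV"
  unfolding series_at_def
  using abs_summable_summable[of "\<lambda>n. a n * \<psi> n"] poly_bounded_summable[OF assms] by (auto simp: has_sum_infsum)

lemma series_at_bound:
  assumes "poly_bounded M \<sigma> a" "\<psi> \<in> mult_chars (\<sigma> + 2)"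
  shows "\<bar>series_at \<psi> a\<bar> \<le> M * (\<Sum>\<^sub>\<infinity>n. real n powr -2)"
proof -
  have "\<bar>series_at \<psi> a\<bar> \<le> (\<Sum>\<^sub>\<infinity>n. \<bar>a n * \<psi> n\<bar>)"
    unfolding series_at_def using norm_infsum_bound[of "\<lambda>n. a n * \<psi> n" UNIV] poly_bounded_summable[OF assms]
    by simp
  also have "\<dots> \<le> (\<Sum>\<^sub>\<infinity>n. M * real n powr -2)"
    by (intro infsum_mono poly_bounded_summable[OF assms] summable_on_cmult_right
        summable_on_inverse_square poly_bounded_char[OF assms])
  also have "\<dots> = M * (\<Sum>\<^sub>\<infinity>n. real n powr -2)" by (rule infsum_cmult_right')
  finally show ?thesis .
qed

text \<open>Evaluation is multiplicative: \<open>\<psi> n = \<psi> d * \<psi> (n div d)\<close>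
  turns the Dirichlet convolution into a product.\<close>

lemma series_at_divisor_sum:
  assumes a: "poly_bounded M \<sigma> a" and b: "poly_bounded M' \<sigma> b" and \<psi>: "\<psi> \<in> mult_chars (\<sigma> + 2)"
  shows "((\<lambda>n. (\<Sum>d | d dvd n. a d * b (n div d)) * \<psi> n) has_sum series_at \<psi> a * series_at \<psi> b) UNIV"
proof -
  have "((\<lambda>n. \<Sum>d | d dvd n. (a d * \<psi> d) * (b (n div d) * \<psi> (n div d))) has_sum
      series_at \<psi> a * series_at \<psi> b) UNIV"
    unfolding series_at_def
    by (rule has_sum_mult_divisors)
      (use poly_bounded_summable a b \<psi> poly_bounded_zero in auto)
  moreover have "(\<Sum>d | d dvd n. (a d * \<psi> d) * (b (n div d) * \<psi> (n div d)))
      = (\<Sum>d | d dvd n. a d * b (n div d)) * \<psi> n" for n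
    unfolding sum_distrib_right
  proof (rule sum.cong[OF refl])
    fix d assume "d \<in> {d. d dvd n}"
    then have "\<psi> n = \<psi> d * \<psi> (n div d)"
      using \<psi> unfolding mult_chars_def by (metis (mono_tags, lifting) dvd_mult_div_cancel mem_Collect_eq)
    then show "a d * \<psi> d * (b (n div d) * \<psi> (n div d)) = a d * b (n div d) * \<psi> n" by simp
  qed
  ultimately show ?thesis by simp
qed

section \<open>Division with estimates, and domination by finitely many series\<close>

lemma ex_less_recursion:
  fixes \<Phi> :: "(nat \<Rightarrow> 'a) \<Rightarrow> nat \<Rightarrow> 'a"
  assumes "\<And>G G' n. (\<And>m. m < n \<Longrightarrow> G m = G' m) \<Longrightarrow> \<Phi> G n = \<Phi> G' n"
  obtains G where "\<And>n. G n = \<Phi> G n"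
proof -
  have "wfrec less_than \<Phi> n = \<Phi> (wfrec less_than \<Phi>) n" for n
    by (subst wfrec[OF wf_less_than]) (rule assms, simp add: cut_apply)
  then show ?thesis using that by blast
qed

text \<open>On a small enough polydisc the leading term outweighs the rest of the series. For
  \<open>m > b\<close> the ratio \<open>b / m\<close> is at most \<open>b / (b + 1) < 1\<close>, so
  in the splitting of \<open>(b / m) powr \<rho>\<close> into the powers
  \<open>\<rho> - \<sigma> - 2\<close> and \<open>\<sigma> + 2\<close> the first factor tends to 0
  uniformly in \<open>m\<close>, while the second makes the sum converge.\<close>

lemma tail_weight_small:
  fixes b :: nat and \<eta> M \<sigma> :: real
  assumes "b > 0" "\<eta> > 0" "M \<ge> 0"
  shows "\<exists>\<tau>. \<forall>\<rho>\<ge>\<tau>. \<forall>f E. poly_bounded M \<sigma> f \<longrightarrow> finite E \<longrightarrow> E \<subseteq> {b<..} \<longrightarrow>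
    (\<Sum>m\<in>E. \<bar>f m\<bar> * (real m / real b) powr - \<rho>) \<le> \<eta>"
proof -
  define Z where "Z = (\<Sum>\<^sub>\<infinity>n. real n powr -2)"
  have Z: "Z \<ge> 0" unfolding Z_def by (rule infsum_nonneg) auto
  define K where "K = M * real b powr (\<sigma> + 2) * Z + 1"
  have K: "K > 0" using Z assms unfolding K_def by (smt (verit) mult_nonneg_nonneg powr_ge_zero)
  let ?x = "real b / real (b + 1)"
  have x: "0 < ?x" "?x < 1" using assms by auto
  have "((\<lambda>s. ?x powr s) \<longlongrightarrow> 0) at_top"
  proof -
    have "((\<lambda>s. exp (s * ln ?x)) \<longlongrightarrow> 0) at_top"
      using x by (intro filterlim_compose[OF exp_at_bot] filterlim_at_top_mult_tendsto_pos
          filterlim_tendsto_neg_mult_at_bot[OF tendsto_const _ filterlim_ident, of "ln ?x", simplified mult.commute])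
        (auto simp: mult.commute)
    then show ?thesis using x assms by (simp add: powr_def)
  qed
  then have "eventually (\<lambda>s. ?x powr s < \<eta> / K) at_top"
    using K assms by (intro order_tendstoD) auto
  then obtain s0 where s0: "\<And>s. s \<ge> s0 \<Longrightarrow> ?x powr s < \<eta> / K"
    unfolding eventually_at_top_linorder by blast
  show ?thesis
  \<comment> \<open>The absolute value of \<open>s0\<close> is added because \<open>s0\<close> may
    be negative: the exponent \<open>\<rho> - \<sigma> - 2\<close> must be at least
    \<open>s0\<close> and also nonnegative, the latter for monotonicity in the base.\<close>
  proof (intro exI[of _ "s0 + \<sigma> + 2 + \<bar>s0\<bar>"] allI impI)
    fix \<rho> f E
    assume \<rho>: "\<rho> \<ge> s0 + \<sigma> + 2 + \<bar>s0\<bar>" and f: "poly_bounded M \<sigma> f" and E: "finite E" "E \<subseteq> {b<..}"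
    have s: "\<rho> - \<sigma> - 2 \<ge> s0" "\<rho> - \<sigma> - 2 \<ge> 0" using \<rho> by linarith+
    have "\<bar>f m\<bar> * (real m / real b) powr - \<rho>
        \<le> M * real b powr (\<sigma> + 2) * (\<eta> / K) * real m powr -2" if m: "m \<in> E" for m
    proof -
      have mb: "m > b" using m E by auto
      have "(real m / real b) powr - \<rho> = (real b / real m) powr \<rho>"
        using mb assms by (simp add: powr_minus powr_divide)
      also have "\<dots> = (real b / real m) powr (\<rho> - \<sigma> - 2) * (real b / real m) powr (\<sigma> + 2)"
        by (subst powr_add[symmetric]) simp
      also have "\<dots> \<le> (\<eta> / K) * (real b / real m) powr (\<sigma> + 2)"
      proof (rule mult_right_mono)
        have "(real b / real m) powr (\<rho> - \<sigma> - 2) \<le> ?x powr (\<rho> - \<sigma> - 2)"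
          using mb assms s by (intro powr_mono2 divide_left_mono) auto
        also have "\<dots> \<le> \<eta> / K" using s0[OF s(1)] by simp
        finally show "(real b / real m) powr (\<rho> - \<sigma> - 2) \<le> \<eta> / K" .
      qed simp
      finally have 1: "(real m / real b) powr - \<rho> \<le> (\<eta> / K) * (real b / real m) powr (\<sigma> + 2)" .
      have "\<bar>f m\<bar> * (real m / real b) powr - \<rho> \<le>
          (M * real m powr \<sigma>) * ((\<eta> / K) * (real b / real m) powr (\<sigma> + 2))"
        using f 1 assms unfolding poly_bounded_def by (intro mult_mono) auto
      also have "(real b / real m) powr (\<sigma> + 2) = real b powr (\<sigma> + 2) * real m powr - (\<sigma> + 2)"
        unfolding powr_minus divide_inverse[symmetric] using mb by (simp add: powr_divide)
      also have "(M * real m powr \<sigma>) * ((\<eta> / K) * (real b powr (\<sigma> + 2) * real m powr - (\<sigma> + 2)))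
          = M * real b powr (\<sigma> + 2) * (\<eta> / K) * (real m powr \<sigma> * real m powr - (\<sigma> + 2))"
        by (simp add: algebra_simps)
      also have "real m powr \<sigma> * real m powr - (\<sigma> + 2) = real m powr -2"
        by (subst powr_add[symmetric]) simp
      finally show ?thesis .
    qed
    then have "(\<Sum>m\<in>E. \<bar>f m\<bar> * (real m / real b) powr - \<rho>)
        \<le> (\<Sum>m\<in>E. M * real b powr (\<sigma> + 2) * (\<eta> / K) * real m powr -2)" by (rule sum_mono)
    also have "\<dots> = M * real b powr (\<sigma> + 2) * (\<eta> / K) * (\<Sum>m\<in>E. real m powr -2)"
      by (rule sum_distrib_left[symmetric])
    also have "\<dots> \<le> M * real b powr (\<sigma> + 2) * (\<eta> / K) * Z"
      unfolding Z_def using assms K E by (intro mult_left_mono sum_inverse_square_le) auto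
    also have "\<dots> = (K - 1) * (\<eta> / K)" unfolding K_def by simp
    also have "\<dots> \<le> \<eta>" using K assms by (simp add: field_simps)
    finally show "(\<Sum>m\<in>E. \<bar>f m\<bar> * (real m / real b) powr - \<rho>) \<le> \<eta>" .
  qed
qed

text \<open>
  Hironaka division by the series \<open>F b\<close>, normalized to have leading term \<open>b\<close>.  The remainder contains
  no multiple of a leading term.
\<close>

lemma power_series_division:
  fixes F :: "nat \<Rightarrow> nat \<Rightarrow> real" and \<sigma> M :: real
  assumes "finite B" and B: "B \<subseteq> smooth P" and "M \<ge> 0"
    and F_supp: "\<And>b n. b \<in> B \<Longrightarrow> n \<notin> smooth P \<Longrightarrow> F b n = 0"
    and F_lead: "\<And>b. b \<in> B \<Longrightarrow> F b b = 1" "\<And>b n. b \<in> B \<Longrightarrow> n < b \<Longrightarrow> F b n = 0"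
    and F_bd: "\<And>b. b \<in> B \<Longrightarrow> poly_bounded M \<sigma> (F b)"
  shows "\<exists>\<tau>. \<forall>\<rho>\<ge>\<tau>. \<forall>M' H. poly_bounded M' \<rho> H \<longrightarrow> (\<forall>n. n \<notin> smooth P \<longrightarrow> H n = 0) \<longrightarrow>
    (\<exists>Q R. (\<forall>b\<in>B. poly_bounded (2 * M' * real b powr \<rho>) \<rho> (Q b)) \<and> poly_bounded (2 * M') \<rho> R \<and>
       (\<forall>n. n \<notin> smooth P \<longrightarrow> R n = 0) \<and> (\<forall>n. (\<exists>b\<in>B. b dvd n) \<longrightarrow> R n = 0) \<and>
       (\<forall>n. H n = R n + (\<Sum>b\<in>B. \<Sum>d | d dvd n. Q b d * F b (n div d))))"
proof -
  \<comment> \<open>The tails of all the divisors together weigh at most 1/2. This closes the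
    induction for \<open>G_bd\<close> and is the origin of the factor 2 in the bounds.\<close>
  define \<eta> :: real where "\<eta> = 1 / (2 * (real (card B) + 1))"
  have \<eta>: "\<eta> > 0" "real (card B) * \<eta> \<le> 1/2" unfolding \<eta>_def by (auto simp: field_simps)
  have B0: "b > 0" if "b \<in> B" for b using B that unfolding smooth_def by auto
  have "\<forall>b\<in>B. \<exists>\<tau>. \<forall>\<rho>\<ge>\<tau>. \<forall>f E. poly_bounded M \<sigma> f \<longrightarrow> finite E \<longrightarrow> E \<subseteq> {b<..} \<longrightarrow>
    (\<Sum>m\<in>E. \<bar>f m\<bar> * (real m / real b) powr - \<rho>) \<le> \<eta>"
    using tail_weight_small[OF B0 \<eta>(1) \<open>M \<ge> 0\<close>] by blast
  then obtain t where t: "\<And>b \<rho> f E. b \<in> B \<Longrightarrow> \<rho> \<ge> t b \<Longrightarrow> poly_bounded M \<sigma> f \<Longrightarrow> finite E \<Longrightarrow> E \<subseteq> {b<..} \<Longrightarrow>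
    (\<Sum>m\<in>E. \<bar>f m\<bar> * (real m / real b) powr - \<rho>) \<le> \<eta>" by metis
  show ?thesis
  proof (intro exI[of _ "\<Sum>b\<in>B. \<bar>t b\<bar>"] allI impI)
    fix \<rho> M' H
    assume \<rho>: "\<rho> \<ge> (\<Sum>b\<in>B. \<bar>t b\<bar>)" and H: "poly_bounded M' \<rho> H" and H_supp: "\<forall>n. n \<notin> smooth P \<longrightarrow> H n = 0"
    have tail: "(\<Sum>m\<in>E. \<bar>F b m\<bar> * (real m / real b) powr - \<rho>) \<le> \<eta>"
      if "b \<in> B" "finite E" "E \<subseteq> {b<..}" for b E
    proof (rule t[OF that(1) _ F_bd[OF that(1)] that(2,3)])
      have "t b \<le> \<bar>t b\<bar>" by simp
      also have "\<dots> \<le> (\<Sum>b\<in>B. \<bar>t b\<bar>)" using \<open>finite B\<close> that(1) by (intro member_le_sum) auto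
      finally show "t b \<le> \<rho>" using \<rho> by simp
    qed
    have M': "M' \<ge> 0" using H by (rule poly_bounded_nonneg)
    \<comment> \<open>A number may be a multiple of several leading terms; \<open>sel\<close>
      assigns it to one of them, which makes the division deterministic.\<close>
    define sel where "sel n = (SOME b. b \<in> B \<and> b dvd n)" for n
    have sel: "sel n \<in> B \<and> sel n dvd n" if "\<exists>b\<in>B. b dvd n" for n
      unfolding sel_def by (rule someI_ex) (use that in blast)
    define T where "T b d \<longleftrightarrow> b * d \<in> smooth P \<and> sel (b * d) = b" for b d
    \<comment> \<open>\<open>G\<close> collects the quotients and the remainder: at \<open>n\<close> it is the coefficient of \<open>Q b\<close> at
      \<open>n div b\<close> if \<open>sel n = b\<close>, and the coefficient of \<open>R\<close> if no \<open>b\<close> divides \<open>n\<close>.\<close>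
    define \<Phi> where "\<Phi> G n = H n - (\<Sum>b\<in>B. \<Sum>d | d dvd n \<and> b * d < n. (if T b d then G (b * d) else 0) * F b (n div d))"
      for G :: "nat \<Rightarrow> real" and n
    have "\<Phi> G n = \<Phi> G' n" if "\<And>m. m < n \<Longrightarrow> G m = G' m" for G G' n
      unfolding \<Phi>_def by (intro arg_cong2[of _ _ _ _ minus] sum.cong refl) (use that in auto)
    then obtain G where G: "\<And>n. G n = \<Phi> G n" using ex_less_recursion[of \<Phi>] by blast
    \<comment> \<open>The condition \<open>b * d < n\<close> means \<open>n div d > b\<close>, so
      only the tail of \<open>F b\<close> enters. By \<open>e\<close> the bound at
      \<open>b * d\<close> is the bound at \<open>n\<close> times the weight estimated in
      \<open>tail\<close>; the whole correction is thus at most half of the bound at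
      \<open>n\<close>, and \<open>H n\<close> takes at most the other half.\<close>
    have G_bd: "\<bar>G n\<bar> \<le> 2 * M' * real n powr \<rho>" for n
    proof (induction n rule: less_induct)
      case (less n)
      show ?case
      proof (cases "n = 0")
        case True
        then show ?thesis using G[of 0] poly_bounded_zero[OF H] unfolding \<Phi>_def by simp
      next
        case False
        let ?D = "\<lambda>b. {d. d dvd n \<and> b * d < n}"
        have fin: "finite (?D b)" for b using False by simp
        have "\<bar>\<Sum>d\<in>?D b. (if T b d then G (b * d) else 0) * F b (n div d)\<bar>
            \<le> 2 * M' * real n powr \<rho> * \<eta>" if b: "b \<in> B" for b
        proof -
          have "\<bar>\<Sum>d\<in>?D b. (if T b d then G (b * d) else 0) * F b (n div d)\<bar>
              \<le> (\<Sum>d\<in>?D b. 2 * M' * real n powr \<rho> * (\<bar>F b (n div d)\<bar> * (real (n div d) / real b) powr - \<rho>))"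
          proof (rule order_trans[OF sum_abs sum_mono])
            fix d assume d: "d \<in> ?D b"
            then have d0: "d > 0" using False by (auto intro: gr0I)
            obtain m where m: "n = d * m" using d by (auto elim: dvdE)
            have e: "(real (n div d) / real b) powr - \<rho> * real n powr \<rho> = real (b * d) powr \<rho>"
              using False d0 B0[OF b] unfolding m
              by (simp add: powr_minus powr_divide powr_mult field_simps)
            have "\<bar>if T b d then G (b * d) else 0\<bar> \<le> 2 * M' * real (b * d) powr \<rho>"
              using less[of "b * d"] d M' by auto
            then have "\<bar>(if T b d then G (b * d) else 0) * F b (n div d)\<bar>
                \<le> 2 * M' * real (b * d) powr \<rho> * \<bar>F b (n div d)\<bar>"
              unfolding abs_mult by (rule mult_right_mono) simp
            also have "\<dots> = 2 * M' * real n powr \<rho> * (\<bar>F b (n div d)\<bar> * (real (n div d) / real b) powr - \<rho>)"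
              unfolding e[symmetric] by (simp only: ac_simps)
            finally show "\<bar>(if T b d then G (b * d) else 0) * F b (n div d)\<bar>
              \<le> 2 * M' * real n powr \<rho> * (\<bar>F b (n div d)\<bar> * (real (n div d) / real b) powr - \<rho>)" .
          qed
          also have "\<dots> = 2 * M' * real n powr \<rho> * (\<Sum>d\<in>?D b. \<bar>F b (n div d)\<bar> * (real (n div d) / real b) powr - \<rho>)"
            by (rule sum_distrib_left[symmetric])
          also have "(\<Sum>d\<in>?D b. \<bar>F b (n div d)\<bar> * (real (n div d) / real b) powr - \<rho>)
              = (\<Sum>m\<in>(\<lambda>d. n div d) ` ?D b. \<bar>F b m\<bar> * (real m / real b) powr - \<rho>)"
          proof (rule sum.reindex_cong[symmetric, OF _ refl refl])
            show "inj_on (\<lambda>d. n div d) (?D b)"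
            proof (rule inj_onI)
              fix d d' assume dd: "d \<in> ?D b" "d' \<in> ?D b" "n div d = n div d'"
              then have "d * (n div d) = d' * (n div d)" by (metis (no_types, lifting) dvd_mult_div_cancel mem_Collect_eq)
              then show "d = d'" using dd False by (auto simp: dvd_div_eq_0_iff)
            qed
          qed
          also have "\<dots> \<le> \<eta>"
          proof (rule tail[OF b])
            show "(\<lambda>d. n div d) ` ?D b \<subseteq> {b<..}"
              using False by (auto elim!: dvdE)
          qed (use fin in simp)
          finally show ?thesis using M' by (simp add: mult_left_mono)
        qed
        then have "\<bar>\<Sum>b\<in>B. \<Sum>d\<in>?D b. (if T b d then G (b * d) else 0) * F b (n div d)\<bar>
            \<le> (\<Sum>b\<in>B. 2 * M' * real n powr \<rho> * \<eta>)"
          by (intro order_trans[OF sum_abs sum_mono]) auto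
        also have "\<dots> = 2 * M' * real n powr \<rho> * (real (card B) * \<eta>)" by simp
        also have "\<dots> \<le> 2 * M' * real n powr \<rho> * (1/2)"
          using \<eta>(2) M' by (intro mult_left_mono) auto
        finally have "\<bar>\<Sum>b\<in>B. \<Sum>d\<in>?D b. (if T b d then G (b * d) else 0) * F b (n div d)\<bar> \<le> M' * real n powr \<rho>"
          by simp
        moreover have "\<bar>H n\<bar> \<le> M' * real n powr \<rho>" using H unfolding poly_bounded_def by blast
        ultimately show ?thesis unfolding G[of n] \<Phi>_def by linarith
      qed
    qed
    define Q where "Q b d = (if T b d then G (b * d) else 0)" for b d
    define R where "R n = (if n \<in> smooth P \<and> \<not> (\<exists>b\<in>B. b dvd n) then G n else 0)" for n
    have "poly_bounded (2 * M' * real b powr \<rho>) \<rho> (Q b)" for b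
      unfolding poly_bounded_def Q_def using G_bd[of "b * _"] M' by (auto simp: powr_mult mult.assoc)
    moreover have "poly_bounded (2 * M') \<rho> R"
      unfolding poly_bounded_def R_def using G_bd M' by auto
    moreover have "H n = R n + (\<Sum>b\<in>B. \<Sum>d | d dvd n. Q b d * F b (n div d))" for n
    proof (cases "n \<in> smooth P")
      case False
      have "Q b d * F b (n div d) = 0" if "b \<in> B" "d dvd n" for b d
      proof (rule ccontr)
        assume "Q b d * F b (n div d) \<noteq> 0"
        then have "b * d \<in> smooth P" "n div d \<in> smooth P"
          using F_supp[OF that(1)] unfolding Q_def T_def by (auto split: if_splits)
        then have "d * (n div d) \<in> smooth P" by (simp add: smooth_mult)
        then show False using that(2) False by simp
      qed
      then have "(\<Sum>b\<in>B. \<Sum>d | d dvd n. Q b d * F b (n div d)) = 0"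
        by (intro sum.neutral ballI) simp
      then show ?thesis using False H_supp unfolding R_def by simp
    next
      case True
      then have n0: "n > 0" unfolding smooth_def by simp
      \<comment> \<open>If \<open>b * d > n\<close>, then \<open>n div d\<close> lies below the
        leading term of \<open>F b\<close> and the summand vanishes. If \<open>b * d = n\<close>, it
        meets the leading coefficient 1 and gives \<open>G n\<close> when \<open>n\<close> is
        assigned to \<open>b\<close>, and 0 otherwise.\<close>
      have split: "(\<Sum>d | d dvd n. Q b d * F b (n div d)) =
          (if (\<exists>b\<in>B. b dvd n) \<and> sel n = b then G n else 0) + (\<Sum>d | d dvd n \<and> b * d < n. Q b d * F b (n div d))"
        if b: "b \<in> B" for b
      proof -
        have fin: "finite {d. d dvd n}" using n0 by simp
        have "(\<Sum>d | d dvd n. Q b d * F b (n div d)) =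
            (\<Sum>d | d dvd n \<and> b * d = n. Q b d * F b (n div d)) + (\<Sum>d | d dvd n \<and> b * d < n. Q b d * F b (n div d))"
        proof (subst sum.union_disjoint[symmetric])
          show "(\<Sum>d | d dvd n. Q b d * F b (n div d)) =
            (\<Sum>d \<in> {d. d dvd n \<and> b * d = n} \<union> {d. d dvd n \<and> b * d < n}. Q b d * F b (n div d))"
          proof (rule sum.mono_neutral_right[OF fin])
            show "\<forall>d\<in>{d. d dvd n} - ({d. d dvd n \<and> b * d = n} \<union> {d. d dvd n \<and> b * d < n}). Q b d * F b (n div d) = 0"
              using F_lead(2)[OF b] n0 by (auto elim!: dvdE) (metis linorder_neqE_nat)
          qed auto
        qed (use fin in auto)
        also have "(\<Sum>d | d dvd n \<and> b * d = n. Q b d * F b (n div d))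
            = (if (\<exists>b\<in>B. b dvd n) \<and> sel n = b then G n else 0)"
        proof (cases "b dvd n")
          case True
          then have eq: "{d. d dvd n \<and> b * d = n} = {n div b}" using B0[OF b] by auto
          have "n div (n div b) = b" using True n0 B0[OF b] by (auto elim!: dvdE)
          then show ?thesis unfolding eq using True F_lead(1)[OF b] \<open>n \<in> smooth P\<close> b by (auto simp: Q_def T_def)
        next
          case False
          then have "{d. d dvd n \<and> b * d = n} = {}" by auto
          show ?thesis unfolding \<open>{d. d dvd n \<and> b * d = n} = {}\<close> using False sel[of n] by auto
        qed
        finally show ?thesis .
      qed
      have "(\<Sum>b\<in>B. \<Sum>d | d dvd n. Q b d * F b (n div d))
          = (\<Sum>b\<in>B. if (\<exists>b\<in>B. b dvd n) \<and> sel n = b then G n else 0)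
            + (\<Sum>b\<in>B. \<Sum>d | d dvd n \<and> b * d < n. Q b d * F b (n div d))"
        by (simp add: split sum.distrib)
      also have "(\<Sum>b\<in>B. \<Sum>d | d dvd n \<and> b * d < n. Q b d * F b (n div d)) = H n - G n"
        unfolding G[of n] \<Phi>_def Q_def by simp
      also have "(\<Sum>b\<in>B. if (\<exists>b\<in>B. b dvd n) \<and> sel n = b then G n else 0) = (if \<exists>b\<in>B. b dvd n then G n else 0)"
        using sel[of n] \<open>finite B\<close> by auto
      finally show ?thesis using True unfolding R_def by auto
    qed
    moreover have "\<forall>n. n \<notin> smooth P \<longrightarrow> R n = 0" "\<forall>n. (\<exists>b\<in>B. b dvd n) \<longrightarrow> R n = 0"
      unfolding R_def by auto
    ultimately show "\<exists>Q R. (\<forall>b\<in>B. poly_bounded (2 * M' * real b powr \<rho>) \<rho> (Q b)) \<and> poly_bounded (2 * M') \<rho> R \<and>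
       (\<forall>n. n \<notin> smooth P \<longrightarrow> R n = 0) \<and> (\<forall>n. (\<exists>b\<in>B. b dvd n) \<longrightarrow> R n = 0) \<and>
       (\<forall>n. H n = R n + (\<Sum>b\<in>B. \<Sum>d | d dvd n. Q b d * F b (n div d)))"
      by blast
  qed
qed

lemma has_sum_sum_fun:
  fixes f :: "'a \<Rightarrow> 'b \<Rightarrow> real"
  assumes "\<And>i. i \<in> I \<Longrightarrow> ((f i) has_sum s i) A"
  shows "((\<lambda>x. \<Sum>i\<in>I. f i x) has_sum (\<Sum>i\<in>I. s i)) A"
  using assms by (induction I rule: infinite_finite_induct) (auto intro: has_sum_add)

text \<open>A Noetherian property with estimates: \<open>d\<close>, the polydisc and
  \<open>K\<close> are the same for all \<open>k\<close>. The ideal \<open>J\<close> is described by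
  domination instead of generators, so that the remainder of a division belongs to it by the
  triangle inequality alone. Uniformity comes from the common bound \<open>M\<close> on the family,
  which bounds all the quotients at once.\<close>

theorem series_family_bound:
  fixes c :: "nat \<Rightarrow> nat \<Rightarrow> real"
  assumes "finite P" and c_bd: "\<And>k. poly_bounded M \<sigma> (c k)"
    and c_supp: "\<And>k n. n \<notin> smooth P \<Longrightarrow> c k n = 0"
  shows "\<exists>d \<rho> K. \<forall>k. \<forall>\<psi>\<in>mult_chars \<rho>. \<bar>series_at \<psi> (c k)\<bar> \<le> K * (\<Sum>j\<le>d. \<bar>series_at \<psi> (c j)\<bar>)"
proof -
  define S where "S \<psi> d = (\<Sum>j\<le>d. \<bar>series_at \<psi> (c j)\<bar>)" for \<psi> and d :: nat
  have S_mono: "S \<psi> d \<le> S \<psi> d'" if "d \<le> d'" for \<psi> d d'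
    unfolding S_def by (rule sum_mono2) (use that in auto)
  have S_nonneg: "S \<psi> d \<ge> 0" for \<psi> d unfolding S_def by (rule sum_nonneg) simp
  \<comment> \<open>An ideal containing all \<open>c k\<close>.  By Dickson's lemma its leading terms are generated by
    finitely many, and division by the corresponding elements leaves remainder 0.\<close>
  define J where "J = {F. (\<exists>M \<sigma>. poly_bounded M \<sigma> F) \<and> (\<forall>n. n \<notin> smooth P \<longrightarrow> F n = 0) \<and>
    (\<exists>d \<rho> K. \<forall>\<psi>\<in>mult_chars \<rho>. \<bar>series_at \<psi> F\<bar> \<le> K * S \<psi> d)}"
  define ld where "ld F = (LEAST n. F n \<noteq> 0)" for F :: "nat \<Rightarrow> real"
  have ld: "F (ld F) \<noteq> 0" "n < ld F \<Longrightarrow> F n = 0" if "\<exists>n. F n \<noteq> 0" for F n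
    unfolding ld_def using LeastI_ex[OF that] not_less_Least by auto
  define A where "A = ld ` {F \<in> J. \<exists>n. F n \<noteq> 0}"
  have "A \<subseteq> smooth P" unfolding A_def J_def using ld(1) by blast
  from dickson_smooth[OF assms(1) this] obtain B where B: "finite B" "B \<subseteq> A" "\<And>a. a \<in> A \<Longrightarrow> \<exists>b\<in>B. b dvd a"
    by metis
  define W where "W b F M \<sigma> d \<rho> K \<longleftrightarrow> poly_bounded M \<sigma> F \<and> (\<forall>n. n \<notin> smooth P \<longrightarrow> F n = 0) \<and>
      (\<forall>\<psi>\<in>mult_chars \<rho>. \<bar>series_at \<psi> F\<bar> \<le> K * S \<psi> d) \<and> F b = 1 \<and> (\<forall>n<b. F n = 0)"
    for b F M \<sigma> d \<rho> K
  have "\<exists>F M \<sigma> d \<rho> K. W b F M \<sigma> d \<rho> K" if b: "b \<in> B" for b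
  proof -
    obtain G where G: "G \<in> J" "\<exists>n. G n \<noteq> 0" "ld G = b" using b B(2) unfolding A_def by blast
    obtain M \<sigma> d \<rho> K where *: "poly_bounded M \<sigma> G" "\<forall>n. n \<notin> smooth P \<longrightarrow> G n = 0"
      "\<forall>\<psi>\<in>mult_chars \<rho>. \<bar>series_at \<psi> G\<bar> \<le> K * S \<psi> d" using G(1) unfolding J_def by blast
    have Gb: "G b \<noteq> 0" using ld(1)[OF G(2)] G(3) by simp
    show ?thesis
      unfolding W_def
    proof (intro exI conjI ballI allI impI)
      show "poly_bounded (M / \<bar>G b\<bar>) \<sigma> (\<lambda>n. G n / G b)"
        using *(1) Gb unfolding poly_bounded_def by (simp add: abs_divide divide_right_mono)
      show "G n / G b = 0" if "n \<notin> smooth P" for n using *(2) that by simp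
      show "\<bar>series_at \<psi> (\<lambda>n. G n / G b)\<bar> \<le> (K / \<bar>G b\<bar>) * S \<psi> d" if "\<psi> \<in> mult_chars \<rho>" for \<psi>
      proof -
        have "series_at \<psi> (\<lambda>n. G n / G b) = series_at \<psi> G / G b"
          unfolding series_at_def using infsum_cmult_left'[of "\<lambda>n. G n * \<psi> n" "inverse (G b)" UNIV]
          by (simp add: field_simps)
        then show ?thesis using *(3) that Gb by (simp add: abs_divide divide_right_mono)
      qed
      show "G b / G b = 1" using Gb by simp
      show "G n / G b = 0" if "n < b" for n using ld(2)[OF G(2)] that G(3) by simp
    qed
  qed
  then obtain F m s d r k where W: "\<And>b. b \<in> B \<Longrightarrow> W b (F b) (m b) (s b) (d b) (r b) (k b)"
    by metis
  have F: "\<And>b. b \<in> B \<Longrightarrow> poly_bounded (m b) (s b) (F b)"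
    "\<And>b n. b \<in> B \<Longrightarrow> n \<notin> smooth P \<Longrightarrow> F b n = 0"
    "\<And>b \<psi>. b \<in> B \<Longrightarrow> \<psi> \<in> mult_chars (r b) \<Longrightarrow> \<bar>series_at \<psi> (F b)\<bar> \<le> k b * S \<psi> (d b)"
    "\<And>b. b \<in> B \<Longrightarrow> F b b = 1" "\<And>b n. b \<in> B \<Longrightarrow> n < b \<Longrightarrow> F b n = 0"
    using W unfolding W_def by blast+
  \<comment> \<open>The sums over the finite set \<open>B\<close> are common upper bounds for the
    data of all the divisors.\<close>
  define m' where "m' = (\<Sum>b\<in>B. \<bar>m b\<bar>)"
  define s' where "s' = (\<Sum>b\<in>B. \<bar>s b\<bar>)"
  define r' where "r' = (\<Sum>b\<in>B. \<bar>r b\<bar>)"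
  define k' where "k' = (\<Sum>b\<in>B. \<bar>k b\<bar>)"
  define d' where "d' = (\<Sum>b\<in>B. d b)"
  have le: "m b \<le> m'" "s b \<le> s'" "r b \<le> r'" "k b \<le> k'" "d b \<le> d'" if "b \<in> B" for b
    unfolding m'_def s'_def r'_def k'_def d'_def
    by (rule order_trans[OF abs_ge_self member_le_sum[of _ _ "\<lambda>b. \<bar>_ b\<bar>"]], use that B(1) in auto)+
      (use that B(1) in \<open>auto intro: member_le_sum\<close>)
  have nn: "m' \<ge> 0" "k' \<ge> 0" unfolding m'_def k'_def by (auto intro: sum_nonneg)
  have F1: "poly_bounded m' s' (F b)" if "b \<in> B" for b
    using poly_bounded_mono[OF F(1)[OF that] le(1,2)[OF that]] .
  have F3: "\<bar>series_at \<psi> (F b)\<bar> \<le> k' * S \<psi> d'" if "b \<in> B" "\<psi> \<in> mult_chars r'" for b \<psi>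
  proof -
    have "\<bar>series_at \<psi> (F b)\<bar> \<le> k b * S \<psi> (d b)"
      using F(3) that mult_chars_antimono[OF le(3)[OF that(1)]] by blast
    also have "\<dots> \<le> k' * S \<psi> d'"
      using le(4,5)[OF that(1)] nn S_nonneg S_mono by (intro mult_mono) auto
    finally show ?thesis .
  qed
  have "B \<subseteq> smooth P" using B(2) \<open>A \<subseteq> smooth P\<close> by blast
  define Div where "Div \<rho> M' H \<longleftrightarrow>
      (\<exists>Q R. (\<forall>b\<in>B. poly_bounded (2 * M' * real b powr \<rho>) \<rho> (Q b)) \<and> poly_bounded (2 * M') \<rho> R \<and>
       (\<forall>n. n \<notin> smooth P \<longrightarrow> R n = 0) \<and> (\<forall>n. (\<exists>b\<in>B. b dvd n) \<longrightarrow> R n = 0) \<and>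
       (\<forall>n. H n = R n + (\<Sum>b\<in>B. \<Sum>d | d dvd n. Q b d * F b (n div d))))" for \<rho> M' H
  have "\<exists>\<tau>. \<forall>\<rho>\<ge>\<tau>. \<forall>M' H. poly_bounded M' \<rho> H \<longrightarrow> (\<forall>n. n \<notin> smooth P \<longrightarrow> H n = 0) \<longrightarrow> Div \<rho> M' H"
    unfolding Div_def
    by (intro power_series_division[where M = m' and \<sigma> = s'] B(1) nn(1) F(2,4,5) F1 \<open>B \<subseteq> smooth P\<close>)
  then obtain \<tau> where \<tau>: "\<And>\<rho> M' H. \<rho> \<ge> \<tau> \<Longrightarrow> poly_bounded M' \<rho> H \<Longrightarrow> (\<forall>n. n \<notin> smooth P \<longrightarrow> H n = 0) \<Longrightarrow>
      Div \<rho> M' H" by blast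
  \<comment> \<open>Beyond \<tau> division works; \<sigma> and \<open>s'\<close> bring the dividends
    and the divisors to the same exponent, and \<open>r'\<close> makes the domination estimates for
    the divisors available.\<close>
  define \<rho> where "\<rho> = max (max \<tau> \<sigma>) (max s' r')"
  have \<rho>: "\<rho> \<ge> \<tau>" "\<rho> \<ge> \<sigma>" "\<rho> \<ge> s'" "\<rho> \<ge> r'" unfolding \<rho>_def by auto
  define Z where "Z = (\<Sum>\<^sub>\<infinity>n. real n powr -2)"
  have Z: "Z \<ge> 0" unfolding Z_def by (rule infsum_nonneg) auto
  \<comment> \<open>The value of \<open>Q b\<close> is at most
    \<open>2 * M * b powr \<rho> * Z\<close> and that of \<open>F b\<close> at most
    \<open>k' * S \<psi> d'\<close>; neither bound depends on the index \<open>i\<close>.\<close>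
  define K where "K = (\<Sum>b\<in>B. 2 * M * real b powr \<rho> * Z * k')"
  have M: "M \<ge> 0" using c_bd poly_bounded_nonneg by blast
  have "\<bar>series_at \<psi> (c i)\<bar> \<le> K * S \<psi> d'" if \<psi>: "\<psi> \<in> mult_chars (\<rho> + 2)" for i \<psi>
  proof -
    have ci: "poly_bounded M \<rho> (c i)" using poly_bounded_mono[OF c_bd order_refl \<rho>(2)] .
    have "Div \<rho> M (c i)" using \<tau>[OF \<rho>(1) ci] c_supp by blast
    then obtain Q R where Q': "\<forall>b\<in>B. poly_bounded (2 * M * real b powr \<rho>) \<rho> (Q b)"
      and R: "poly_bounded (2 * M) \<rho> R" "\<forall>n. n \<notin> smooth P \<longrightarrow> R n = 0" "\<forall>n. (\<exists>b\<in>B. b dvd n) \<longrightarrow> R n = 0"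
      and eq': "\<forall>n. c i n = R n + (\<Sum>b\<in>B. \<Sum>d | d dvd n. Q b d * F b (n div d))"
      unfolding Div_def by (elim exE conjE) (rule that)
    note Q = Q'[rule_format] and eq = eq'[rule_format]
    have Fb: "poly_bounded m' \<rho> (F b)" if "b \<in> B" for b
      using poly_bounded_mono[OF F1[OF that] order_refl \<rho>(3)] .
    have expand: "series_at \<psi> (c i) = series_at \<psi> R + (\<Sum>b\<in>B. series_at \<psi> (Q b) * series_at \<psi> (F b))"
      if \<psi>: "\<psi> \<in> mult_chars (\<rho> + 2)" for \<psi>
    proof -
      have "((\<lambda>n. R n * \<psi> n + (\<Sum>b\<in>B. (\<Sum>d | d dvd n. Q b d * F b (n div d)) * \<psi> n)) has_sum
          (series_at \<psi> R + (\<Sum>b\<in>B. series_at \<psi> (Q b) * series_at \<psi> (F b)))) UNIV"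
        by (intro has_sum_add has_sum_sum_fun series_at_has_sum[OF R(1)]
            series_at_divisor_sum[OF Q Fb] \<psi>)
      then have "((\<lambda>n. c i n * \<psi> n) has_sum
          (series_at \<psi> R + (\<Sum>b\<in>B. series_at \<psi> (Q b) * series_at \<psi> (F b)))) UNIV"
        by (simp add: eq distrib_right sum_distrib_right)
      then show ?thesis using series_at_has_sum[OF ci \<psi>] has_sum_unique by blast
    qed
    have QF: "\<bar>\<Sum>b\<in>B. series_at \<psi> (Q b) * series_at \<psi> (F b)\<bar> \<le> K * S \<psi> d'"
      if \<psi>: "\<psi> \<in> mult_chars (\<rho> + 2)" for \<psi>
    proof -
      have "\<psi> \<in> mult_chars r'" using \<psi> mult_chars_antimono[of r' "\<rho> + 2"] \<rho>(4) by auto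
      then have "\<bar>series_at \<psi> (Q b) * series_at \<psi> (F b)\<bar> \<le> (2 * M * real b powr \<rho> * Z) * (k' * S \<psi> d')"
        if "b \<in> B" for b
        unfolding abs_mult Z_def using series_at_bound[OF Q[OF that] \<psi>] F3[OF that] M Z
        by (intro mult_mono) (auto simp: Z_def)
      then have "\<bar>\<Sum>b\<in>B. series_at \<psi> (Q b) * series_at \<psi> (F b)\<bar>
          \<le> (\<Sum>b\<in>B. (2 * M * real b powr \<rho> * Z) * (k' * S \<psi> d'))"
        by (intro order_trans[OF sum_abs sum_mono]) auto
      then show ?thesis unfolding K_def by (simp add: sum_distrib_right mult.assoc)
    qed
    have K: "K \<ge> 0" unfolding K_def using M Z nn by (intro sum_nonneg) auto
    \<comment> \<open>The witness \<open>i + d'\<close> grows with \<open>i\<close>, which is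
      harmless: membership in \<open>J\<close> forces \<open>R = 0\<close>, and then only the terms
      bounded by \<open>K * S \<psi> d'\<close> are left.\<close>
    have "R \<in> J"
      unfolding J_def
    proof (intro CollectI conjI exI ballI)
      show "poly_bounded (2 * M) \<rho> R" "\<forall>n. n \<notin> smooth P \<longrightarrow> R n = 0" by fact+
      fix \<psi> assume \<psi>: "\<psi> \<in> mult_chars (\<rho> + 2)"
      have "\<bar>series_at \<psi> R\<bar> \<le> \<bar>series_at \<psi> (c i)\<bar> + K * S \<psi> d'"
        using expand[OF \<psi>] QF[OF \<psi>] by linarith
      also have "\<bar>series_at \<psi> (c i)\<bar> \<le> S \<psi> (i + d')"
        unfolding S_def by (rule member_le_sum) auto
      also have "S \<psi> (i + d') + K * S \<psi> d' \<le> (1 + K) * S \<psi> (i + d')"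
        using K S_mono[of d' "i + d'" \<psi>] by (simp add: distrib_right mult_left_mono)
      finally show "\<bar>series_at \<psi> R\<bar> \<le> (1 + K) * S \<psi> (i + d')" by simp
    qed
    have "R n = 0" for n
    proof (rule ccontr)
      assume "R n \<noteq> 0"
      then have ex: "\<exists>n. R n \<noteq> 0" by blast
      then have "ld R \<in> A" using \<open>R \<in> J\<close> unfolding A_def by blast
      then show False using B(3) R(3) ld(1)[OF ex] by blast
    qed
    then have "series_at \<psi> R = 0" unfolding series_at_def by simp
    then show ?thesis using expand[OF \<psi>] QF[OF \<psi>] by simp
  qed
  then show ?thesis unfolding S_def by blast
qed

section \<open>Restriction of an analytic function to lines\<close>

lemma ex_inj_primes: "\<exists>p :: 'k::finite \<Rightarrow> nat. inj p \<and> (\<forall>i. prime (p i))"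
proof -
  obtain B :: "nat set" where B: "finite B" "card B = CARD('k)" "B \<subseteq> {p. prime p}"
    using infinite_arbitrarily_large[OF primes_infinite] by blast
  obtain h :: "'k \<Rightarrow> nat" where "bij_betw h UNIV B"
    using finite_same_card_bij[OF finite B(1)] B(2) by auto
  then show ?thesis using B(3) unfolding bij_betw_def by blast
qed

lemma prod_sum_type:
  fixes f :: "'a::finite + 'b::finite \<Rightarrow> 'c::comm_monoid_mult"
  shows "(\<Prod>i\<in>UNIV. f i) = (\<Prod>i\<in>UNIV. f (Inl i)) * (\<Prod>i\<in>UNIV. f (Inr i))"
  unfolding UNIV_Plus_UNIV[symmetric] by (subst prod.Plus) auto

locale prime_coding =
  fixes p :: "'k::finite \<Rightarrow> nat"
  assumes inj_p: "inj p" and prime_p: "\<And>i. prime (p i)"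
begin

definition code :: "('k \<Rightarrow> nat) \<Rightarrow> nat" where "code \<alpha> = (\<Prod>i\<in>UNIV. p i ^ \<alpha> i)"

abbreviation S where "S \<equiv> smooth (range p)"

text \<open>The value 0 off \<open>S\<close> preserves complete multiplicativity, because a product
  lies in \<open>S\<close> only if both factors do.\<close>

definition monomial_char :: "('k \<Rightarrow> real) \<Rightarrow> nat \<Rightarrow> real"
  where "monomial_char x n = (if n \<in> S then (\<Prod>i\<in>UNIV. x i ^ multiplicity (p i) n) else 0)"

lemma prime_p_nonzero: "p i \<noteq> 0"
  using prime_p[of i] by (metis not_prime_0)

lemma multiplicity_code: "multiplicity (p i) (code \<alpha>) = \<alpha> i"
proof -
  have "multiplicity (p i) (code \<alpha>) = (\<Sum>j\<in>UNIV. multiplicity (p i) (p j ^ \<alpha> j))"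
    unfolding code_def
    by (rule prime_elem_multiplicity_prod_distrib) (use prime_p in \<open>auto simp: prime_p_nonzero\<close>)
  also have "\<dots> = (\<Sum>j\<in>UNIV. if j = i then \<alpha> i else 0)"
  proof (rule sum.cong[OF refl])
    fix j
    show "multiplicity (p i) (p j ^ \<alpha> j) = (if j = i then \<alpha> i else 0)"
      using prime_p inj_p by (auto simp: prime_multiplicity_other[OF prime_p prime_p] inj_eq
          prime_elem_multiplicity_power_distrib multiplicity_distinct_prime_power)
  qed
  finally show ?thesis by simp
qed

lemma code_in_S: "code \<alpha> \<in> S"
  unfolding smooth_def
proof (intro CollectI conjI allI impI)
  show "code \<alpha> > 0" unfolding code_def using prime_p_nonzero by (auto intro!: prod_pos)
  fix q assume q: "prime q" "q dvd code \<alpha>"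
  then obtain i where "q dvd p i ^ \<alpha> i" unfolding code_def by (auto simp: prime_dvd_prod_iff)
  then have "q = p i" using q(1) prime_p by (metis prime_dvd_power primes_dvd_imp_eq)
  then show "q \<in> range p" by simp
qed

lemma code_multiplicity:
  assumes "n \<in> S" shows "code (\<lambda>i. multiplicity (p i) n) = n"
proof (rule multiplicity_eq_nat)
  show "code (\<lambda>i. multiplicity (p i) n) > 0" using code_in_S unfolding smooth_def by blast
  show "n > 0" using assms unfolding smooth_def by blast
  fix q :: nat assume q: "prime q"
  show "multiplicity q (code (\<lambda>i. multiplicity (p i) n)) = multiplicity q n"
  proof (cases "q \<in> range p")
    case True
    then show ?thesis using multiplicity_code by auto
  next
    case False
    then have "\<not> q dvd m" if "m \<in> S" for m using that q unfolding smooth_def by auto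
    then show ?thesis using assms code_in_S by (simp add: not_dvd_imp_multiplicity_0)
  qed
qed

lemma monomial_char_mult: "monomial_char x (m * n) = monomial_char x m * monomial_char x n"
proof (cases "m * n \<in> S")
  case True
  then have "m \<in> S" "n \<in> S" by (auto simp: smooth_mult)
  then show ?thesis using True unfolding monomial_char_def smooth_def
    by (simp add: prime_elem_multiplicity_mult_distrib prime_p power_add prod.distrib)
next
  case False
  then show ?thesis unfolding monomial_char_def by (auto simp: smooth_mult)
qed

text \<open>The coordinate bounds, raised to the exponents of \<open>n\<close>, multiply up to
  \<open>n powr - \<rho>\<close> by unique factorization.\<close>

lemma monomial_char_in_mult_chars:
  assumes "\<And>i. \<bar>x i\<bar> \<le> real (p i) powr - \<rho>"
  shows "monomial_char x \<in> mult_chars \<rho>"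
  unfolding mult_chars_def
proof (intro CollectI conjI allI)
  fix m n
  show "monomial_char x (m * n) = monomial_char x m * monomial_char x n" by (rule monomial_char_mult)
next
  fix n
  show "\<bar>monomial_char x n\<bar> \<le> real n powr - \<rho>"
  proof (cases "n \<in> S")
    case True
    then have "\<bar>monomial_char x n\<bar> = (\<Prod>i\<in>UNIV. \<bar>x i\<bar> ^ multiplicity (p i) n)"
      unfolding monomial_char_def by (simp add: abs_prod power_abs)
    also have "\<dots> \<le> (\<Prod>i\<in>UNIV. (real (p i) powr - \<rho>) ^ multiplicity (p i) n)"
      using assms by (intro prod_mono conjI power_mono) auto
    also have "\<dots> = (\<Prod>i\<in>UNIV. real (p i ^ multiplicity (p i) n) powr - \<rho>)"
      using prime_p by (intro prod.cong refl) (simp add: powr_realpow[symmetric] powr_powr prime_gt_0_nat powr_power mult.commute)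
    also have "\<dots> = real (code (\<lambda>i. multiplicity (p i) n)) powr - \<rho>"
      unfolding code_def by (simp add: prod_powr_distrib[symmetric])
    finally show ?thesis using code_multiplicity[OF True] by simp
  qed (simp add: monomial_char_def)
qed

end

lemma prod_binomial:
  fixes y w :: "'n::finite \<Rightarrow> real"
  shows "(\<Prod>i\<in>UNIV. (y i + w i) ^ \<beta> i) =
    (\<Sum>\<gamma> | \<forall>i. \<gamma> i \<le> \<beta> i. (\<Prod>i\<in>UNIV. real (\<beta> i choose \<gamma> i)) * (\<Prod>i\<in>UNIV. y i ^ (\<beta> i - \<gamma> i)) * (\<Prod>i\<in>UNIV. w i ^ \<gamma> i))"
proof -
  have "(\<Prod>i\<in>UNIV. (y i + w i) ^ \<beta> i)
      = (\<Prod>i\<in>UNIV. \<Sum>k\<le>\<beta> i. real (\<beta> i choose k) * w i ^ k * y i ^ (\<beta> i - k))"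
    by (subst add.commute) (simp add: binomial_ring)
  also have "\<dots> = (\<Sum>\<gamma>\<in>PiE UNIV (\<lambda>i. {..\<beta> i}). \<Prod>i\<in>UNIV. real (\<beta> i choose \<gamma> i) * w i ^ \<gamma> i * y i ^ (\<beta> i - \<gamma> i))"
    by (rule prod_sum_PiE) auto
  also have "PiE UNIV (\<lambda>i. {..\<beta> i}) = {\<gamma>. \<forall>i. \<gamma> i \<le> \<beta> i}"
    by (auto simp: PiE_def Pi_def)
  finally show ?thesis by (simp add: prod.distrib mult_ac)
qed

section \<open>Expansion in the base point and the direction jointly\<close>

text \<open>The primes indexed by \<open>Inl\<close> code the coordinates of \<open>y\<close>, those
  indexed by \<open>Inr\<close> the coordinates of \<open>w\<close>. The coefficients are controlled
  at radius \<open>2 * \<eta>\<close> so that the factor 2 can pay for the binomial coefficients of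
  \<open>(y + w) ^ \<beta>\<close>.\<close>

locale shifted_series = prime_coding p for p :: "'n::finite + 'n \<Rightarrow> nat" +
  fixes b :: "('n \<Rightarrow> nat) \<Rightarrow> real" and M \<eta> :: real
  assumes \<eta>: "0 < \<eta>" "\<eta> \<le> 1" and M: "\<And>\<beta>. \<bar>b \<beta>\<bar> * (2 * \<eta>) ^ (\<Sum>i\<in>UNIV. \<beta> i) \<le> M"
begin

definition mL where "mL n i = multiplicity (p (Inl i)) n"
definition mR where "mR n i = multiplicity (p (Inr i)) n"
definition deg where "deg n = (\<Sum>i\<in>UNIV. mR n i)"

text \<open>The coefficients of \<open>\<Sum>\<beta>. b \<beta> * (y + w) ^ \<beta>\<close> as a power series in \<open>(y, w)\<close>.\<close>

definition coef :: "nat \<Rightarrow> real"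
  where "coef n = (if n \<in> S then b (\<lambda>i. mL n i + mR n i) * (\<Prod>i\<in>UNIV. real (mL n i + mR n i choose mR n i)) else 0)"

text \<open>The part homogeneous of degree \<open>k\<close> in \<open>w\<close>: its value at
  \<open>(y, w)\<close> is the coefficient of \<open>s ^ k\<close> along the line
  \<open>y + s w\<close>.\<close>

definition coef_deg :: "nat \<Rightarrow> nat \<Rightarrow> real" where "coef_deg k n = (if deg n = k then coef n else 0)"

text \<open>Chosen with \<open>2 powr \<sigma> = 1 / \<eta>\<close>. Every prime is at least 2, so a
  monomial of total degree \<open>N\<close> has a code \<open>n \<ge> 2 ^ N\<close>, whence
  \<open>(1 / \<eta>) ^ N \<le> n powr \<sigma>\<close>.\<close>

definition \<sigma> where "\<sigma> = log 2 (1 / \<eta>)"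

lemma M_nonneg: "M \<ge> 0"
  using M[of "\<lambda>_. 0"] abs_ge_zero by (simp add: order_trans[OF abs_ge_zero])

lemma poly_bounded_coef: "poly_bounded M \<sigma> coef"
  unfolding poly_bounded_def
proof
  fix n
  show "\<bar>coef n\<bar> \<le> M * real n powr \<sigma>"
  proof (cases "n \<in> S")
    case True
    define \<beta> where "\<beta> i = mL n i + mR n i" for i
    let ?N = "\<Sum>i\<in>UNIV. \<beta> i"
    have "(\<Prod>i\<in>UNIV. real (\<beta> i choose mR n i)) \<le> (\<Prod>i\<in>UNIV. 2 ^ \<beta> i)"
    proof (intro prod_mono conjI)
      fix i
      have "\<beta> i choose mR n i \<le> 2 ^ \<beta> i" by (rule binomial_le_pow2)
      then show "real (\<beta> i choose mR n i) \<le> 2 ^ \<beta> i" by (metis of_nat_le_iff of_nat_numeral of_nat_power)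
    qed auto
    also have "\<dots> = 2 ^ ?N" by (simp add: power_sum)
    finally have "\<bar>coef n\<bar> \<le> \<bar>b \<beta>\<bar> * 2 ^ ?N"
      unfolding coef_def \<beta>_def using True by (simp add: abs_mult abs_prod mult_left_mono)
    also have "\<dots> = \<bar>b \<beta>\<bar> * (2 * \<eta>) ^ ?N * (1 / \<eta>) ^ ?N"
      using \<eta> by (simp add: power_mult_distrib power_divide)
    also have "\<dots> \<le> M * (1 / \<eta>) ^ ?N" using M \<eta> by (intro mult_right_mono) auto
    also have "(1 / \<eta>) ^ ?N = (2 ^ ?N) powr \<sigma>"
    proof -
      have "1 / \<eta> = 2 powr \<sigma>" unfolding \<sigma>_def using \<eta> by simp
      then show ?thesis by (simp add: powr_realpow[symmetric] powr_powr mult.commute)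
    qed
    also have "M * (2 ^ ?N) powr \<sigma> \<le> M * real n powr \<sigma>"
    proof (intro mult_left_mono powr_mono2 M_nonneg)
      show "\<sigma> \<ge> 0" unfolding \<sigma>_def using \<eta> by simp
      have "(2::nat) ^ ?N = (\<Prod>i\<in>UNIV. 2 ^ \<beta> i)" by (simp add: power_sum)
      also have "\<dots> = (\<Prod>i\<in>UNIV. 2 ^ mL n i) * (\<Prod>i\<in>UNIV. 2 ^ mR n i)"
        unfolding \<beta>_def by (simp add: power_add prod.distrib)
      also have "\<dots> \<le> (\<Prod>i\<in>UNIV. p (Inl i) ^ mL n i) * (\<Prod>i\<in>UNIV. p (Inr i) ^ mR n i)"
        by (intro mult_mono prod_mono conjI power_mono) (auto intro: prime_ge_2_nat prime_p)
      also have "\<dots> = code (\<lambda>i. multiplicity (p i) n)"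
        unfolding code_def mL_def mR_def by (subst prod_sum_type) simp
      also have "\<dots> = n" by (rule code_multiplicity[OF True])
      finally show "2 ^ ?N \<le> real n" by (metis of_nat_le_iff of_nat_numeral of_nat_power)
    qed simp
    finally show ?thesis .
  qed (use M_nonneg in \<open>simp add: coef_def\<close>)
qed

lemma poly_bounded_coef_deg: "poly_bounded M \<sigma> (coef_deg k)"
  using poly_bounded_coef M_nonneg unfolding poly_bounded_def coef_deg_def by auto

lemma monomial_char_scale:
  "monomial_char (case_sum y (\<lambda>i. s * w i)) n = monomial_char (case_sum y w) n * s ^ deg n"
  unfolding monomial_char_def
  by (auto simp: prod_sum_type deg_def mR_def power_mult_distrib prod.distrib power_sum)

text \<open>The coded series in \<open>(y, w)\<close> converges absolutely, so it may be summed in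
  any order. The code \<open>n\<close> corresponds to the pair of \<beta>, the total exponents, and
  \<gamma>, those of \<open>w\<close>; summing over \<gamma> first undoes the binomial
  expansion.\<close>

lemma has_sum_shift:
  assumes "monomial_char (case_sum y w) \<in> mult_chars (\<sigma> + 2)"
  shows "((\<lambda>\<beta>. b \<beta> * (\<Prod>i\<in>UNIV. (y i + w i) ^ \<beta> i)) has_sum
    series_at (monomial_char (case_sum y w)) coef) UNIV"
proof -
  let ?x = "case_sum y w"
  have "((\<lambda>n. coef n * monomial_char ?x n) has_sum series_at (monomial_char ?x) coef) S"
    using series_at_has_sum[OF poly_bounded_coef assms]
    by (subst (asm) has_sum_cong_neutral[where T = S and g = "\<lambda>n. coef n * monomial_char ?x n"])
      (auto simp: coef_def)
  then have "((\<lambda>(\<beta>, \<gamma>). b \<beta> * ((\<Prod>i\<in>UNIV. real (\<beta> i choose \<gamma> i)) * (\<Prod>i\<in>UNIV. y i ^ (\<beta> i - \<gamma> i)) * (\<Prod>i\<in>UNIV. w i ^ \<gamma> i)))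
      has_sum series_at (monomial_char ?x) coef) (Sigma UNIV (\<lambda>\<beta>. {\<gamma>. \<forall>i. \<gamma> i \<le> \<beta> i}))"
  proof (rule has_sum_reindex_bij_witness[where i = "\<lambda>(\<beta>, \<gamma>). code (case_sum (\<lambda>i. \<beta> i - \<gamma> i) \<gamma>)"
        and j = "\<lambda>n. (\<lambda>i. mL n i + mR n i, mR n)", THEN iffD1, rotated -1])
    fix n assume n: "n \<in> S"
    have "case_sum (\<lambda>i. mL n i + mR n i - mR n i) (mR n) = (\<lambda>i. multiplicity (p i) n)"
      by (rule ext) (auto simp: mL_def mR_def split: sum.split)
    then show "(case (\<lambda>i. mL n i + mR n i, mR n) of (\<beta>, \<gamma>) \<Rightarrow> code (case_sum (\<lambda>i. \<beta> i - \<gamma> i) \<gamma>)) = n"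
      using code_multiplicity[OF n] by simp
    show "(case (\<lambda>i. mL n i + mR n i, mR n) of (\<beta>, \<gamma>) \<Rightarrow>
        b \<beta> * ((\<Prod>i\<in>UNIV. real (\<beta> i choose \<gamma> i)) * (\<Prod>i\<in>UNIV. y i ^ (\<beta> i - \<gamma> i)) * (\<Prod>i\<in>UNIV. w i ^ \<gamma> i)))
      = coef n * monomial_char ?x n"
      using n unfolding coef_def monomial_char_def
      by (simp add: prod_sum_type mL_def mR_def mult.assoc)
  next
    fix a :: "('n \<Rightarrow> nat) \<times> ('n \<Rightarrow> nat)" assume "a \<in> (SIGMA \<beta>:UNIV. {\<gamma>. \<forall>i. \<gamma> i \<le> \<beta> i})"
    then obtain \<beta> \<gamma> where a: "a = (\<beta>, \<gamma>)" "\<And>i. \<gamma> i \<le> \<beta> i" by auto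
    have "mL (code (case_sum (\<lambda>i. \<beta> i - \<gamma> i) \<gamma>)) = (\<lambda>i. \<beta> i - \<gamma> i)"
      "mR (code (case_sum (\<lambda>i. \<beta> i - \<gamma> i) \<gamma>)) = \<gamma>"
      unfolding mL_def mR_def multiplicity_code by auto
    then show "(\<lambda>n. (\<lambda>i. mL n i + mR n i, mR n)) (case a of (\<beta>, \<gamma>) \<Rightarrow> code (case_sum (\<lambda>i. \<beta> i - \<gamma> i) \<gamma>)) = a"
      using a by auto
  qed (auto intro: code_in_S)
  then have "((\<lambda>\<beta>. \<Sum>\<gamma> | \<forall>i. \<gamma> i \<le> \<beta> i. b \<beta> * ((\<Prod>i\<in>UNIV. real (\<beta> i choose \<gamma> i)) * (\<Prod>i\<in>UNIV. y i ^ (\<beta> i - \<gamma> i)) * (\<Prod>i\<in>UNIV. w i ^ \<gamma> i)))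
      has_sum series_at (monomial_char ?x) coef) UNIV"
  proof (rule has_sum_SigmaD)
    fix \<beta> :: "'n \<Rightarrow> nat"
    have "finite (PiE UNIV (\<lambda>i. {..\<beta> i}))" by (rule finite_PiE) auto
    also have "PiE UNIV (\<lambda>i. {..\<beta> i}) = {\<gamma>. \<forall>i. \<gamma> i \<le> \<beta> i}"
      by (auto simp: PiE_def Pi_def)
    finally have fin: "finite {\<gamma>. \<forall>i. \<gamma> i \<le> \<beta> i}" .
    show "((\<lambda>\<gamma>. case (\<beta>, \<gamma>) of (\<beta>, \<gamma>) \<Rightarrow> b \<beta> * ((\<Prod>i\<in>UNIV. real (\<beta> i choose \<gamma> i)) * (\<Prod>i\<in>UNIV. y i ^ (\<beta> i - \<gamma> i)) * (\<Prod>i\<in>UNIV. w i ^ \<gamma> i)))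
      has_sum (\<Sum>\<gamma> | \<forall>i. \<gamma> i \<le> \<beta> i. b \<beta> * ((\<Prod>i\<in>UNIV. real (\<beta> i choose \<gamma> i)) * (\<Prod>i\<in>UNIV. y i ^ (\<beta> i - \<gamma> i)) * (\<Prod>i\<in>UNIV. w i ^ \<gamma> i))))
      {\<gamma>. \<forall>i. \<gamma> i \<le> \<beta> i}"
      by (rule has_sum_finiteI[OF fin]) simp
  qed
  then show ?thesis unfolding prod_binomial by (simp add: sum_distrib_left)
qed

text \<open>Replacing \<open>w\<close> by \<open>s w\<close> multiplies the monomial coded by
  \<open>n\<close> by \<open>s ^ deg n\<close>, so the coefficients in \<open>s\<close> appear on
  grouping by degree. As \<open>s\<close> is at most 1 in absolute value, the scaled point stays in
  the same polydisc.\<close>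

lemma has_sum_line:
  assumes \<psi>: "monomial_char (case_sum y w) \<in> mult_chars (\<sigma> + 2)" and s: "\<bar>s\<bar> \<le> 1"
  shows "((\<lambda>k. series_at (monomial_char (case_sum y w)) (coef_deg k) * s ^ k) has_sum
    (\<Sum>\<^sub>\<infinity>\<beta>. b \<beta> * (\<Prod>i\<in>UNIV. (y i + s * w i) ^ \<beta> i))) UNIV"
proof -
  let ?\<psi> = "monomial_char (case_sum y w)" and ?\<psi>' = "monomial_char (case_sum y (\<lambda>i. s * w i))"
  have le: "\<bar>?\<psi>' n\<bar> \<le> \<bar>?\<psi> n\<bar>" for n
    unfolding monomial_char_scale abs_mult using s by (simp add: mult_left_le power_le_one power_abs)
  have \<psi>': "?\<psi>' \<in> mult_chars (\<sigma> + 2)"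
  proof -
    have "?\<psi>' (m * n) = ?\<psi>' m * ?\<psi>' n" for m n by (rule monomial_char_mult)
    moreover have "\<bar>?\<psi>' n\<bar> \<le> real n powr - (\<sigma> + 2)" for n
      using le[of n] \<psi> unfolding mult_chars_def by (auto intro: order_trans)
    ultimately show ?thesis unfolding mult_chars_def by blast
  qed
  have "((\<lambda>n. coef n * ?\<psi>' n) has_sum series_at ?\<psi>' coef) UNIV"
    by (rule series_at_has_sum[OF poly_bounded_coef \<psi>'])
  then have "((\<lambda>(k, n). coef n * ?\<psi> n * s ^ k) has_sum series_at ?\<psi>' coef) (Sigma UNIV (\<lambda>k. {n. deg n = k}))"
    by (subst (asm) has_sum_reindex_bij_witness[where i = snd and j = "\<lambda>n. (deg n, n)"
          and T = "Sigma UNIV (\<lambda>k. {n. deg n = k})" and h = "\<lambda>(k, n). coef n * ?\<psi> n * s ^ k", OF _ _ _ _ _ refl])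
      (auto simp: monomial_char_scale)
  then have "((\<lambda>k. series_at ?\<psi> (coef_deg k) * s ^ k) has_sum series_at ?\<psi>' coef) UNIV"
  proof (rule has_sum_SigmaD)
    fix k
    have "((\<lambda>n. coef_deg k n * ?\<psi> n * s ^ k) has_sum series_at ?\<psi> (coef_deg k) * s ^ k) UNIV"
      by (intro has_sum_cmult_left series_at_has_sum[OF poly_bounded_coef_deg \<psi>])
    then show "((\<lambda>n. case (k, n) of (k, n) \<Rightarrow> coef n * ?\<psi> n * s ^ k) has_sum series_at ?\<psi> (coef_deg k) * s ^ k) {n. deg n = k}"
      by (subst (asm) has_sum_cong_neutral[where T = "{n. deg n = k}" and g = "\<lambda>n. coef n * ?\<psi> n * s ^ k"])
        (auto simp: coef_deg_def)
  qed
  moreover have "series_at ?\<psi>' coef = (\<Sum>\<^sub>\<infinity>\<beta>. b \<beta> * (\<Prod>i\<in>UNIV. (y i + s * w i) ^ \<beta> i))"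
    using infsumI[OF has_sum_shift[OF \<psi>']] by simp
  ultimately show ?thesis by simp
qed

end

section \<open>Counting sign changes on intervals\<close>

text \<open>Zero counts as nonnegative, so a function vanishing identically needs a single piece.
  This is why segments inside the zero set of \<open>g\<close> cause no exception.\<close>

definition sign_pieces :: "nat \<Rightarrow> real set \<Rightarrow> (real \<Rightarrow> real) \<Rightarrow> bool"
  where "sign_pieces N I u \<longleftrightarrow> (\<exists>F. finite F \<and> card F \<le> N \<and> disjoint F \<and> \<Union>F = I \<and>
    (\<forall>X\<in>F. is_interval X \<and> ((\<forall>x\<in>X. u x < 0) \<or> (\<forall>x\<in>X. u x \<ge> 0))))"

definition interval_union :: "nat \<Rightarrow> real set \<Rightarrow> bool"
  where "interval_union N A \<longleftrightarrow> (\<exists>F. finite F \<and> card F \<le> N \<and> disjoint F \<and> \<Union>F = A \<and> (\<forall>X\<in>F. is_interval X))"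

lemma sign_piecesE:
  assumes "sign_pieces N I u"
  obtains F where "finite F" "card F \<le> N" "disjoint F" "\<Union>F = I"
    "\<forall>X\<in>F. is_interval X" "\<forall>X\<in>F. (\<forall>x\<in>X. u x < 0) \<or> (\<forall>x\<in>X. u x \<ge> 0)"
proof -
  from assms obtain F where F: "finite F \<and> card F \<le> N \<and> disjoint F \<and> \<Union>F = I \<and>
      (\<forall>X\<in>F. is_interval X \<and> ((\<forall>x\<in>X. u x < 0) \<or> (\<forall>x\<in>X. u x \<ge> 0)))"
    unfolding sign_pieces_def ..
  then have *: "\<forall>X\<in>F. is_interval X \<and> ((\<forall>x\<in>X. u x < 0) \<or> (\<forall>x\<in>X. u x \<ge> 0))" by (elim conjE)
  show ?thesis by (rule that[of F]) (use F * in simp_all)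
qed

lemma interval_unionE:
  assumes "interval_union N A"
  obtains F where "finite F" "card F \<le> N" "disjoint F" "\<Union>F = A" "\<forall>X\<in>F. is_interval X"
proof -
  from assms obtain F where F: "finite F \<and> card F \<le> N \<and> disjoint F \<and> \<Union>F = A \<and> (\<forall>X\<in>F. is_interval X)"
    unfolding interval_union_def ..
  then have *: "\<forall>X\<in>F. is_interval X" by (elim conjE)
  show ?thesis by (rule that[of F]) (use F * in simp_all)
qed

lemma is_interval_real_iff:
  "is_interval (X :: real set) \<longleftrightarrow> (\<forall>a\<in>X. \<forall>b\<in>X. \<forall>x. a \<le> x \<longrightarrow> x \<le> b \<longrightarrow> x \<in> X)"
  unfolding is_interval_1 by blast

lemma is_interval_realD:
  "is_interval (X :: real set) \<Longrightarrow> a \<in> X \<Longrightarrow> b \<in> X \<Longrightarrow> a \<le> x \<Longrightarrow> x \<le> b \<Longrightarrow> x \<in> X"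
  unfolding is_interval_1 by blast

lemma sign_pieces_const:
  assumes "is_interval I" "(\<forall>x\<in>I. u x < 0) \<or> (\<forall>x\<in>I. u x \<ge> 0)"
  shows "sign_pieces 1 I u"
  unfolding sign_pieces_def by (intro exI[of _ "{I}"]) (use assms in auto)

lemma sign_pieces_mono: "sign_pieces N I u \<Longrightarrow> N \<le> N' \<Longrightarrow> sign_pieces N' I u"
  unfolding sign_pieces_def by (erule exE, rule_tac x = F in exI) auto

lemma sign_pieces_cong:
  assumes "sign_pieces N I u" "\<And>x. x \<in> I \<Longrightarrow> u x = v x"
  shows "sign_pieces N I v"
proof -
  obtain F where F: "finite F" "card F \<le> N" "disjoint F" "\<Union>F = I"
    "\<forall>X\<in>F. is_interval X" "\<forall>X\<in>F. (\<forall>x\<in>X. u x < 0) \<or> (\<forall>x\<in>X. u x \<ge> 0)"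
    by (rule sign_piecesE[OF assms(1)])
  have "(\<forall>x\<in>X. v x < 0) \<or> (\<forall>x\<in>X. v x \<ge> 0)" if "X \<in> F" for X
  proof -
    have "u x = v x" if x: "x \<in> X" for x
    proof (rule assms(2))
      show "x \<in> I" using F(4) \<open>X \<in> F\<close> x by blast
    qed
    then show ?thesis using F(6)[rule_format, OF that] by simp
  qed
  then show ?thesis unfolding sign_pieces_def using F(1-5) by (intro exI[of _ F] conjI ballI) simp_all
qed

text \<open>Where the derivative keeps its sign the function is monotone, so its negative and its
  nonnegative part are intervals: each piece splits into at most two. This plays the role of Rolle's
  theorem without counting zeros.\<close>

lemma sign_pieces_antideriv:
  assumes "sign_pieces N I u'" "\<And>x. x \<in> I \<Longrightarrow> (u has_real_derivative u' x) (at x)"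
  shows "sign_pieces (2 * N) I u"
proof -
  obtain F where F: "finite F" "card F \<le> N" "disjoint F" "\<Union>F = I"
    "\<forall>X\<in>F. is_interval X" "\<forall>X\<in>F. (\<forall>x\<in>X. u' x < 0) \<or> (\<forall>x\<in>X. u' x \<ge> 0)"
    by (rule sign_piecesE[OF assms(1)])
  let ?neg = "\<lambda>X. X \<inter> {x. u x < 0}" and ?pos = "\<lambda>X. X \<inter> {x. u x \<ge> 0}"
  have intv: "is_interval (?neg X) \<and> is_interval (?pos X)" if X: "X \<in> F" for X
  proof -
    have seg: "{x..y} \<subseteq> X" if "x \<in> X" "y \<in> X" for x y
      using is_interval_realD[OF F(5)[rule_format, OF X] that] by auto
    have d: "(u has_real_derivative u' x) (at x)" if "x \<in> X" for x
      using assms(2) F(4) X that by blast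
    have "(\<forall>x\<in>X. \<forall>y\<in>X. x \<le> y \<longrightarrow> u x \<le> u y) \<or> (\<forall>x\<in>X. \<forall>y\<in>X. x \<le> y \<longrightarrow> u y \<le> u x)"
      using F(6)[rule_format, OF X]
    proof
      assume neg: "\<forall>x\<in>X. u' x < 0"
      have "u y \<le> u x" if "x \<in> X" "y \<in> X" "x \<le> y" for x y
      proof (rule DERIV_nonpos_imp_nonincreasing[OF that(3)])
        fix z assume "x \<le> z" "z \<le> y"
        then have "z \<in> X" using seg[OF that(1,2)] by auto
        then show "\<exists>d. (u has_real_derivative d) (at z) \<and> d \<le> 0" using d[of z] neg less_imp_le by blast
      qed
      then show ?thesis by blast
    next
      assume pos: "\<forall>x\<in>X. u' x \<ge> 0"
      have "u x \<le> u y" if "x \<in> X" "y \<in> X" "x \<le> y" for x y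
      proof (rule DERIV_nonneg_imp_nondecreasing[OF that(3)])
        fix z assume "x \<le> z" "z \<le> y"
        then have "z \<in> X" using seg[OF that(1,2)] by auto
        then show "\<exists>d. (u has_real_derivative d) (at z) \<and> 0 \<le> d" using d[of z] pos by blast
      qed
      then show ?thesis by blast
    qed
    then have "u a \<le> u x \<and> u x \<le> u b \<or> u b \<le> u x \<and> u x \<le> u a" if "a \<in> X" "b \<in> X" "a \<le> x" "x \<le> b" for a b x
      using seg[OF that(1,2)] that by (metis atLeastAtMost_iff subsetD)
    then have "x \<in> X \<and> min (u a) (u b) \<le> u x \<and> u x \<le> max (u a) (u b)"
      if "a \<in> X" "b \<in> X" "a \<le> x" "x \<le> b" for a b x
      using seg[OF that(1,2)] that by (auto simp: min_le_iff_disj le_max_iff_disj)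
    then have btw: "x \<in> X \<and> min (u a) (u b) \<le> u x \<and> u x \<le> max (u a) (u b)"
      if "a \<in> X" "b \<in> X" "a \<le> x" "x \<le> b" for a b x using that by blast
    show ?thesis
      unfolding is_interval_real_iff
    proof (intro conjI ballI allI impI)
      fix a b x assume "a \<in> ?neg X" "b \<in> ?neg X" "a \<le> x" "x \<le> b"
      then show "x \<in> ?neg X" using btw[of a b x] by auto
    next
      fix a b x assume "a \<in> ?pos X" "b \<in> ?pos X" "a \<le> x" "x \<le> b"
      then show "x \<in> ?pos X" using btw[of a b x] by auto
    qed
  qed
  show ?thesis
    unfolding sign_pieces_def
  proof (intro exI[of _ "?neg ` F \<union> ?pos ` F"] conjI ballI)
    have "card (?neg ` F \<union> ?pos ` F) \<le> card (?neg ` F) + card (?pos ` F)" by (rule card_Un_le)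
    also have "\<dots> \<le> card F + card F" by (intro add_mono card_image_le F(1))
    finally show "card (?neg ` F \<union> ?pos ` F) \<le> 2 * N" using F(2) by simp
    have "\<Union> (?neg ` F \<union> ?pos ` F) = \<Union>F" by (auto simp: not_less)
    from this F(4) show "\<Union> (?neg ` F \<union> ?pos ` F) = I" by (rule trans)
    show "disjoint (?neg ` F \<union> ?pos ` F)"
    proof (rule disjointI)
      fix A B assume AB: "A \<in> ?neg ` F \<union> ?pos ` F" "B \<in> ?neg ` F \<union> ?pos ` F" "A \<noteq> B"
      obtain X Y where XY: "X \<in> F" "Y \<in> F" "A = ?neg X \<or> A = ?pos X" "B = ?neg Y \<or> B = ?pos Y"
        using AB(1,2) by blast
      show "A \<inter> B = {}"
      proof (cases "X = Y")
        case True
        then show ?thesis using XY AB(3) by auto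
      next
        case False
        then have "X \<inter> Y = {}" using F(3) XY by (auto dest: disjointD)
        then show ?thesis using XY by blast
      qed
    qed
    show "is_interval X" if "X \<in> ?neg ` F \<union> ?pos ` F" for X using intv that by blast
    show "(\<forall>x\<in>X. u x < 0) \<or> (\<forall>x\<in>X. 0 \<le> u x)" if "X \<in> ?neg ` F \<union> ?pos ` F" for X using that by blast
  qed (use F(1) in simp)
qed

lemma interval_union_single: "is_interval I \<Longrightarrow> interval_union 1 I"
  unfolding interval_union_def by (intro exI[of _ "{I}"]) auto

lemma interval_union_empty: "interval_union N {}"
  unfolding interval_union_def by (intro exI[of _ "{}"]) auto

lemma interval_union_mono: "interval_union N A \<Longrightarrow> N \<le> N' \<Longrightarrow> interval_union N' A"
  unfolding interval_union_def by (erule exE, rule_tac x = F in exI) auto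

lemma sign_pieces_imp_interval_union:
  assumes "sign_pieces N I u" shows "interval_union N {x \<in> I. u x < 0}"
proof -
  obtain F where F: "finite F" "card F \<le> N" "disjoint F" "\<Union>F = I"
    "\<forall>X\<in>F. is_interval X" "\<forall>X\<in>F. (\<forall>x\<in>X. u x < 0) \<or> (\<forall>x\<in>X. u x \<ge> 0)"
    by (rule sign_piecesE[OF assms(1)])
  let ?G = "{X \<in> F. \<forall>x\<in>X. u x < 0}"
  have "card ?G \<le> N" using card_mono[of F ?G] F(1,2) by auto
  moreover have "disjoint ?G" using F(3) by (auto intro!: disjointI dest: disjointD)
  moreover have "\<Union>?G = {x \<in> I. u x < 0}" using F(4,6) by (auto simp: not_less[symmetric])
  ultimately show ?thesis
    unfolding interval_union_def using F(1,5) by (intro exI[of _ ?G]) auto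
qed

lemma interval_union_Int:
  assumes "interval_union N A" "interval_union N' A'"
  shows "interval_union (N * N') (A \<inter> A')"
proof -
  obtain F where F: "finite F" "card F \<le> N" "disjoint F" "\<Union>F = A" "\<forall>X\<in>F. is_interval X"
    by (rule interval_unionE[OF assms(1)])
  obtain F' where F': "finite F'" "card F' \<le> N'" "disjoint F'" "\<Union>F' = A'" "\<forall>X\<in>F'. is_interval X"
    by (rule interval_unionE[OF assms(2)])
  let ?G = "(\<lambda>(X, Y). X \<inter> Y) ` (F \<times> F')"
  have "card ?G \<le> card (F \<times> F')" using F(1) F'(1) by (intro card_image_le) auto
  also have "\<dots> \<le> N * N'" unfolding card_cartesian_product using F(2) F'(2) by (rule mult_le_mono)
  finally have "card ?G \<le> N * N'" .
  moreover have "disjoint ?G"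
  proof (rule disjointI)
    fix P Q assume "P \<in> ?G" "Q \<in> ?G" "P \<noteq> Q"
    then obtain X Y X' Y' where "X \<in> F" "Y \<in> F'" "X' \<in> F" "Y' \<in> F'" "P = X \<inter> Y" "Q = X' \<inter> Y'"
      "X \<noteq> X' \<or> Y \<noteq> Y'" by auto
    moreover from this have "X \<inter> X' = {} \<or> Y \<inter> Y' = {}"
      using F(3) F'(3) by (auto dest: disjointD)
    ultimately show "P \<inter> Q = {}" by blast
  qed
  moreover have "\<Union>?G = A \<inter> A'" using F(4) F'(4) by auto
  moreover have "\<forall>X\<in>?G. is_interval X" using F(5) F'(5) by (auto intro: is_interval_Int)
  ultimately show ?thesis
    unfolding interval_union_def using F(1) F'(1) by (intro exI[of _ ?G]) auto
qed

lemma interval_union_UN: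
  assumes "finite J" "\<And>j. j \<in> J \<Longrightarrow> interval_union N (A j)"
    "\<And>i j. i \<in> J \<Longrightarrow> j \<in> J \<Longrightarrow> i \<noteq> j \<Longrightarrow> A i \<inter> A j = {}"
  shows "interval_union (card J * N) (\<Union>j\<in>J. A j)"
proof -
  have "\<forall>j\<in>J. \<exists>F. finite F \<and> card F \<le> N \<and> disjoint F \<and> \<Union>F = A j \<and> (\<forall>X\<in>F. is_interval X)"
    using assms(2) unfolding interval_union_def by blast
  then obtain F where F: "\<And>j. j \<in> J \<Longrightarrow> finite (F j)" "\<And>j. j \<in> J \<Longrightarrow> card (F j) \<le> N" "\<And>j. j \<in> J \<Longrightarrow> disjoint (F j)"
    "\<And>j. j \<in> J \<Longrightarrow> \<Union>(F j) = A j" "\<And>j X. j \<in> J \<Longrightarrow> X \<in> F j \<Longrightarrow> is_interval X"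
    by metis
  let ?G = "\<Union>j\<in>J. F j"
  have "card ?G \<le> (\<Sum>j\<in>J. card (F j))" using assms(1) by (rule card_UN_le)
  also have "\<dots> \<le> card J * N" using sum_bounded_above[of J "\<lambda>j. card (F j)" N] F(2) by simp
  finally have "card ?G \<le> card J * N" .
  moreover have "disjoint ?G"
  proof (rule disjointI)
    fix P Q assume "P \<in> ?G" "Q \<in> ?G" "P \<noteq> Q"
    then obtain i j where ij: "i \<in> J" "P \<in> F i" "j \<in> J" "Q \<in> F j" by blast
    show "P \<inter> Q = {}"
    proof (cases "i = j")
      case True
      then show ?thesis using ij F(3) \<open>P \<noteq> Q\<close> by (auto dest: disjointD)
    next
      case False
      have "P \<subseteq> A i" "Q \<subseteq> A j" using ij F(4) by blast+
      then show ?thesis using assms(3)[OF ij(1,3) False] by blast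
    qed
  qed
  moreover have "\<Union>?G = (\<Union>j\<in>J. A j)"
  proof -
    have "\<Union>?G = (\<Union>j\<in>J. \<Union>(F j))" by blast
    then show ?thesis using F(4) by simp
  qed
  ultimately show ?thesis
    unfolding interval_union_def using F(1,5) assms(1) by (intro exI[of _ ?G]) auto
qed

lemma interval_union_vimage:
  assumes "interval_union N A" "mono h \<or> antimono h"
  shows "interval_union N (h -` A)"
proof -
  obtain F where F: "finite F" "card F \<le> N" "disjoint F" "\<Union>F = A" "\<forall>X\<in>F. is_interval X"
    by (rule interval_unionE[OF assms(1)])
  let ?G = "(\<lambda>X. h -` X) ` F"
  have "card ?G \<le> N" using card_image_le[OF F(1), of "\<lambda>X. h -` X"] F(2) by simp
  moreover have "disjoint ?G"
    by (rule disjointI) (use F(3) in \<open>force dest: disjointD\<close>)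
  moreover have "\<Union>?G = h -` A" using F(4) by auto
  moreover have "\<forall>X\<in>?G. is_interval X"
  proof -
    have "is_interval (h -` X)" if "X \<in> F" for X
    unfolding is_interval_real_iff
  proof (intro ballI allI impI)
    fix a b x assume *: "a \<in> h -` X" "b \<in> h -` X" "a \<le> x" "x \<le> b"
    then have "h a \<le> h x \<and> h x \<le> h b \<or> h b \<le> h x \<and> h x \<le> h a"
      using assms(2) by (auto simp: mono_def antimono_def)
    then show "x \<in> h -` X"
      using is_interval_realD[OF F(5)[rule_format, OF that], of "h a" "h b" "h x"]
        is_interval_realD[OF F(5)[rule_format, OF that], of "h b" "h a" "h x"] *(1,2) by auto
  qed
    then show ?thesis by blast
  qed
  ultimately show ?thesis
    unfolding interval_union_def using F(1) by (intro exI[of _ ?G]) auto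
qed

lemma diffs_funpow: "((diffs ^^ j) c) n = fact (n + j) / fact n * (c (n + j) :: real)"
proof (induction j arbitrary: n)
  case (Suc j)
  have "(diffs ^^ Suc j) c n = real (Suc n) * (diffs ^^ j) c (Suc n)" by (simp add: diffs_def)
  also have "\<dots> = fact (n + Suc j) / fact n * c (n + Suc j)"
    unfolding Suc by (simp del: of_nat_Suc)
  finally show ?case .
qed simp

text \<open>All coefficients are at most \<open>K * (d + 1)\<close> times the largest one
  \<open>c J\<close> with \<open>J \<le> d\<close>, so the \<open>J\<close>-th derivative differs
  from \<open>fact J * c J\<close> by a small multiple of \<open>c J\<close>, on an interval
  depending on \<open>K\<close> and \<open>d\<close> only. Integrating back \<open>J\<close> times
  doubles the number of pieces each time. If \<open>c J = 0\<close>, the series is zero and the same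
  argument gives a nonnegative sign.\<close>

lemma power_series_sign_pieces:
  fixes K :: real and d :: nat
  assumes "K \<ge> 0"
  shows "\<exists>\<delta>>0. \<delta> \<le> 1 \<and> (\<forall>(c :: nat \<Rightarrow> real) u. (\<forall>k. \<bar>c k\<bar> \<le> K * (\<Sum>j\<le>d. \<bar>c j\<bar>)) \<longrightarrow>
    (\<forall>s. \<bar>s\<bar> \<le> \<delta> \<longrightarrow> (\<lambda>k. c k * s ^ k) sums u s) \<longrightarrow> sign_pieces (2 ^ d) {-\<delta>..\<delta>} u)"
proof -
  \<comment> \<open>Coefficients of the \<open>J\<close>-th derivative of the geometric series,
    which majorizes any series with bounded coefficients.\<close>
  define e where "e J n = ((diffs ^^ J) (\<lambda>_. 1 :: real)) n" for J n
  have e_nonneg: "e J n \<ge> 0" for J n unfolding e_def diffs_funpow by simp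
  have summ: "summable (\<lambda>n. ((diffs ^^ j) c) n * s ^ n)"
    if "\<And>k. \<bar>c k\<bar> \<le> A" "\<bar>s\<bar> < 1" for c A and s :: real and j
    using that(2)
  proof (induction j arbitrary: s)
    case 0
    have "summable (\<lambda>n. A * \<bar>s\<bar> ^ n)" using 0 by (intro summable_mult summable_geometric) auto
    then show ?case
      by (rule summable_comparison_test'[where N = 0])
        (simp add: abs_mult power_abs that(1) mult_right_mono)
  next
    case (Suc j)
    show ?case using termdiff_converges[of s 1 "(diffs ^^ j) c"] Suc by simp
  qed
  \<comment> \<open>The geometric majorant without its constant term and with one factor
    \<open>s\<close> taken out, at \<open>s = 1/2\<close>.\<close>
  define W where "W J = (\<Sum>n. e J (Suc n) * (1/2) ^ n)" for J
  have e_summable: "summable (\<lambda>n. e J (Suc n) * (1/2) ^ n)" for J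
  proof -
    have "summable (\<lambda>n. e J n * (1/2) ^ n)" unfolding e_def by (rule summ[of _ 1]) auto
    then have "summable (\<lambda>n. 2 * (e J (Suc n) * (1/2) ^ Suc n))"
      by (intro summable_mult) (subst summable_Suc_iff)
    then show ?thesis by simp
  qed
  have W_nonneg: "W J \<ge> 0" for J unfolding W_def using e_summable e_nonneg by (intro suminf_nonneg) auto
  \<comment> \<open>Arranged so that \<open>\<delta> * B = 1/2\<close>, which makes the deviation in
    \<open>close\<close> at most half of the absolute value of \<open>c J\<close>.\<close>
  define B where "B = K * (real d + 1) * (\<Sum>J\<le>d. W J) + 1"
  have B: "B \<ge> 1" unfolding B_def using assms W_nonneg by (simp add: sum_nonneg)
  define \<delta> where "\<delta> = 1 / (2 * B)"
  have \<delta>: "0 < \<delta>" "\<delta> \<le> 1/2" unfolding \<delta>_def using B by (auto simp: field_simps)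
  show ?thesis
  proof (intro exI[of _ \<delta>] conjI allI impI)
    fix c :: "nat \<Rightarrow> real" and u :: "real \<Rightarrow> real"
    assume c: "\<forall>k. \<bar>c k\<bar> \<le> K * (\<Sum>j\<le>d. \<bar>c j\<bar>)"
      and u: "\<forall>s. \<bar>s\<bar> \<le> \<delta> \<longrightarrow> (\<lambda>k. c k * s ^ k) sums u s"
    obtain J where J: "J \<le> d" "\<And>j. j \<le> d \<Longrightarrow> \<bar>c j\<bar> \<le> \<bar>c J\<bar>"
    proof -
      have "Max ((\<lambda>j. \<bar>c j\<bar>) ` {..d}) \<in> (\<lambda>j. \<bar>c j\<bar>) ` {..d}" by (rule Max_in) auto
      then obtain J where J: "Max ((\<lambda>j. \<bar>c j\<bar>) ` {..d}) = \<bar>c J\<bar>" "J \<in> {..d}" by (rule imageE)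
      have "\<bar>c j\<bar> \<le> \<bar>c J\<bar>" if "j \<le> d" for j
        unfolding J(1)[symmetric] using that by (intro Max_ge) auto
      then show ?thesis using that J(2) by simp
    qed
    define A where "A = K * (real d + 1) * \<bar>c J\<bar>"
    have cA: "\<bar>c k\<bar> \<le> A" for k
    proof -
      have "(\<Sum>j\<le>d. \<bar>c j\<bar>) \<le> (real d + 1) * \<bar>c J\<bar>"
        using sum_bounded_above[of "{..d}" "\<lambda>j. \<bar>c j\<bar>" "\<bar>c J\<bar>"] J(2) by (simp add: add.commute)
      then have "K * (\<Sum>j\<le>d. \<bar>c j\<bar>) \<le> A" unfolding A_def using assms by (simp add: mult_left_mono mult.assoc)
      then show ?thesis using c by (meson order_trans)
    qed
    have A: "A \<ge> 0" using cA[of 0] by linarith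
    define v where "v j s = (\<Sum>n. ((diffs ^^ j) c) n * s ^ n)" for j and s :: real
    have dv: "(v j has_real_derivative v (Suc j) s) (at s)" if s: "\<bar>s\<bar> < 1" for j s
    proof -
      obtain r where r: "\<bar>s\<bar> < r" "r < 1" using dense[OF s] by blast
      have "((\<lambda>x. \<Sum>n. (diffs ^^ j) c n * x ^ n) has_real_derivative (\<Sum>n. diffs ((diffs ^^ j) c) n * s ^ n)) (at s)"
        by (rule termdiffs_strong[where K = r]) (use summ[OF cA, of r j] r in auto)
      then show ?thesis unfolding v_def by simp
    qed
    have uv: "u s = v 0 s" if "\<bar>s\<bar> \<le> \<delta>" for s
      unfolding v_def using u that by (simp add: sums_iff)
    have base: "(\<forall>s\<in>{-\<delta>..\<delta>}. v J s < 0) \<or> (\<forall>s\<in>{-\<delta>..\<delta>}. v J s \<ge> 0)"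
    proof -
      have close: "\<bar>v J s - fact J * c J\<bar> \<le> \<bar>c J\<bar> / 2" if s: "\<bar>s\<bar> \<le> \<delta>" for s
      proof -
        have s1: "\<bar>s\<bar> \<le> 1/2" using s \<delta> by linarith
        have sm: "summable (\<lambda>n. ((diffs ^^ J) c) n * s ^ n)" by (rule summ[OF cA]) (use s1 in auto)
        have sm': "summable (\<lambda>n. ((diffs ^^ J) c) (Suc n) * s ^ Suc n)"
          using sm by (subst summable_Suc_iff)
        have bd: "\<bar>((diffs ^^ J) c) (Suc n) * s ^ Suc n\<bar> \<le> A * \<bar>s\<bar> * (e J (Suc n) * (1/2) ^ n)" for n
        proof -
          have "\<bar>((diffs ^^ J) c) (Suc n)\<bar> \<le> A * e J (Suc n)"
            unfolding e_def diffs_funpow abs_mult using cA[of "Suc n + J"]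
            by (simp add: mult.commute mult_right_mono divide_right_mono)
          moreover have "\<bar>s ^ Suc n\<bar> \<le> \<bar>s\<bar> * (1/2) ^ n"
            unfolding power_Suc abs_mult power_abs using s1 by (intro mult_left_mono power_mono) auto
          ultimately show ?thesis unfolding abs_mult
            using A e_nonneg mult_mono[of "\<bar>((diffs ^^ J) c) (Suc n)\<bar>" "A * e J (Suc n)" "\<bar>s ^ Suc n\<bar>" "\<bar>s\<bar> * (1/2) ^ n"]
            by (simp add: mult_ac)
        qed
        have "v J s - fact J * c J = (\<Sum>n. ((diffs ^^ J) c) (Suc n) * s ^ Suc n)"
          unfolding v_def using suminf_split_head[OF sm] by (simp add: diffs_funpow)
        also have "\<bar>\<dots>\<bar> \<le> (\<Sum>n. A * \<bar>s\<bar> * (e J (Suc n) * (1/2) ^ n))"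
          using bd norm_suminf_le[of "\<lambda>n. ((diffs ^^ J) c) (Suc n) * s ^ Suc n"] summable_mult[OF e_summable]
          by (simp only: real_norm_def)
        also have "\<dots> = A * \<bar>s\<bar> * W J" unfolding W_def by (rule suminf_mult[OF e_summable])
        also have "\<dots> = \<bar>c J\<bar> * (\<bar>s\<bar> * (K * (real d + 1) * W J))" unfolding A_def by (simp add: mult_ac)
        also have "\<dots> \<le> \<bar>c J\<bar> * (\<delta> * B)"
        proof (intro mult_left_mono mult_mono)
          have "W J \<le> (\<Sum>J\<le>d. W J)" using J(1) W_nonneg by (intro member_le_sum) auto
          then have "K * (real d + 1) * W J \<le> K * (real d + 1) * (\<Sum>J\<le>d. W J)"
            using assms by (intro mult_left_mono) auto
          then show "K * (real d + 1) * W J \<le> B" unfolding B_def by simp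
        qed (use s \<delta> assms W_nonneg in auto)
        also have "\<delta> * B = 1/2" unfolding \<delta>_def using B by simp
        finally show ?thesis by simp
      qed
      have f: "\<bar>c J\<bar> \<le> fact J * \<bar>c J\<bar>" using mult_right_mono[of 1 "fact J :: real" "\<bar>c J\<bar>"] by simp
      show ?thesis
      proof (cases "c J < 0")
        case True
        have "v J s < 0" if "s \<in> {-\<delta>..\<delta>}" for s
        proof -
          have "\<bar>v J s - fact J * c J\<bar> \<le> \<bar>c J\<bar> / 2" by (rule close) (use that in auto)
          moreover have "fact J * c J = - (fact J * \<bar>c J\<bar>)" using True by simp
          ultimately show ?thesis using f True by linarith
        qed
        then show ?thesis by blast
      next
        case False
        have "v J s \<ge> 0" if "s \<in> {-\<delta>..\<delta>}" for s
        proof -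
          have "\<bar>v J s - fact J * c J\<bar> \<le> \<bar>c J\<bar> / 2" by (rule close) (use that in auto)
          moreover have "fact J * c J = fact J * \<bar>c J\<bar>" using False by simp
          ultimately show ?thesis using f False by linarith
        qed
        then show ?thesis by blast
      qed
    qed
    have "sign_pieces (2 ^ j) {-\<delta>..\<delta>} (v (J - j))" if "j \<le> J" for j
      using that
    proof (induction j)
      case 0
      then show ?case using sign_pieces_const[of "{-\<delta>..\<delta>}" "v J"] base by simp
    next
      case (Suc j)
      then have "Suc (J - Suc j) = J - j" by simp
      then have "sign_pieces (2 * 2 ^ j) {-\<delta>..\<delta>} (v (J - Suc j))"
        using Suc dv[of _ "J - Suc j"] \<delta> by (intro sign_pieces_antideriv[where u' = "v (J - j)"]) auto
      then show ?case by simp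
    qed
    from this[of J] have "sign_pieces (2 ^ J) {-\<delta>..\<delta>} (v 0)" by simp
    then have "sign_pieces (2 ^ d) {-\<delta>..\<delta>} (v 0)" by (rule sign_pieces_mono) (use J(1) in auto)
    then show "sign_pieces (2 ^ d) {-\<delta>..\<delta>} u" by (rule sign_pieces_cong) (use uv in auto)
  qed (use \<delta> in auto)
qed

section \<open>From power series at a point to all rays through a compact convex set\<close>

text \<open>At the point \<open>x\<close> all coordinates of \<open>x - a\<close> equal
  \<open>2 * \<eta>\<close>, so every monomial is positive, and unconditional convergence of a real
  series is absolute. The choice of \<eta> puts this point within \<open>r / 2\<close> of
  \<open>a\<close>.\<close>

lemma coeff_bound_of_has_sum:
  fixes g :: "real ^ 'n \<Rightarrow> real"
  assumes "r > 0" "\<And>x. x \<in> ball a r \<Longrightarrow> ((\<lambda>k. c k * (\<Prod>i\<in>UNIV. (x $ i - a $ i) ^ k i)) has_sum g x) UNIV"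
  obtains \<eta> where "0 < \<eta>" "\<eta> \<le> 1" "(\<lambda>k. \<bar>c k\<bar> * (2 * \<eta>) ^ (\<Sum>i\<in>UNIV. k i)) summable_on UNIV"
proof -
  define \<eta> where "\<eta> = min 1 (r / (4 * real CARD('n)))"
  have \<eta>: "0 < \<eta>" "\<eta> \<le> 1" unfolding \<eta>_def using assms(1) by auto
  define x where "x = a + (\<chi> i. 2 * \<eta>)"
  have "norm (x - a) \<le> (\<Sum>i\<in>UNIV. \<bar>(x - a) $ i\<bar>)" by (rule norm_le_l1_cart)
  also have "\<dots> = 2 * real CARD('n) * \<eta>" unfolding x_def using \<eta> by simp
  also have "\<dots> \<le> 2 * real CARD('n) * (r / (4 * real CARD('n)))"
    unfolding \<eta>_def by (intro mult_left_mono) auto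
  also have "\<dots> < r" using assms(1) by simp
  finally have "x \<in> ball a r" by (simp add: dist_norm norm_minus_commute)
  from has_sum_imp_summable[OF assms(2)[OF this]]
  have "(\<lambda>k. c k * (2 * \<eta>) ^ (\<Sum>i\<in>UNIV. k i)) summable_on UNIV"
    unfolding x_def by (simp add: power_sum)
  then have "(\<lambda>k. norm (c k * (2 * \<eta>) ^ (\<Sum>i\<in>UNIV. k i))) summable_on UNIV"
    by (rule summable_on_iff_abs_summable_on_real[THEN iffD1])
  then show ?thesis using that[OF \<eta>] \<eta> by (simp add: abs_mult)
qed

text \<open>Needed for the measurability of the region of integration; the absolute bound on the
  coefficients gives uniform convergence near each point.\<close>

lemma real_analytic_on_imp_continuous_on:
  fixes g :: "real ^ 'n \<Rightarrow> real"
  assumes "open V" "real_analytic_on V g"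
  shows "continuous_on V g"
proof (rule continuous_at_imp_continuous_on, rule ballI)
  fix a assume "a \<in> V"
  then have "\<exists>r>0. \<exists>c. \<forall>x\<in>ball a r. ((\<lambda>k. c k * (\<Prod>i\<in>UNIV. (x $ i - a $ i) ^ k i)) has_sum g x) UNIV"
    using assms(2) unfolding real_analytic_on_def by (rule bspec[rotated])
  then obtain r c where "r > 0"
    "\<forall>x\<in>ball a r. ((\<lambda>k. c k * (\<Prod>i\<in>UNIV. (x $ i - a $ i) ^ k i)) has_sum g x) UNIV"
    by (elim exE conjE)
  note r = this(1) this(2)[rule_format]
  obtain \<eta> where \<eta>: "0 < \<eta>" "\<eta> \<le> 1" "(\<lambda>k. \<bar>c k\<bar> * (2 * \<eta>) ^ (\<Sum>i\<in>UNIV. k i)) summable_on UNIV"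
    by (rule coeff_bound_of_has_sum[OF r])
  define B where "B = ball a (min r \<eta>)"
  let ?f = "\<lambda>k x. c k * (\<Prod>i\<in>UNIV. (x $ i - a $ i) ^ k i)"
  have bound: "norm (?f k x) \<le> \<bar>c k\<bar> * (2 * \<eta>) ^ (\<Sum>i\<in>UNIV. k i)" if "x \<in> B" for k x
  proof -
    have "\<bar>x $ i - a $ i\<bar> \<le> 2 * \<eta>" for i
    proof -
      have "\<bar>(x - a) $ i\<bar> \<le> norm (x - a)" by (rule component_le_norm_cart)
      then show ?thesis using that \<eta> unfolding B_def by (simp add: dist_norm norm_minus_commute)
    qed
    then have "(\<Prod>i\<in>UNIV. \<bar>x $ i - a $ i\<bar> ^ k i) \<le> (\<Prod>i\<in>UNIV. (2 * \<eta>) ^ k i)"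
      by (intro prod_mono conjI power_mono) auto
    then show ?thesis by (simp add: abs_mult abs_prod power_abs power_sum mult_left_mono)
  qed
  have "uniform_limit B (\<lambda>X x. \<Sum>k\<in>X. ?f k x) (\<lambda>x. \<Sum>\<^sub>\<infinity>k\<in>UNIV. ?f k x) (finite_subsets_at_top UNIV)"
    by (rule Weierstrass_m_test_general[where M = "\<lambda>k. \<bar>c k\<bar> * (2 * \<eta>) ^ (\<Sum>i\<in>UNIV. k i)"])
      (use bound \<eta>(3) in auto)
  then have "continuous_on B (\<lambda>x. \<Sum>\<^sub>\<infinity>k. ?f k x)"
    by (rule uniform_limit_theorem[rotated]) (auto intro!: always_eventually continuous_intros)
  then have "continuous_on B g"
    by (rule continuous_on_eq) (use r(2) in \<open>auto simp: B_def intro!: infsumI\<close>)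
  moreover have "a \<in> B" "open B" using r \<eta> unfolding B_def by auto
  ultimately show "isCont g a" using continuous_on_eq_continuous_at by blast
qed

text \<open>The Taylor coefficients along \<open>x + s w\<close> are values at
  \<open>(x - a, w)\<close> of one family of power series, so the domination constants do not depend
  on \<open>x\<close> and \<open>w\<close>.\<close>

lemma analytic_local_interval_union:
  fixes g :: "real ^ 'n \<Rightarrow> real"
  assumes "r > 0" "\<And>x. x \<in> ball a r \<Longrightarrow> ((\<lambda>k. c k * (\<Prod>i\<in>UNIV. (x $ i - a $ i) ^ k i)) has_sum g x) UNIV"
  shows "\<exists>\<epsilon>>0. \<exists>N. \<forall>x\<in>ball a \<epsilon>. \<forall>w. norm w \<le> \<epsilon> \<longrightarrow> interval_union N {s \<in> {-1..1}. g (x + s *\<^sub>R w) < 0}"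
proof -
  obtain \<eta> where \<eta>: "0 < \<eta>" "\<eta> \<le> 1" "(\<lambda>k. \<bar>c k\<bar> * (2 * \<eta>) ^ (\<Sum>i\<in>UNIV. k i)) summable_on UNIV"
    by (rule coeff_bound_of_has_sum[OF assms])
  define M where "M = (\<Sum>\<^sub>\<infinity>k. \<bar>c k\<bar> * (2 * \<eta>) ^ (\<Sum>i\<in>UNIV. k i))"
  have M: "\<bar>c k\<bar> * (2 * \<eta>) ^ (\<Sum>i\<in>UNIV. k i) \<le> M" for k
    using finite_sum_le_infsum[OF \<eta>(3), of "{k}"] \<eta> unfolding M_def by simp
  obtain p :: "'n + 'n \<Rightarrow> nat" where p: "inj p" "\<And>i. prime (p i)" using ex_inj_primes by metis
  interpret shifted_series p c M \<eta>
    by unfold_locales (use p \<eta> M in auto)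
  have "\<exists>d \<rho> K. \<forall>k. \<forall>\<psi>\<in>mult_chars \<rho>. \<bar>series_at \<psi> (coef_deg k)\<bar> \<le> K * (\<Sum>j\<le>d. \<bar>series_at \<psi> (coef_deg j)\<bar>)"
    by (rule series_family_bound[of "range p" M \<sigma>])
      (use poly_bounded_coef_deg in \<open>auto simp: coef_deg_def coef_def\<close>)
  then obtain d \<rho> K where "\<forall>k. \<forall>\<psi>\<in>mult_chars \<rho>.
      \<bar>series_at \<psi> (coef_deg k)\<bar> \<le> K * (\<Sum>j\<le>d. \<bar>series_at \<psi> (coef_deg j)\<bar>)" by (elim exE)
  note K = this[rule_format]
  obtain \<delta> where "\<delta> > 0" "\<delta> \<le> 1" "\<forall>(c :: nat \<Rightarrow> real) u. (\<forall>k. \<bar>c k\<bar> \<le> \<bar>K\<bar> * (\<Sum>j\<le>d. \<bar>c j\<bar>)) \<longrightarrow>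
      (\<forall>s. \<bar>s\<bar> \<le> \<delta> \<longrightarrow> (\<lambda>k. c k * s ^ k) sums u s) \<longrightarrow> sign_pieces (2 ^ d) {-\<delta>..\<delta>} u"
    using power_series_sign_pieces[OF abs_ge_zero, of K d] by (elim exE conjE)
  note \<delta> = this(1,2) this(3)[rule_format]
  define \<rho>' where "\<rho>' = max \<rho> (\<sigma> + 2)"
  \<comment> \<open>The first bound puts \<open>x - a\<close> and \<open>w\<close> in the polydisc
    of radii \<open>p i powr - \<rho>'\<close>; the second keeps \<open>x + s w\<close> within
    \<open>2 * \<epsilon> < r\<close> of \<open>a\<close>.\<close>
  define \<epsilon> where "\<epsilon> = min (Min (range (\<lambda>i. real (p i) powr - \<rho>'))) (r / 4)"
  have \<epsilon>: "\<epsilon> > 0" "\<epsilon> \<le> r / 4" unfolding \<epsilon>_def using assms(1) prime_p_nonzero by auto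
  have \<epsilon>_le: "\<epsilon> \<le> real (p i) powr - \<rho>'" for i
    unfolding \<epsilon>_def by (rule order_trans[OF min.cobounded1 Min_le]) auto
  have main: "sign_pieces (2 ^ d) {-\<delta>..\<delta>} (\<lambda>s. g (x + s *\<^sub>R w))"
    if x: "x \<in> ball a \<epsilon>" and w: "norm w \<le> \<epsilon>" for x w
  proof -
    let ?\<psi> = "monomial_char (case_sum (\<lambda>i. (x - a) $ i) (\<lambda>i. w $ i))"
    have "\<bar>(x - a) $ i\<bar> \<le> \<epsilon>" "\<bar>w $ i\<bar> \<le> \<epsilon>" for i
      using component_le_norm_cart[of "x - a" i] component_le_norm_cart[of w i] x w
      by (auto simp: dist_norm norm_minus_commute)
    then have \<psi>: "?\<psi> \<in> mult_chars \<rho>'"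
      by (intro monomial_char_in_mult_chars) (auto intro: order_trans[OF _ \<epsilon>_le] split: sum.split)
    then have \<psi>1: "?\<psi> \<in> mult_chars \<rho>" and \<psi>2: "?\<psi> \<in> mult_chars (\<sigma> + 2)"
      using mult_chars_antimono[of \<rho> \<rho>'] mult_chars_antimono[of "\<sigma> + 2" \<rho>'] unfolding \<rho>'_def by auto
    show ?thesis
    proof (rule \<delta>(3)[where c = "\<lambda>k. series_at ?\<psi> (coef_deg k)"])
      fix k
      show "\<bar>series_at ?\<psi> (coef_deg k)\<bar> \<le> \<bar>K\<bar> * (\<Sum>j\<le>d. \<bar>series_at ?\<psi> (coef_deg j)\<bar>)"
        by (rule order_trans[OF K[OF \<psi>1]]) (auto intro!: mult_right_mono sum_nonneg)
    next
      fix s assume "\<bar>s\<bar> \<le> \<delta>"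
      then have s: "\<bar>s\<bar> \<le> 1" using \<delta> by simp
      have "norm (x + s *\<^sub>R w - a) \<le> norm (x - a) + \<bar>s\<bar> * norm w"
        using norm_triangle_ineq[of "x - a" "s *\<^sub>R w"] by (simp add: algebra_simps)
      also have "\<dots> \<le> \<epsilon> + 1 * \<epsilon>"
        using x w s by (intro add_mono mult_mono) (auto simp: dist_norm norm_minus_commute)
      also have "\<dots> < r" using \<epsilon> assms(1) by simp
      finally have "x + s *\<^sub>R w \<in> ball a r" by (simp add: dist_norm norm_minus_commute)
      from infsumI[OF assms(2)[OF this]]
      have "(\<Sum>\<^sub>\<infinity>\<beta>. c \<beta> * (\<Prod>i\<in>UNIV. ((x - a) $ i + s * w $ i) ^ \<beta> i)) = g (x + s *\<^sub>R w)"
        by (simp add: algebra_simps)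
      then show "(\<lambda>k. series_at ?\<psi> (coef_deg k) * s ^ k) sums g (x + s *\<^sub>R w)"
        using has_sum_imp_sums[OF has_sum_line[OF \<psi>2 s]] by simp
    qed
  qed
  show ?thesis
  \<comment> \<open>Shrinking by \<delta> lets \<open>w / \<delta>\<close> be used as direction, so
    that the parameter interval from -\<delta> to \<delta> becomes the one from -1 to 1.\<close>
  proof (intro exI[of _ "\<epsilon> * \<delta>"] exI[of _ "2 ^ d"] conjI ballI allI impI)
    show "\<epsilon> * \<delta> > 0" using \<epsilon> \<delta> by simp
    fix x w :: "real ^ 'n" assume x: "x \<in> ball a (\<epsilon> * \<delta>)" and w: "norm w \<le> \<epsilon> * \<delta>"
    have "x \<in> ball a \<epsilon>" using x \<epsilon> \<delta> by (auto intro: order_less_le_trans mult_left_le)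
    moreover have "norm ((1 / \<delta>) *\<^sub>R w) \<le> \<epsilon>" using w \<delta> by (simp add: field_simps)
    ultimately have "interval_union (2 ^ d) {t \<in> {-\<delta>..\<delta>}. g (x + t *\<^sub>R ((1 / \<delta>) *\<^sub>R w)) < 0}"
      by (rule sign_pieces_imp_interval_union[OF main])
    then have "interval_union (2 ^ d) ((\<lambda>s. \<delta> * s) -` {t \<in> {-\<delta>..\<delta>}. g (x + t *\<^sub>R ((1 / \<delta>) *\<^sub>R w)) < 0})"
      by (rule interval_union_vimage) (use \<delta> in \<open>auto intro!: monoI\<close>)
    also have "(\<lambda>s. \<delta> * s) -` {t \<in> {-\<delta>..\<delta>}. g (x + t *\<^sub>R ((1 / \<delta>) *\<^sub>R w)) < 0} = {s \<in> {-1..1}. g (x + s *\<^sub>R w) < 0}"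
      using \<delta> mult_le_cancel_left_pos[of \<delta> "-1"] mult_le_cancel_left_pos[of \<delta> _ 1] by auto
    finally show "interval_union (2 ^ d) {s \<in> {-1..1}. g (x + s *\<^sub>R w) < 0}" .
  qed
qed

lemma analytic_uniform_interval_union:
  fixes g :: "real ^ 'n \<Rightarrow> real"
  assumes "compact K" "K \<subseteq> V" "real_analytic_on V g"
  shows "\<exists>\<epsilon>>0. \<exists>N. \<forall>x\<in>K. \<forall>w. norm w \<le> \<epsilon> \<longrightarrow> interval_union N {s \<in> {-1..1}. g (x + s *\<^sub>R w) < 0}"
proof -
  define W where "W a \<epsilon> N \<longleftrightarrow> (\<forall>x\<in>ball a \<epsilon>. \<forall>w. norm w \<le> \<epsilon> \<longrightarrow> interval_union N {s \<in> {-1..1}. g (x + s *\<^sub>R w) < 0})" for a \<epsilon> N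
  have "\<forall>a\<in>K. \<exists>\<epsilon> N. \<epsilon> > 0 \<and> W a \<epsilon> N"
  proof
    fix a assume "a \<in> K"
    then have "a \<in> V" using assms(2) by blast
    then have "\<exists>r>0. \<exists>c. \<forall>x\<in>ball a r. ((\<lambda>k. c k * (\<Prod>i\<in>UNIV. (x $ i - a $ i) ^ k i)) has_sum g x) UNIV"
      using assms(3) unfolding real_analytic_on_def by (rule bspec[rotated])
    then obtain r c where "r > 0"
      "\<forall>x\<in>ball a r. ((\<lambda>k. c k * (\<Prod>i\<in>UNIV. (x $ i - a $ i) ^ k i)) has_sum g x) UNIV"
      by (elim exE conjE)
    from analytic_local_interval_union[OF this(1) this(2)[rule_format]]
    show "\<exists>\<epsilon> N. \<epsilon> > 0 \<and> W a \<epsilon> N" unfolding W_def by blast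
  qed
  then obtain e N where "\<forall>a\<in>K. e a > 0 \<and> W a (e a) (N a)" by metis
  then have e: "\<And>a. a \<in> K \<Longrightarrow> e a > 0" and W: "\<And>a. a \<in> K \<Longrightarrow> W a (e a) (N a)" by blast+
  obtain T where T: "T \<subseteq> K" "finite T" "K \<subseteq> (\<Union>a\<in>T. ball a (e a))"
    by (rule compactE_image[OF assms(1), of K "\<lambda>a. ball a (e a)"]) (use e in auto)
  show ?thesis
  \<comment> \<open>The inserted 1 makes the minimum meaningful when \<open>T\<close> is
    empty.\<close>
  proof (intro exI[of _ "Min (insert 1 (e ` T))"] exI[of _ "\<Sum>a\<in>T. N a"] conjI ballI allI impI)
    show "Min (insert 1 (e ` T)) > 0" using T e by (subst Min_gr_iff) auto
    fix x w :: "real ^ 'n" assume x: "x \<in> K" and w: "norm w \<le> Min (insert 1 (e ` T))"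
    then obtain a where a: "a \<in> T" "x \<in> ball a (e a)" using T(3) by blast
    have "norm w \<le> e a" using w a(1) T(2) by (simp add: Min_ge_iff)
    then have "interval_union (N a) {s \<in> {-1..1}. g (x + s *\<^sub>R w) < 0}" 
      using W[of a] a T(1) unfolding W_def by blast
    then show "interval_union (\<Sum>a\<in>T. N a) {s \<in> {-1..1}. g (x + s *\<^sub>R w) < 0}"
      by (rule interval_union_mono) (use a(1) T(2) in \<open>auto intro: member_le_sum\<close>)
  qed
qed

lemma is_interval_line_preimage:
  assumes "convex K"
  shows "is_interval {\<tau> :: real. a + \<tau> *\<^sub>R y \<in> K}"
proof -
  have "convex {\<tau>. a + \<tau> *\<^sub>R y \<in> K}"
  proof (rule convexI)
    fix s s' u v :: real
    assume *: "s \<in> {\<tau>. a + \<tau> *\<^sub>R y \<in> K}" "s' \<in> {\<tau>. a + \<tau> *\<^sub>R y \<in> K}" "0 \<le> u" "0 \<le> v" "u + v = 1"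
    have "u *\<^sub>R (a + s *\<^sub>R y) + v *\<^sub>R (a + s' *\<^sub>R y) \<in> K"
      by (rule convexD[OF assms]) (use * in auto)
    also have "u *\<^sub>R (a + s *\<^sub>R y) + v *\<^sub>R (a + s' *\<^sub>R y) = (u + v) *\<^sub>R a + (u *\<^sub>R s + v *\<^sub>R s') *\<^sub>R y"
      by (simp add: algebra_simps)
    finally show "u *\<^sub>R s + v *\<^sub>R s' \<in> {\<tau>. a + \<tau> *\<^sub>R y \<in> K}" using *(5) by simp
  qed
  then show ?thesis by (simp add: is_interval_convex_1)
qed

text \<open>The ray is cut into \<open>m > R / \<epsilon>\<close> pieces short enough for the local
  bound. Since \<open>a\<close> is arbitrary, a piece that meets \<open>K\<close> is recentred at
  one of its points in \<open>K\<close>; convexity makes the part inside \<open>K\<close> an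
  interval.\<close>

lemma analytic_ray_interval_union:
  fixes g :: "real ^ 'n \<Rightarrow> real"
  assumes "compact K" "convex K" "K \<subseteq> V" "real_analytic_on V g"
  shows "\<exists>N. \<forall>a y. norm y \<le> R \<longrightarrow>
    interval_union N {\<tau> \<in> {1..<2}. a + \<tau> *\<^sub>R y \<in> K \<and> g (a + \<tau> *\<^sub>R y) < 0}"
proof -
  obtain \<epsilon> N where \<epsilon>: "\<epsilon> > 0" and
    N: "\<And>x w. x \<in> K \<Longrightarrow> norm w \<le> \<epsilon> \<Longrightarrow> interval_union N {s \<in> {-1..1}. g (x + s *\<^sub>R w) < 0}"
    using analytic_uniform_interval_union[OF assms(1,3,4)] by blast
  obtain m :: nat where m: "real m > R / \<epsilon>" "m > 0"
    using reals_Archimedean2[of "max 1 (R / \<epsilon>)"] by (metis gr0I max_less_iff_conj not_one_less_zero of_nat_0)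
  have "interval_union (m * N) {\<tau> \<in> {1..<2}. a + \<tau> *\<^sub>R y \<in> K \<and> g (a + \<tau> *\<^sub>R y) < 0}"
    if y: "norm y \<le> R" for a y
  proof -
    define T where "T j = {1 + real j / real m ..< 1 + (real j + 1) / real m}" for j
    define A where "A j = {\<tau> \<in> T j. a + \<tau> *\<^sub>R y \<in> K \<and> g (a + \<tau> *\<^sub>R y) < 0}" for j
    have "interval_union N (A j)" for j
    proof (cases "\<exists>\<tau>\<in>T j. a + \<tau> *\<^sub>R y \<in> K")
      case False
      then have "A j = {}" unfolding A_def by blast
      then show ?thesis by (simp add: interval_union_empty)
    next
      case True
      then obtain t where t: "t \<in> T j" "a + t *\<^sub>R y \<in> K" by blast
      let ?I = "{\<tau> \<in> T j. a + \<tau> *\<^sub>R y \<in> K}"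
      have "is_interval {\<tau>. a + \<tau> *\<^sub>R y \<in> K}" by (rule is_interval_line_preimage[OF assms(2)])
      moreover have "is_interval (T j)" unfolding T_def by (simp add: is_interval_co)
      ultimately have "is_interval (T j \<inter> {\<tau>. a + \<tau> *\<^sub>R y \<in> K})" by (rule is_interval_Int[rotated])
      then have I: "interval_union 1 ?I" by (intro interval_union_single) (simp add: Int_def)
      have w: "norm ((1 / real m) *\<^sub>R y) \<le> \<epsilon>"
      proof -
        have "norm y \<le> \<epsilon> * real m" using m \<epsilon> y by (simp add: field_simps)
        then show ?thesis using m by (simp add: field_simps)
      qed
      \<comment> \<open>The affine change of parameter takes \<open>t\<close> to 0 and
        \<open>T j\<close>, of length \<open>1 / m\<close>, into the interval from -1 to 1.\<close>
      have "interval_union N ((\<lambda>\<tau>. real m * (\<tau> - t)) -`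
          {s \<in> {-1..1}. g (a + t *\<^sub>R y + s *\<^sub>R ((1 / real m) *\<^sub>R y)) < 0})"
        by (rule interval_union_vimage[OF N[OF t(2) w]]) (auto intro!: monoI mult_left_mono)
      from interval_union_Int[OF I this]
      have "interval_union N (?I \<inter> (\<lambda>\<tau>. real m * (\<tau> - t)) -`
          {s \<in> {-1..1}. g (a + t *\<^sub>R y + s *\<^sub>R ((1 / real m) *\<^sub>R y)) < 0})" by simp
      also have "\<dots> = A j"
      proof -
        have eq: "a + t *\<^sub>R y + (real m * (\<tau> - t)) *\<^sub>R ((1 / real m) *\<^sub>R y) = a + \<tau> *\<^sub>R y" for \<tau>
          using m by (simp add: algebra_simps)
        have bd: "\<bar>real m * (\<tau> - t)\<bar> \<le> 1" if "\<tau> \<in> T j" for \<tau>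
        proof -
          have "\<bar>\<tau> - t\<bar> \<le> 1 / real m" using that t(1) unfolding T_def
            by (auto simp: add_divide_distrib abs_le_iff)
          then have "real m * \<bar>\<tau> - t\<bar> \<le> real m * (1 / real m)" by (rule mult_left_mono) simp
          then show ?thesis using m by (simp add: abs_mult)
        qed
        show ?thesis
          unfolding A_def vimage_def mem_Collect_eq eq using bd by (auto simp: abs_le_iff)
      qed
      finally show ?thesis .
    qed
    then have "interval_union (card {..<m} * N) (\<Union>j\<in>{..<m}. A j)"
    proof (intro interval_union_UN)
      fix i j :: nat assume "i \<noteq> j"
      have "T i \<inter> T j = {}" if "i < j" for i j :: nat
      proof -
        have "(real i + 1) / real m \<le> real j / real m" using that by (intro divide_right_mono) auto
        then show ?thesis unfolding T_def by auto
      qed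
      then have "T i \<inter> T j = {}" using \<open>i \<noteq> j\<close> by (metis Int_commute linorder_neqE_nat)
      then show "A i \<inter> A j = {}" unfolding A_def by blast
    qed auto
    moreover have "(\<Union>j\<in>{..<m}. T j) = {1..<2}"
    proof (intro equalityI subsetI)
      fix \<tau> assume "\<tau> \<in> (\<Union>j\<in>{..<m}. T j)"
      then obtain j where j: "j < m" "\<tau> \<in> T j" by auto
      then have "(real j + 1) / real m \<le> 1" using m by (simp add: field_simps)
      moreover have "0 \<le> real j / real m" by simp
      ultimately show "\<tau> \<in> {1..<2}" using j(2) unfolding T_def atLeastLessThan_iff by linarith
    next
      fix \<tau> :: real assume \<tau>: "\<tau> \<in> {1..<2}"
      define j where "j = nat \<lfloor>(\<tau> - 1) * real m\<rfloor>"
      have nn: "0 \<le> (\<tau> - 1) * real m" using \<tau> by simp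
      have j: "real j \<le> (\<tau> - 1) * real m" "(\<tau> - 1) * real m < real j + 1"
        unfolding j_def using nn by linarith+
      have "(\<tau> - 1) * real m < 1 * real m" using \<tau> m by (intro mult_strict_right_mono) auto
      then have "j < m" using j(1) by simp
      moreover have "\<tau> \<in> T j" unfolding T_def using j m by (auto simp: field_simps)
      ultimately show "\<tau> \<in> (\<Union>j\<in>{..<m}. T j)" by blast
    qed
    then have "(\<Union>j\<in>{..<m}. A j) = {\<tau> \<in> {1..<2}. a + \<tau> *\<^sub>R y \<in> K \<and> g (a + \<tau> *\<^sub>R y) < 0}"
      unfolding A_def by blast
    ultimately show ?thesis by simp
  qed
  then show ?thesis by blast
qed

section \<open>Oscillatory integrals with convex phase\<close>

text \<open>Integration by parts against \<open>\<psi> / h'\<close>. Two of the three terms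
  \<open>A / Q\<close> come from the endpoints, the third from the variation of
  \<open>1 / h'\<close>, which is monotone because \<open>h'' \<ge> 0\<close>; the term with
  \<open>B\<close> comes from the derivative of the amplitude.\<close>

lemma van_der_corput_convex:
  fixes h h' h'' \<psi> \<psi>' :: "real \<Rightarrow> real"
  assumes ab: "a \<le> b" and pos: "\<Lambda> > 0" "Q > 0"
    and h: "\<And>t. t \<in> {a..b} \<Longrightarrow> (h has_real_derivative h' t) (at t)"
    and h': "\<And>t. t \<in> {a..b} \<Longrightarrow> (h' has_real_derivative h'' t) (at t)"
    and \<psi>: "\<And>t. t \<in> {a..b} \<Longrightarrow> (\<psi> has_real_derivative \<psi>' t) (at t)"
    and cont: "continuous_on {a..b} h''" "continuous_on {a..b} \<psi>'"
    and h''_nonneg: "\<And>t. t \<in> {a..b} \<Longrightarrow> 0 \<le> h'' t"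
    and h'_ge: "\<And>t. t \<in> {a..b} \<Longrightarrow> Q \<le> h' t"
    and bd: "\<And>t. t \<in> {a..b} \<Longrightarrow> \<bar>\<psi> t\<bar> \<le> A" "\<And>t. t \<in> {a..b} \<Longrightarrow> \<bar>\<psi>' t\<bar> \<le> B"
  shows "norm (integral {a..b} (\<lambda>t. exp (- \<i> * complex_of_real (\<Lambda> * h t)) * complex_of_real (\<psi> t)))
    \<le> (3 * A + B * (b - a)) / (\<Lambda> * Q)"
proof -
  define E where "E t = exp (- \<i> * complex_of_real (\<Lambda> * h t))" for t
  have norm_E: "norm (E t) = 1" for t unfolding E_def by (simp add: norm_exp_eq_Re)
  define w where "w t = \<psi> t / h' t" for t
  define w' where "w' t = (\<psi>' t * h' t - \<psi> t * h'' t) / (h' t * h' t)" for t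
  have h'_pos: "h' t > 0" if "t \<in> {a..b}" for t using h'_ge[OF that] pos by linarith
  have A: "A \<ge> 0" using bd(1)[of a] ab by auto
  have E': "(E has_vector_derivative (- \<i> * complex_of_real (\<Lambda> * h' t)) * E t) (at t)" if "t \<in> {a..b}" for t
  proof -
    have "((\<lambda>t. - \<i> * complex_of_real (\<Lambda> * h t)) has_vector_derivative - \<i> * complex_of_real (\<Lambda> * h' t)) (at t)"
      by (auto intro!: derivative_eq_intros h[OF that])
    from field_vector_diff_chain_at[OF this DERIV_exp] show ?thesis
      unfolding E_def by (simp add: o_def)
  qed
  have w': "((\<lambda>t. complex_of_real (w t)) has_vector_derivative complex_of_real (w' t)) (at t)"
    if "t \<in> {a..b}" for t
    unfolding w_def w'_def using h'_pos[OF that]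
    by (intro has_vector_derivative_of_real DERIV_divide \<psi> h' that) simp
  define G where "G t = complex_of_real (w t) * E t" for t
  have G': "(G has_vector_derivative complex_of_real (w' t) * E t - \<i> * complex_of_real \<Lambda> * (E t * complex_of_real (\<psi> t))) (at t)"
    if t: "t \<in> {a..b}" for t
  proof -
    have wh: "\<psi> t = w t * h' t" unfolding w_def using h'_pos[OF t] by simp
    have "complex_of_real (w t) * ((- \<i> * complex_of_real (\<Lambda> * h' t)) * E t) + complex_of_real (w' t) * E t
        = complex_of_real (w' t) * E t - \<i> * complex_of_real \<Lambda> * (E t * complex_of_real (\<psi> t))"
      unfolding wh by (simp add: algebra_simps)
    then show ?thesis
      unfolding G_def using has_vector_derivative_mult[OF w'[OF t] E'[OF t]] by (simp only:)
  qed
  have contE: "continuous_on {a..b} E"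
    using E' has_vector_derivative_continuous continuous_at_imp_continuous_on by blast
  have cont_h': "continuous_on {a..b} h'" "continuous_on {a..b} \<psi>"
    using h' \<psi> DERIV_isCont continuous_at_imp_continuous_on by blast+
  have cont_w': "continuous_on {a..b} w'"
    unfolding w'_def using h'_pos by (intro continuous_intros cont cont_h') force
  have int_w': "(\<lambda>t. complex_of_real (w' t) * E t) integrable_on {a..b}"
    by (intro integrable_continuous_real continuous_intros cont_w' contE)
  have int1: "(\<lambda>t. E t * complex_of_real (\<psi> t)) integrable_on {a..b}"
    by (intro integrable_continuous_real continuous_intros cont_h' contE)
  have "((\<lambda>t. complex_of_real (w' t) * E t - \<i> * complex_of_real \<Lambda> * (E t * complex_of_real (\<psi> t))) has_integral G b - G a) {a..b}"
    by (rule fundamental_theorem_of_calculus[OF ab]) (use G' has_vector_derivative_at_within in blast)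
  moreover have "((\<lambda>t. complex_of_real (w' t) * E t - \<i> * complex_of_real \<Lambda> * (E t * complex_of_real (\<psi> t))) has_integral
      integral {a..b} (\<lambda>t. complex_of_real (w' t) * E t) - \<i> * complex_of_real \<Lambda> * integral {a..b} (\<lambda>t. E t * complex_of_real (\<psi> t))) {a..b}"
    by (intro has_integral_diff has_integral_mult_right integrable_integral int_w' int1)
  ultimately have "G b - G a = integral {a..b} (\<lambda>t. complex_of_real (w' t) * E t)
      - \<i> * complex_of_real \<Lambda> * integral {a..b} (\<lambda>t. E t * complex_of_real (\<psi> t))"
    by (rule has_integral_unique)
  then have "\<i> * complex_of_real \<Lambda> * integral {a..b} (\<lambda>t. E t * complex_of_real (\<psi> t))
      = integral {a..b} (\<lambda>t. complex_of_real (w' t) * E t) - (G b - G a)" by (simp add: algebra_simps)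
  then have "norm (\<i> * complex_of_real \<Lambda> * integral {a..b} (\<lambda>t. E t * complex_of_real (\<psi> t)))
      \<le> norm (integral {a..b} (\<lambda>t. complex_of_real (w' t) * E t)) + (norm (G b) + norm (G a))"
    by (simp only:) (rule order_trans[OF norm_triangle_ineq4 add_left_mono[OF norm_triangle_ineq4]])
  moreover have "norm (\<i> * complex_of_real \<Lambda> * integral {a..b} (\<lambda>t. E t * complex_of_real (\<psi> t)))
      = \<Lambda> * norm (integral {a..b} (\<lambda>t. E t * complex_of_real (\<psi> t)))" using pos by (simp add: norm_mult)
  moreover have G_le: "norm (G t) \<le> A / Q" if "t \<in> {a..b}" for t
  proof -
    have "norm (G t) = \<bar>\<psi> t\<bar> / h' t" unfolding G_def w_def using h'_pos[OF that] by (simp add: norm_mult norm_E norm_divide)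
    also have "\<dots> \<le> A / Q" using bd(1)[OF that] h'_ge[OF that] pos A by (intro frac_le) auto
    finally show ?thesis .
  qed
  moreover have "norm (integral {a..b} (\<lambda>t. complex_of_real (w' t) * E t)) \<le> A / Q + B * (b - a) / Q"
  proof -
    \<comment> \<open>As \<open>h'' \<ge> 0\<close>, the majorant \<open>A * h'' / h'^2\<close> is
      an exact derivative, so no bound on the size of \<open>h''\<close> enters.\<close>
    have inv: "((\<lambda>t. - (A / h' t)) has_vector_derivative A * h'' t / (h' t * h' t)) (at t within {a..b})"
      if t: "t \<in> {a..b}" for t
    proof -
      have "((\<lambda>t. - (A / h' t)) has_real_derivative A * h'' t / (h' t * h' t)) (at t)"
        using h'_pos[OF t] by (auto intro!: derivative_eq_intros h'[OF t])
      then show ?thesis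
        by (simp add: has_real_derivative_iff_has_vector_derivative has_vector_derivative_at_within)
    qed
    have I1: "((\<lambda>t. A * h'' t / (h' t * h' t)) has_integral - (A / h' b) - - (A / h' a)) {a..b}"
      by (rule fundamental_theorem_of_calculus[OF ab inv])
    have I2: "((\<lambda>t. B / Q) has_integral (b - a) * (B / Q)) {a..b}"
      using has_integral_const_real[of "B / Q" a b] ab by simp
    have I: "((\<lambda>t. A * h'' t / (h' t * h' t) + B / Q) has_integral (A / h' a - A / h' b) + (b - a) * (B / Q)) {a..b}"
      using has_integral_add[OF I1 I2] by simp
    have "norm (integral {a..b} (\<lambda>t. complex_of_real (w' t) * E t)) \<le> integral {a..b} (\<lambda>t. A * h'' t / (h' t * h' t) + B / Q)"
    proof (rule Henstock_Kurzweil_Integration.integral_norm_bound_integral[OF int_w'])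
      show "(\<lambda>t. A * h'' t / (h' t * h' t) + B / Q) integrable_on {a..b}" using I by blast
      fix t assume t: "t \<in> {a..b}"
      have "w' t = \<psi>' t / h' t - \<psi> t * h'' t / (h' t * h' t)"
        unfolding w'_def using h'_pos[OF t] by (simp add: diff_divide_distrib)
      then have "\<bar>w' t\<bar> \<le> \<bar>\<psi>' t / h' t\<bar> + \<bar>\<psi> t * h'' t / (h' t * h' t)\<bar>" by linarith
      also have "\<bar>\<psi>' t / h' t\<bar> \<le> B / Q"
        using bd(2)[OF t] h'_ge[OF t] h'_pos[OF t] pos by (auto simp: abs_divide intro!: frac_le)
      also have "\<bar>\<psi> t * h'' t / (h' t * h' t)\<bar> \<le> A * h'' t / (h' t * h' t)"
        using bd(1)[OF t] h''_nonneg[OF t] h'_pos[OF t] by (auto simp: abs_mult abs_divide intro!: divide_right_mono mult_right_mono)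
      finally show "norm (complex_of_real (w' t) * E t) \<le> A * h'' t / (h' t * h' t) + B / Q"
        by (simp add: norm_mult norm_E)
    qed
    also have "\<dots> = (A / h' a - A / h' b) + (b - a) * (B / Q)" using I by (rule integral_unique)
    also have "\<dots> \<le> A / Q + B * (b - a) / Q"
    proof -
      have "A / h' a \<le> A / Q" using h'_ge[of a] ab pos A by (intro divide_left_mono) auto
      moreover have "A / h' b \<ge> 0" using h'_pos[of b] ab A by auto
      ultimately show ?thesis by (simp add: mult.commute)
    qed
    finally show ?thesis .
  qed
  moreover have "norm (G a) \<le> A / Q" "norm (G b) \<le> A / Q" using G_le ab by auto
  ultimately have "\<Lambda> * norm (integral {a..b} (\<lambda>t. E t * complex_of_real (\<psi> t)))
      \<le> (A / Q + B * (b - a) / Q) + (A / Q + A / Q)"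
    by linarith
  also have "\<dots> = (3 * A + B * (b - a)) / Q" by (simp add: add_divide_distrib)
  finally have "norm (integral {a..b} (\<lambda>t. E t * complex_of_real (\<psi> t))) \<le> (3 * A + B * (b - a)) / (\<Lambda> * Q)"
    using pos by (simp add: field_simps)
  then show ?thesis unfolding E_def .
qed

lemma has_vector_derivative_along_line:
  assumes "(f has_derivative F) (at (a + t *\<^sub>R y))"
  shows "((\<lambda>\<tau>. f (a + \<tau> *\<^sub>R y)) has_vector_derivative F y) (at t)"
proof -
  have "((\<lambda>\<tau>. a + \<tau> *\<^sub>R y) has_derivative (\<lambda>h. h *\<^sub>R y)) (at t)"
    by (auto intro!: derivative_eq_intros)
  from has_derivative_compose[OF this assms] show ?thesis
    unfolding has_vector_derivative_def
    using linear_scale[OF has_derivative_linear[OF assms]] by simp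
qed

lemma convex_on_above_tangent:
  fixes f :: "'a::real_normed_vector \<Rightarrow> real"
  assumes "convex_on U f" "(f has_derivative F) (at x)" "x \<in> U" "z \<in> U"
  shows "F (z - x) \<le> f z - f x"
proof -
  let ?k = "\<lambda>t. f (x + t *\<^sub>R (z - x))"
  have "(?k has_vector_derivative F (z - x)) (at 0)"
    by (rule has_vector_derivative_along_line) (use assms(2) in simp)
  then have "((\<lambda>h. (?k (0 + h) - ?k 0) / h) \<longlongrightarrow> F (z - x)) (at 0)"
    by (simp add: has_real_derivative_iff_has_vector_derivative[symmetric] DERIV_def)
  then have lim: "((\<lambda>h. (?k (0 + h) - ?k 0) / h) \<longlongrightarrow> F (z - x)) (at_right 0)"
    by (rule filterlim_mono) (auto simp: at_le)
  have "eventually (\<lambda>h. (?k (0 + h) - ?k 0) / h \<le> f z - f x) (at_right 0)"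
    unfolding eventually_at_right_field
  proof (intro exI[of _ 1] conjI allI impI)
    fix h :: real assume h: "0 < h" "h < 1"
    have "f ((1 - h) *\<^sub>R x + h *\<^sub>R z) \<le> (1 - h) * f x + h * f z"
      using h by (intro convex_onD[OF assms(1)] assms(3,4)) auto
    moreover have "(1 - h) *\<^sub>R x + h *\<^sub>R z = x + h *\<^sub>R (z - x)" by (simp add: algebra_simps)
    ultimately have "?k h - f x \<le> h * (f z - f x)" by (simp add: algebra_simps)
    then show "(?k (0 + h) - ?k 0) / h \<le> f z - f x" using h by (simp add: field_simps)
  qed simp
  then show ?thesis by (rule tendsto_upperbound[OF lim]) simp
qed

text \<open>Adding the tangent inequalities at two points of a line shows that the derivative along
  the line is monotone.\<close>

lemma convex_on_second_derivative_nonneg: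
  fixes f :: "'a::real_normed_vector \<Rightarrow> real" and f' :: "'a \<Rightarrow> 'a \<Rightarrow>\<^sub>L real"
  assumes "open U" "convex_on U f" "x \<in> U"
    and f': "\<And>x. x \<in> U \<Longrightarrow> (f has_derivative blinfun_apply (f' x)) (at x)"
    and F: "(f' has_derivative F) (at x)"
  shows "0 \<le> blinfun_apply (F y) y"
proof -
  let ?k = "\<lambda>\<tau>. blinfun_apply (f' (x + \<tau> *\<^sub>R y)) y"
  have "((\<lambda>\<tau>. f' (x + \<tau> *\<^sub>R y)) has_vector_derivative F y) (at 0)"
    by (rule has_vector_derivative_along_line) (use F in simp)
  from bounded_linear.has_vector_derivative[OF blinfun.bounded_linear_left this]
  have d: "(?k has_real_derivative blinfun_apply (F y) y) (at 0)"
    by (simp add: has_real_derivative_iff_has_vector_derivative)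
  let ?A = "(\<lambda>\<tau>. x + \<tau> *\<^sub>R y) -` U"
  have "open ?A" by (intro open_vimage assms(1) continuous_intros)
  moreover have "mono_on ?A ?k"
  proof (rule mono_onI)
    fix s t assume st: "s \<in> ?A" "t \<in> ?A" "s \<le> t"
    have 1: "blinfun_apply (f' (x + s *\<^sub>R y)) ((t - s) *\<^sub>R y) \<le> f (x + t *\<^sub>R y) - f (x + s *\<^sub>R y)"
      using convex_on_above_tangent[OF assms(2) f'[of "x + s *\<^sub>R y"], of "x + t *\<^sub>R y"] st
      by (simp add: scaleR_diff_left)
    have 2: "blinfun_apply (f' (x + t *\<^sub>R y)) ((s - t) *\<^sub>R y) \<le> f (x + s *\<^sub>R y) - f (x + t *\<^sub>R y)"
      using convex_on_above_tangent[OF assms(2) f'[of "x + t *\<^sub>R y"], of "x + s *\<^sub>R y"] st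
      by (simp add: scaleR_diff_left)
    have "(s - t) * ?k t = - ((t - s) * ?k t)" by (simp add: algebra_simps)
    then have "(t - s) * ?k s \<le> (t - s) * ?k t"
      using 1 2 unfolding blinfun.scaleR_right real_scaleR_def by linarith
    then show "?k s \<le> ?k t"
      using st(3) by (cases "s = t") (auto simp: mult_le_cancel_left)
  qed
  ultimately show ?thesis
    using mono_on_imp_deriv_nonneg[OF _ d] assms(3) by (simp add: interior_open)
qed

section \<open>Averaging over dilations, and the bound along one ray\<close>

text \<open>For each \<tau> the substitution \<open>x = a + \<tau> y\<close> leaves the integral of
  \<open>F\<close> unchanged; as the interval of \<tau> has length 1, averaging needs no
  normalization. From \<open>\<tau> \<ge> 1\<close> it follows that \<open>y\<close> stays in the
  ball of radius \<open>R\<close>, which gives the integrable majorant for Fubini.\<close>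

lemma norm_integral_le_dilations:
  fixes F :: "'a::euclidean_space \<Rightarrow> complex"
  assumes F: "F \<in> borel_measurable borel" "\<And>x. norm (F x) \<le> M" "\<And>x. F x \<noteq> 0 \<Longrightarrow> x \<in> cball a R"
  shows "ennreal (norm (\<integral>x. F x \<partial>lborel)) \<le>
    (\<integral>\<^sup>+y. ennreal (norm (\<integral>\<tau>. indicator {1..<2} \<tau> *\<^sub>R (\<tau> ^ DIM('a) *\<^sub>R F (a + \<tau> *\<^sub>R y)) \<partial>lborel)) \<partial>lborel)"
proof -
  let ?H = "\<lambda>\<tau> y. indicator {1..<2} \<tau> *\<^sub>R (\<tau> ^ DIM('a) *\<^sub>R F (a + \<tau> *\<^sub>R y)) :: complex"
  have [measurable]: "F \<in> borel_measurable borel" by fact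
  have M: "M \<ge> 0" using F(2)[of 0] norm_ge_zero order_trans by blast
  have bound: "norm (?H \<tau> y) \<le> (2 ^ DIM('a) * M) * indicator ({1..2} \<times> cball 0 R) (\<tau>, y)" for \<tau> y
  proof (cases "\<tau> \<in> {1..<2} \<and> F (a + \<tau> *\<^sub>R y) \<noteq> 0")
    case True
    then have "a + \<tau> *\<^sub>R y \<in> cball a R" using F(3) by blast
    then have "\<tau> * norm y \<le> R" using True by (simp add: dist_norm)
    moreover have "1 * norm y \<le> \<tau> * norm y" using True by (intro mult_right_mono) auto
    ultimately have "y \<in> cball 0 R" by simp
    moreover have "\<tau> ^ DIM('a) * norm (F (a + \<tau> *\<^sub>R y)) \<le> 2 ^ DIM('a) * M"
      using True F(2) by (intro mult_mono power_mono) auto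
    ultimately show ?thesis using True by simp
  qed (use M in \<open>auto simp: indicator_def\<close>)
  have int: "integrable (lborel \<Otimes>\<^sub>M lborel) (\<lambda>(\<tau>, y). ?H \<tau> y)"
  proof (rule Bochner_Integration.integrable_bound)
    have "emeasure (lborel \<Otimes>\<^sub>M lborel) ({1..2::real} \<times> cball (0::'a) R) < \<infinity>"
      using emeasure_bounded_finite[OF bounded_cball, of "0::'a" R]
      by (subst lborel.emeasure_pair_measure_Times) (auto simp: ennreal_mult_less_top)
    then show "integrable (lborel \<Otimes>\<^sub>M lborel) (\<lambda>p. (2 ^ DIM('a) * M) * indicator ({1..2::real} \<times> cball (0::'a) R) p :: real)"
      by (intro integrable_mult_right) (auto intro!: integrable_real_indicator)
    show "(\<lambda>(\<tau>, y). ?H \<tau> y) \<in> borel_measurable (lborel \<Otimes>\<^sub>M lborel)"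
      by measurable
    show "AE p in lborel \<Otimes>\<^sub>M lborel. norm (case p of (\<tau>, y) \<Rightarrow> ?H \<tau> y)
        \<le> norm ((2 ^ DIM('a) * M) * indicator ({1..2::real} \<times> cball (0::'a) R) p :: real)"
    proof (rule AE_I2)
      fix p :: "real \<times> 'a"
      obtain \<tau> y where p: "p = (\<tau>, y)" by (cases p)
      show "norm (case p of (\<tau>, y) \<Rightarrow> ?H \<tau> y)
          \<le> norm ((2 ^ DIM('a) * M) * indicator ({1..2::real} \<times> cball (0::'a) R) p :: real)"
        unfolding p using order_trans[OF bound[of \<tau> y] abs_ge_self] by (simp only: prod.case real_norm_def)
    qed
  qed
  have inner: "(\<integral>y. ?H \<tau> y \<partial>lborel) = indicator {1..<2} \<tau> *\<^sub>R (\<integral>x. F x \<partial>lborel)" for \<tau>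
  proof (cases "\<tau> \<in> {1..<2}")
    case True
    then have "\<tau> > 0" by simp
    have "(\<integral>x. F x \<partial>lborel) = (\<integral>x. F x \<partial>density (distr lborel borel (\<lambda>x. a + \<tau> *\<^sub>R x)) (\<lambda>_. ennreal (\<bar>\<tau>\<bar> ^ DIM('a))))"
      using lborel_affine[of \<tau> a] \<open>\<tau> > 0\<close> by (simp add: ennreal_power)
    also have "\<dots> = (\<integral>x. \<bar>\<tau>\<bar> ^ DIM('a) *\<^sub>R F (a + \<tau> *\<^sub>R x) \<partial>lborel)"
      by (subst integral_density) (auto simp: integral_distr)
    finally show ?thesis using True by simp
  qed simp
  have "(\<integral>y. (\<integral>\<tau>. ?H \<tau> y \<partial>lborel) \<partial>lborel) = (\<integral>\<tau>. (\<integral>y. ?H \<tau> y \<partial>lborel) \<partial>lborel)"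
    by (rule lborel_pair.Fubini_integral[OF int])
  also have "\<dots> = (\<integral>\<tau>. indicator {1..<2} \<tau> *\<^sub>R (\<integral>x. F x \<partial>lborel) \<partial>(lborel :: real measure))"
    by (simp only: inner)
  also have "\<dots> = (\<integral>x. F x \<partial>lborel)" by simp
  finally have "(\<integral>x. F x \<partial>lborel) = (\<integral>y. (\<integral>\<tau>. ?H \<tau> y \<partial>lborel) \<partial>lborel)" by simp
  moreover have "integrable lborel (\<lambda>y. \<integral>\<tau>. ?H \<tau> y \<partial>lborel)"
    by (rule lborel_pair.integrable_snd[OF int])
  ultimately show ?thesis using integral_norm_bound_ennreal by simp
qed

lemma analytic_family_ray_interval_union:
  fixes g :: "'i \<Rightarrow> real ^ 'n \<Rightarrow> real"
  assumes "compact K" "convex K" "finite I"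
    and "\<And>i. i \<in> I \<Longrightarrow> K \<subseteq> V i" "\<And>i. i \<in> I \<Longrightarrow> real_analytic_on (V i) (g i)"
  shows "\<exists>N. \<forall>a y. norm y \<le> R \<longrightarrow>
    interval_union N {\<tau> \<in> {1..<2}. a + \<tau> *\<^sub>R y \<in> K \<and> (\<forall>i\<in>I. g i (a + \<tau> *\<^sub>R y) < 0)}"
  using assms(3-5)
proof (induction I)
  case empty
  have "interval_union 1 ({1..<2} \<inter> {\<tau>. a + \<tau> *\<^sub>R y \<in> K})" for a y :: "real ^ 'n"
    by (intro interval_union_single is_interval_Int is_interval_line_preimage assms(2) is_interval_co)
  moreover have "{1..<2} \<inter> {\<tau>. a + \<tau> *\<^sub>R y \<in> K}
      = {\<tau> \<in> {1..<2}. a + \<tau> *\<^sub>R y \<in> K \<and> (\<forall>i\<in>{}. g i (a + \<tau> *\<^sub>R y) < 0)}" for a y :: "real ^ 'n"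
    by auto
  ultimately show ?case by metis
next
  case (insert j I)
  let ?A = "\<lambda>I a y. {\<tau> \<in> {1..<2}. a + \<tau> *\<^sub>R y \<in> K \<and> (\<forall>i\<in>I. g i (a + \<tau> *\<^sub>R y) < 0)}"
  obtain N where N: "\<forall>a y. norm y \<le> R \<longrightarrow> interval_union N (?A I a y)"
    using insert by auto
  obtain N' where N': "\<forall>a y. norm y \<le> R \<longrightarrow>
      interval_union N' {\<tau> \<in> {1..<2}. a + \<tau> *\<^sub>R y \<in> K \<and> g j (a + \<tau> *\<^sub>R y) < 0}"
    using analytic_ray_interval_union[OF assms(1,2), of "V j" "g j" R] insert.prems by auto
  show ?case
  proof (intro exI[of _ "N * N'"] allI impI)
    fix a y :: "real ^ 'n" assume y: "norm y \<le> R"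
    have "interval_union (N * N') (?A I a y \<inter> {\<tau> \<in> {1..<2}. a + \<tau> *\<^sub>R y \<in> K \<and> g j (a + \<tau> *\<^sub>R y) < 0})"
      by (rule interval_union_Int) (use N N' y in auto)
    also have "?A I a y \<inter> {\<tau> \<in> {1..<2}. a + \<tau> *\<^sub>R y \<in> K \<and> g j (a + \<tau> *\<^sub>R y) < 0} = ?A (insert j I) a y"
      by auto
    finally show "interval_union (N * N') (?A (insert j I) a y)" .
  qed
qed

text \<open>The pieces may be open, half open or closed; this passes to the closed intervals on
  which integration by parts takes place.\<close>

lemma integral_interval_closure:
  fixes u :: "real \<Rightarrow> complex"
  assumes "is_interval X" "X \<noteq> {}" "bounded X"
  shows "integral X u = integral {Inf X..Sup X} u" "{Inf X..Sup X} \<subseteq> closure X" "Inf X \<le> Sup X"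
proof -
  have bdd: "bdd_below X" "bdd_above X"
    using assms(3) by (auto simp: bounded_imp_bdd_below bounded_imp_bdd_above)
  have sub: "X \<subseteq> {Inf X..Sup X}"
    using bdd by (auto intro: cInf_lower cSup_upper)
  have "t \<in> X" if t: "Inf X < t" "t < Sup X" for t
  proof -
    obtain x where "x \<in> X" "x < t" using cInf_lessD[OF assms(2) t(1)] by blast
    moreover obtain z where "z \<in> X" "t < z" using less_cSupE[OF t(2) assms(2)] by blast
    ultimately show ?thesis using is_interval_realD[OF assms(1), of x z t] by simp
  qed
  then have "{Inf X..Sup X} - X \<subseteq> {Inf X, Sup X}" by force
  then have "negligible ({Inf X..Sup X} - X)" by (rule negligible_subset[rotated]) simp
  then show "integral X u = integral {Inf X..Sup X} u" by (rule integral_subset_negligible[OF sub])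
  have "{Inf X..Sup X} \<subseteq> X \<union> {Inf X, Sup X}" using \<open>{Inf X..Sup X} - X \<subseteq> {Inf X, Sup X}\<close> by blast
  also have "\<dots> \<subseteq> closure X"
    using closure_subset[of X] closure_contains_Inf[OF assms(2) bdd(1)] closure_contains_Sup[OF assms(2) bdd(2)] by auto
  finally show "{Inf X..Sup X} \<subseteq> closure X" .
  show "Inf X \<le> Sup X" using sub assms(2) by auto
qed

locale convex_graph =
  fixes U K :: "'a::euclidean_space set" and f :: "'a \<Rightarrow> real"
    and f' :: "'a \<Rightarrow> 'a \<Rightarrow>\<^sub>L real" and f'' :: "'a \<Rightarrow> 'a \<Rightarrow>\<^sub>L ('a \<Rightarrow>\<^sub>L real)"
  assumes open_U: "open U" and compact_K: "compact K" and convex_K: "convex K" and K_U: "K \<subseteq> U"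
    and convex_f: "convex_on U f"
    and f': "\<And>x. x \<in> U \<Longrightarrow> (f has_derivative blinfun_apply (f' x)) (at x)"
    and f'': "\<And>x. x \<in> U \<Longrightarrow> (f' has_derivative blinfun_apply (f'' x)) (at x)"
    and cont_f'': "continuous_on U f''"
begin

definition phase :: "'a \<times> real \<Rightarrow> 'a \<Rightarrow> real" where "phase v x = (x, f x) \<bullet> v"

lemma cont_f: "continuous_on U f"
  using f' has_derivative_continuous continuous_at_imp_continuous_on by blast

lemma continuous_on_phase: "continuous_on U (phase v)"
  unfolding phase_def by (intro continuous_intros cont_f)

lemma phase_ray_derivatives:
  assumes "a + t *\<^sub>R y \<in> U"
  shows "((\<lambda>t. phase v (a + t *\<^sub>R y)) has_real_derivative
      (y \<bullet> fst v + snd v * blinfun_apply (f' (a + t *\<^sub>R y)) y)) (at t)"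
    and "((\<lambda>t. y \<bullet> fst v + snd v * blinfun_apply (f' (a + t *\<^sub>R y)) y) has_real_derivative
      snd v * blinfun_apply (blinfun_apply (f'' (a + t *\<^sub>R y)) y) y) (at t)"
proof -
  have 1: "((\<lambda>t. f (a + t *\<^sub>R y)) has_real_derivative blinfun_apply (f' (a + t *\<^sub>R y)) y) (at t)"
    using has_vector_derivative_along_line[OF f'[OF assms]]
    by (simp add: has_real_derivative_iff_has_vector_derivative)
  have "phase v (a + t *\<^sub>R y) = a \<bullet> fst v + t * (y \<bullet> fst v) + f (a + t *\<^sub>R y) * snd v" for t
    unfolding phase_def by (simp add: inner_prod_def inner_add_left)
  then show "((\<lambda>t. phase v (a + t *\<^sub>R y)) has_real_derivative
      (y \<bullet> fst v + snd v * blinfun_apply (f' (a + t *\<^sub>R y)) y)) (at t)"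
    by (auto intro!: derivative_eq_intros 1)
  have "((\<lambda>t. blinfun_apply (f' (a + t *\<^sub>R y)) y) has_real_derivative blinfun_apply (blinfun_apply (f'' (a + t *\<^sub>R y)) y) y) (at t)"
    using bounded_linear.has_vector_derivative[OF blinfun.bounded_linear_left has_vector_derivative_along_line[OF f''[OF assms]]]
    by (simp add: has_real_derivative_iff_has_vector_derivative)
  then show "((\<lambda>t. y \<bullet> fst v + snd v * blinfun_apply (f' (a + t *\<^sub>R y)) y) has_real_derivative
      snd v * blinfun_apply (blinfun_apply (f'' (a + t *\<^sub>R y)) y) y) (at t)"
    by (auto intro!: derivative_eq_intros)
qed

lemma phase_above_tangent:
  assumes "x \<in> U" "z \<in> U" "snd v \<ge> 0"
  shows "(z - x) \<bullet> fst v + snd v * blinfun_apply (f' x) (z - x) \<le> phase v z - phase v x"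
proof -
  have "snd v * blinfun_apply (f' x) (z - x) \<le> snd v * (f z - f x)"
    by (intro mult_left_mono convex_on_above_tangent[OF convex_f f'] assms)
  then show ?thesis unfolding phase_def by (simp add: inner_prod_def inner_diff_left algebra_simps)
qed

text \<open>\<open>a + y\<close> is the convex combination of \<open>a\<close> and
  \<open>a + t y\<close> with weight \<open>1 / t\<close> on the latter;
  \<open>snd v \<ge> 0\<close> preserves the direction of the inequality.\<close>

lemma convex_on_phase:
  assumes "snd v \<ge> 0" "a \<in> U" "a + t *\<^sub>R y \<in> U" "1 \<le> t"
  shows "t * (phase v (a + y) - phase v a) \<le> phase v (a + t *\<^sub>R y) - phase v a"
proof -
  have eq: "a + y = (1 - 1 / t) *\<^sub>R a + (1 / t) *\<^sub>R (a + t *\<^sub>R y)" using assms(4) by (simp add: algebra_simps)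
  have "f (a + y) \<le> (1 - 1 / t) * f a + (1 / t) * f (a + t *\<^sub>R y)"
    unfolding eq by (rule convex_onD[OF convex_f]) (use assms in auto)
  then have "t * f (a + y) \<le> t * ((1 - 1 / t) * f a + (1 / t) * f (a + t *\<^sub>R y))"
    using assms(4) by (intro mult_left_mono) auto
  also have "\<dots> = (t - 1) * f a + f (a + t *\<^sub>R y)" using assms(4) by (simp add: field_simps)
  finally have "t * (f (a + y) - f a) \<le> f (a + t *\<^sub>R y) - f a" by (simp add: algebra_simps)
  then have "snd v * (t * (f (a + y) - f a)) \<le> snd v * (f (a + t *\<^sub>R y) - f a)"
    using assms(1) by (rule mult_left_mono)
  then show ?thesis unfolding phase_def by (simp add: inner_prod_def inner_add_left algebra_simps)
qed

text \<open>The closure of \<open>X\<close> may contain \<open>t = 2\<close>, so the amplitude is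
  controlled up to and including 2; the closed interval is still mapped into \<open>K\<close>
  because \<open>K\<close> is closed.\<close>

lemma ray_integral_bound:
  assumes v: "snd v \<ge> 0" and a: "a \<in> K" and \<Lambda>: "\<Lambda> > 0" and Q: "phase v (a + y) - phase v a > 0"
    and X: "is_interval X" "X \<subseteq> {1..<2}" "\<And>t. t \<in> X \<Longrightarrow> a + t *\<^sub>R y \<in> K"
    and \<psi>: "\<And>t. t \<in> {1..2} \<Longrightarrow> (\<psi> has_real_derivative \<psi>' t) (at t)" "continuous_on {1..2} \<psi>'"
    and bd: "\<And>t. t \<in> {1..2} \<Longrightarrow> a + t *\<^sub>R y \<in> K \<Longrightarrow> \<bar>\<psi> t\<bar> \<le> A"
      "\<And>t. t \<in> {1..2} \<Longrightarrow> a + t *\<^sub>R y \<in> K \<Longrightarrow> \<bar>\<psi>' t\<bar> \<le> B"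
    and AB: "A \<ge> 0" "B \<ge> 0"
  shows "norm (integral X (\<lambda>t. exp (- \<i> * complex_of_real (\<Lambda> * phase v (a + t *\<^sub>R y))) * complex_of_real (\<psi> t)))
    \<le> (3 * A + B) / (\<Lambda> * (phase v (a + y) - phase v a))"
proof (cases "X = {}")
  case True
  then show ?thesis using AB \<Lambda> Q by simp
next
  case False
  have bdd: "bounded X" 
    by (rule bounded_subset[OF compact_imp_bounded[OF compact_Icc, of 1 2]]) (use X(2) in auto)
  let ?I = "{Inf X..Sup X}"
  note cl = integral_interval_closure[OF X(1) False bdd]
  have "closed {t. a + t *\<^sub>R y \<in> K}"
    using continuous_closed_vimage[OF compact_imp_closed[OF compact_K], of "\<lambda>t. a + t *\<^sub>R y"]
    by (simp add: vimage_def)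
  then have "closure X \<subseteq> {t. a + t *\<^sub>R y \<in> K}" using X(3) by (intro closure_minimal) auto
  moreover have "closure X \<subseteq> {1..2}" using X(2) by (intro closure_minimal) auto
  ultimately have I: "a + t *\<^sub>R y \<in> K" "t \<in> {1..2}" if "t \<in> ?I" for t using cl(2) that by blast+
  then have IU: "a + t *\<^sub>R y \<in> U" if "t \<in> ?I" for t using K_U that by blast
  have aU: "a \<in> U" using a K_U by blast
  have "norm (integral ?I (\<lambda>t. exp (- \<i> * complex_of_real (\<Lambda> * phase v (a + t *\<^sub>R y))) * complex_of_real (\<psi> t)))
      \<le> (3 * A + B * (Sup X - Inf X)) / (\<Lambda> * (phase v (a + y) - phase v a))"
  proof (rule van_der_corput_convex[OF cl(3) \<Lambda> Q phase_ray_derivatives(1) phase_ray_derivatives(2) \<psi>(1)])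
    show "continuous_on ?I (\<lambda>t. snd v * blinfun_apply (blinfun_apply (f'' (a + t *\<^sub>R y)) y) y)"
      using IU by (intro continuous_intros continuous_on_compose2[OF cont_f'']) auto
    show "continuous_on ?I \<psi>'" by (rule continuous_on_subset[OF \<psi>(2)]) (use I(2) in blast)
    fix t assume t: "t \<in> ?I"
    show "0 \<le> snd v * blinfun_apply (blinfun_apply (f'' (a + t *\<^sub>R y)) y) y"
      by (intro mult_nonneg_nonneg v convex_on_second_derivative_nonneg[OF open_U convex_f IU[OF t] f' f''[OF IU[OF t]]])
    show "\<bar>\<psi> t\<bar> \<le> A" "\<bar>\<psi>' t\<bar> \<le> B" using bd I t by blast+
    \<comment> \<open>The tangent at \<open>a + t y\<close>, evaluated at \<open>a\<close>, gives
      \<open>t * h' t \<ge> P (a + t y) - P a\<close>; the slope inequality bounds this below by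
      \<open>t * (P (a + y) - P a)\<close>.\<close>
    show "phase v (a + y) - phase v a \<le> y \<bullet> fst v + snd v * blinfun_apply (f' (a + t *\<^sub>R y)) y"
    proof -
      let ?d = "y \<bullet> fst v + snd v * blinfun_apply (f' (a + t *\<^sub>R y)) y"
      have "(a - (a + t *\<^sub>R y)) \<bullet> fst v + snd v * blinfun_apply (f' (a + t *\<^sub>R y)) (a - (a + t *\<^sub>R y))
          \<le> phase v a - phase v (a + t *\<^sub>R y)"
        by (rule phase_above_tangent[OF IU[OF t] aU v])
      then have "phase v (a + t *\<^sub>R y) - phase v a \<le> t * ?d"
        by (simp add: blinfun.minus_right blinfun.scaleR_right algebra_simps)
      moreover have "t \<ge> 1" using I(2)[OF t] by simp
      moreover note convex_on_phase[OF v aU IU[OF t] \<open>t \<ge> 1\<close>]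
      ultimately have "t * (phase v (a + y) - phase v a) \<le> t * ?d" by linarith
      then show ?thesis using \<open>t \<ge> 1\<close> by (simp add: mult_le_cancel_left)
    qed
  qed (use I IU in auto)
  also have "\<dots> \<le> (3 * A + B) / (\<Lambda> * (phase v (a + y) - phase v a))"
  proof (intro divide_right_mono add_left_mono mult_left_le AB)
    have "Inf X \<in> ?I" "Sup X \<in> ?I" using cl(3) by auto
    then show "Sup X - Inf X \<le> 1" using I(2)[of "Inf X"] I(2)[of "Sup X"] by simp
  qed (use \<Lambda> Q in simp)
  finally show ?thesis unfolding cl(1) .
qed

end

section \<open>Dyadic summation and the reduction to sublevel sets\<close>

definition decay :: "real \<Rightarrow> real" where "decay z = (if z \<le> 1 then 1 else 1 / z)"

text \<open>One summand suffices: \<open>k = 0\<close> if \<open>z \<le> 2\<close>, otherwise the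
  \<open>k\<close> with \<open>2 ^ k < z \<le> 2 ^ (k + 1)\<close>.\<close>

lemma decay_le_dyadic: "ennreal (decay z) \<le> (\<Sum>k. ennreal ((1/2) ^ k) * indicator {..2 ^ (k + 1)} z)"
proof -
  have "\<exists>k. decay z \<le> (1/2) ^ k \<and> z \<le> 2 ^ (k + 1)"
  proof (cases "z \<le> 2")
    case True
    then show ?thesis by (intro exI[of _ 0]) (auto simp: decay_def)
  next
    case False
    obtain n where n: "z < 2 ^ n" using real_arch_pow[of 2 z] by auto
    define m where "m = (LEAST n. z \<le> 2 ^ n)"
    have m: "z \<le> 2 ^ m" unfolding m_def by (rule LeastI) (rule less_imp_le[OF n])
    have "m \<noteq> 0" using m False by (intro notI) simp
    then obtain k where k: "m = Suc k" using not0_implies_Suc by blast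
    have "\<not> z \<le> 2 ^ k" using not_less_Least[of k "\<lambda>n. z \<le> 2 ^ n"] k unfolding m_def by simp
    then have "1 / z \<le> 1 / 2 ^ k" by (intro divide_left_mono) (use False in auto)
    then show ?thesis using False m k by (intro exI[of _ k]) (auto simp: decay_def power_one_over)
  qed
  then obtain k where k: "decay z \<le> (1/2) ^ k" "z \<le> 2 ^ (k + 1)" by blast
  define F where "F k = ennreal ((1/2) ^ k) * indicator {..2 ^ (k + 1)} z" for k
  have "ennreal (decay z) \<le> F k"
    using k by (simp add: F_def ennreal_leI)
  also have "F k = (\<Sum>i\<in>{k}. F i)" by simp
  also have "\<dots> \<le> (\<Sum>k. F k)" by (rule sum_le_suminf) auto
  finally show ?thesis unfolding F_def .
qed

text \<open>Layer \<open>k\<close> has weight \<open>2 ^ -k\<close> and lies in the sublevel set of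
  height \<open>2 ^ (k + 1) / \<Lambda>\<close>, so its contribution is at most
  \<open>C * 2 powr \<alpha> * \<Lambda> powr - \<alpha>\<close> times the \<open>k\<close>-th power
  of \<open>2 powr (\<alpha> - 1)\<close>. The constant is the sum of this geometric series.\<close>

lemma nn_integral_decay_bound:
  fixes P :: "'a::euclidean_space \<Rightarrow> real"
  assumes [measurable]: "P \<in> borel_measurable borel" "K \<in> sets borel"
    and C: "C \<ge> 0" and \<alpha>: "\<alpha> < 1" and \<Lambda>: "\<Lambda> > 0"
    and sub: "\<And>t. t > 0 \<Longrightarrow> emeasure lborel {x \<in> K. P x \<le> inverse t} \<le> ennreal (C * t powr - \<alpha>)"
  shows "(\<integral>\<^sup>+x. ennreal (decay (\<Lambda> * P x)) * indicator K x \<partial>lborel)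
    \<le> ennreal (C * 2 powr \<alpha> / (1 - 2 powr (\<alpha> - 1)) * \<Lambda> powr - \<alpha>)"
proof -
  let ?S = "\<lambda>k. {x \<in> K. P x \<le> inverse (\<Lambda> / 2 ^ (k + 1))}"
  have "(\<integral>\<^sup>+x. ennreal (decay (\<Lambda> * P x)) * indicator K x \<partial>lborel)
      \<le> (\<integral>\<^sup>+x. (\<Sum>k. ennreal ((1/2) ^ k) * indicator (?S k) x) \<partial>lborel)"
  proof (rule nn_integral_mono)
    fix x
    show "ennreal (decay (\<Lambda> * P x)) * indicator K x \<le> (\<Sum>k. ennreal ((1/2) ^ k) * indicator (?S k) x)"
    proof (cases "x \<in> K")
      case True
      have "indicator {..2 ^ (k + 1)} (\<Lambda> * P x) = (indicator (?S k) x :: ennreal)" for k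
        using True \<Lambda> by (auto simp: indicator_def field_simps)
      then show ?thesis using decay_le_dyadic[of "\<Lambda> * P x"] True by simp
    qed simp
  qed
  also have "\<dots> = (\<Sum>k. \<integral>\<^sup>+x. ennreal ((1/2) ^ k) * indicator (?S k) x \<partial>lborel)"
    by (rule nn_integral_suminf) measurable
  also have "\<dots> = (\<Sum>k. ennreal ((1/2) ^ k) * emeasure lborel (?S k))"
    by (intro suminf_cong nn_integral_cmult_indicator) measurable
  also have "\<dots> \<le> (\<Sum>k. ennreal (C * 2 powr \<alpha> * \<Lambda> powr - \<alpha> * (2 powr (\<alpha> - 1)) ^ k))"
  proof (intro suminf_le summableI)
    fix k
    have "ennreal ((1/2) ^ k) * emeasure lborel (?S k) \<le> ennreal ((1/2) ^ k) * ennreal (C * (\<Lambda> / 2 ^ (k + 1)) powr - \<alpha>)"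
      by (intro mult_left_mono sub) (use \<Lambda> in auto)
    also have "\<dots> = ennreal ((1/2) ^ k * (C * (\<Lambda> / 2 ^ (k + 1)) powr - \<alpha>))"
      using C by (simp add: ennreal_mult)
    also have "(1/2) ^ k * (C * (\<Lambda> / 2 ^ (k + 1)) powr - \<alpha>) = C * 2 powr \<alpha> * \<Lambda> powr - \<alpha> * (2 powr (\<alpha> - 1)) ^ k"
    proof -
      have pow: "(2::real) ^ (k + 1) = 2 powr real (k + 1)" by (rule powr_realpow[symmetric]) simp
      have "(\<Lambda> / 2 ^ (k + 1)) powr - \<alpha> = \<Lambda> powr - \<alpha> * (2 powr real (k + 1)) powr \<alpha>"
        unfolding pow using \<Lambda> by (simp add: powr_divide powr_minus field_simps)
      also have "(2 powr real (k + 1)) powr \<alpha> = 2 powr \<alpha> * 2 powr (real k * \<alpha>)"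
        by (simp add: powr_powr powr_add[symmetric] algebra_simps)
      finally have "(\<Lambda> / 2 ^ (k + 1)) powr - \<alpha> = \<Lambda> powr - \<alpha> * (2 powr \<alpha> * 2 powr (real k * \<alpha>))" .
      moreover have "(2 powr (\<alpha> - 1)) ^ k = 2 powr (real k * \<alpha>) * (1/2) ^ k"
      proof -
        have "(2 powr (\<alpha> - 1)) ^ k = 2 powr (real k * \<alpha> + - real k)"
          by (simp add: powr_power algebra_simps)
        also have "\<dots> = 2 powr (real k * \<alpha>) * 2 powr - real k" by (rule powr_add)
        also have "2 powr - real k = (1/2 :: real) ^ k"
          by (simp add: powr_minus powr_realpow power_one_over inverse_eq_divide)
        finally show ?thesis .
      qed
      ultimately show ?thesis by simp
    qed
    finally show "ennreal ((1/2) ^ k) * emeasure lborel (?S k) \<le> ennreal (C * 2 powr \<alpha> * \<Lambda> powr - \<alpha> * (2 powr (\<alpha> - 1)) ^ k)" .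
  qed
  also have "\<dots> = ennreal (C * 2 powr \<alpha> * \<Lambda> powr - \<alpha> * (1 / (1 - 2 powr (\<alpha> - 1))))"
  proof (rule suminf_ennreal_eq)
    have "2 powr (\<alpha> - 1) < 2 powr 0" using \<alpha> by (intro powr_less_mono) auto
    then show "(\<lambda>k. C * 2 powr \<alpha> * \<Lambda> powr - \<alpha> * (2 powr (\<alpha> - 1)) ^ k) sums (C * 2 powr \<alpha> * \<Lambda> powr - \<alpha> * (1 / (1 - 2 powr (\<alpha> - 1))))"
      by (intro sums_mult geometric_sums) simp
  qed (use C in simp)
  finally show ?thesis by (simp add: mult_ac)
qed

text \<open>The constant \<open>D\<close> is chosen before \<open>v\<close>, \<Lambda> and
  \<open>a\<close>: it is built from \<open>N\<close>, \<open>R\<close>, the dimension and the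
  bounds of \<phi> and its derivative on \<open>K\<close>.\<close>

lemma (in convex_graph) cut_integral_bound:
  fixes \<phi> :: "'a \<Rightarrow> real" and \<phi>' :: "'a \<Rightarrow> 'a \<Rightarrow>\<^sub>L real"
  assumes \<phi>: "\<And>x. (\<phi> has_derivative blinfun_apply (\<phi>' x)) (at x)" and cont_\<phi>': "continuous_on UNIV \<phi>'"
    and G: "G \<in> sets borel" "G \<subseteq> K"
    and N: "\<And>a y. norm y \<le> R \<Longrightarrow> interval_union N {\<tau> \<in> {1..<2}. a + \<tau> *\<^sub>R y \<in> G}"
    and R: "\<And>a b. a \<in> K \<Longrightarrow> b \<in> K \<Longrightarrow> dist a b \<le> R"
  shows "\<exists>D\<ge>0. \<forall>v \<Lambda> a. snd v \<ge> 0 \<longrightarrow> \<Lambda> > 0 \<longrightarrow> a \<in> K \<longrightarrow> (\<forall>x\<in>K. phase v a \<le> phase v x) \<longrightarrow>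
    ennreal (norm (\<integral>x. indicator G x *\<^sub>R (exp (- \<i> * complex_of_real (\<Lambda> * phase v x)) * complex_of_real (\<phi> x)) \<partial>lborel))
    \<le> ennreal D * (\<integral>\<^sup>+x. ennreal (decay (\<Lambda> * (indicator K x * (phase v x - phase v a)))) * indicator K x \<partial>lborel)"
proof -
  have cont_\<phi>: "continuous_on UNIV \<phi>"
    using \<phi> has_derivative_continuous continuous_at_imp_continuous_on by blast
  have "bounded (\<phi> ` K)" "bounded (\<phi>' ` K)"
    using compact_continuous_image[OF continuous_on_subset[OF cont_\<phi>] compact_K]
      compact_continuous_image[OF continuous_on_subset[OF cont_\<phi>'] compact_K] by (auto intro: compact_imp_bounded)
  then obtain A0 B0 where A0: "A0 > 0" "\<And>x. x \<in> K \<Longrightarrow> \<bar>\<phi> x\<bar> \<le> A0" and B0: "B0 > 0" "\<And>x. x \<in> K \<Longrightarrow> norm (\<phi>' x) \<le> B0"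
    unfolding bounded_pos by (metis imageI real_norm_def)
  define n where "n = DIM('a)"
  \<comment> \<open>\<open>A\<close> and \<open>B\<close> bound the amplitude
    \<open>\<tau> ^ n * \<phi> (a + \<tau> y)\<close> and its derivative in \<tau>, the latter by
    the product rule.\<close>
  define A where "A = 2 ^ n * A0"
  define B where "B = real n * 2 ^ n * A0 + 2 ^ n * (B0 * \<bar>R\<bar>)"
  have AB: "A \<ge> 0" "B \<ge> 0" unfolding A_def B_def using A0 B0 by auto
  \<comment> \<open>The summand \<open>A\<close> is the trivial bound, used while
    \<open>\<Lambda> * P \<le> 1\<close>; the other one is the oscillatory bound for at most
    \<open>N\<close> pieces.\<close>
  define D where "D = A + real N * (3 * A + B)"
  have D: "D \<ge> 0" "A \<le> D" "real N * (3 * A + B) \<le> D" unfolding D_def using AB by auto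
  show ?thesis
  proof (intro exI[of _ D] conjI allI impI D(1))
    fix v :: "'a \<times> real" and \<Lambda> :: real and a :: 'a
    assume v: "snd v \<ge> 0" and \<Lambda>: "\<Lambda> > 0" and a: "a \<in> K" and min: "\<forall>x\<in>K. phase v a \<le> phase v x"
    have RR: "R \<ge> 0" using R[OF a a] by simp
    let ?e = "\<lambda>x. exp (- \<i> * complex_of_real (\<Lambda> * phase v x))"
    have norm_e: "norm (?e x) = 1" for x by (simp add: norm_exp_eq_Re)
    define F where "F x = indicator G x *\<^sub>R (?e x * complex_of_real (\<phi> x))" for x
    \<comment> \<open>The factor \<open>indicator K\<close> gives a Borel function on the whole
      space, since \<open>phase v\<close> is only controlled on \<open>U\<close>.\<close>
    define P where "P x = indicator K x * (phase v x - phase v a)" for x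
    have K_borel: "K \<in> sets borel" using compact_K by (simp add: compact_imp_closed)
    have [measurable]: "P \<in> borel_measurable borel"
    proof -
      have "(\<lambda>x. indicator K x *\<^sub>R (phase v x - phase v a)) \<in> borel_measurable borel"
        by (intro borel_measurable_continuous_on_indicator K_borel continuous_intros
            continuous_on_subset[OF continuous_on_phase K_U])
      then show ?thesis unfolding P_def[abs_def] by simp
    qed
    have G_U: "G \<subseteq> U" using G(2) K_U by blast
    have F_meas: "F \<in> borel_measurable borel"
      unfolding F_def[abs_def]
      by (intro borel_measurable_continuous_on_indicator G(1) continuous_intros
          continuous_on_subset[OF continuous_on_phase G_U] continuous_on_subset[OF cont_\<phi>]) simp
    have F_bd: "norm (F x) \<le> A0" for x
      using A0 G(2) unfolding F_def by (auto simp: indicator_def norm_mult norm_e)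
    have F_supp: "x \<in> cball a R" if "F x \<noteq> 0" for x
      using that G(2) R[OF a, of x] unfolding F_def by (auto simp: indicator_def split: if_splits)
    define w where "w x = ennreal (decay (\<Lambda> * P x)) * indicator K x" for x
    have [measurable]: "w \<in> borel_measurable borel"
      unfolding w_def[abs_def] decay_def using K_borel by measurable
    have inner: "ennreal (norm (\<integral>\<tau>. indicator {1..<2} \<tau> *\<^sub>R (\<tau> ^ DIM('a) *\<^sub>R F (a + \<tau> *\<^sub>R y)) \<partial>lborel))
        \<le> ennreal D * w (a + y)" for y
    proof -
      define T where "T = {\<tau> \<in> {1..<2}. a + \<tau> *\<^sub>R y \<in> G}"
      define \<psi> where "\<psi> \<tau> = \<tau> ^ n * \<phi> (a + \<tau> *\<^sub>R y)" for \<tau> :: real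
      define \<psi>' where "\<psi>' \<tau> = real n * \<tau> ^ (n - 1) * \<phi> (a + \<tau> *\<^sub>R y) + \<tau> ^ n * blinfun_apply (\<phi>' (a + \<tau> *\<^sub>R y)) y" for \<tau> :: real
      define \<zeta> where "\<zeta> \<tau> = ?e (a + \<tau> *\<^sub>R y) * complex_of_real (\<psi> \<tau>)" for \<tau> :: real
      have eq: "(\<integral>\<tau>. indicator {1..<2} \<tau> *\<^sub>R (\<tau> ^ DIM('a) *\<^sub>R F (a + \<tau> *\<^sub>R y)) \<partial>lborel)
          = (\<integral>\<tau>. indicator T \<tau> *\<^sub>R \<zeta> \<tau> \<partial>lborel)"
        by (intro Bochner_Integration.integral_cong refl)
          (auto simp: T_def F_def \<zeta>_def \<psi>_def n_def indicator_def scaleR_conv_of_real)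
      show ?thesis
      proof (cases "T = {}")
        case True
        then show ?thesis unfolding eq by simp
      next
        case False
        \<comment> \<open>If the ray meets \<open>G\<close> at some parameter
          \<open>t \<ge> 1\<close>, convexity places \<open>a + y\<close> itself in
          \<open>K\<close>. So \<open>y\<close> is short enough for the bound \<open>N\<close>, and
          the weight at \<open>a + y\<close> is not cut off by the indicator of
          \<open>K\<close>.\<close>
        then obtain t where t: "1 \<le> t" "a + t *\<^sub>R y \<in> K" using G(2) unfolding T_def by auto
        have "(1 - 1 / t) *\<^sub>R a + (1 / t) *\<^sub>R (a + t *\<^sub>R y) \<in> K"
          by (rule convexD[OF convex_K a t(2)]) (use t(1) in auto)
        also have "(1 - 1 / t) *\<^sub>R a + (1 / t) *\<^sub>R (a + t *\<^sub>R y) = a + y" using t(1) by (simp add: algebra_simps)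
        finally have ay: "a + y \<in> K" .
        have y: "norm y \<le> R" using R[OF a ay] by (simp add: dist_norm)
        obtain \<F> where \<F>: "finite \<F>" "card \<F> \<le> N" "disjoint \<F>" "\<Union>\<F> = T" "\<forall>X\<in>\<F>. is_interval X"
          unfolding T_def by (rule interval_unionE[OF N[OF y]])
        have XT: "X \<subseteq> T" if "X \<in> \<F>" for X using \<F>(4) that by blast
        have TK: "a + \<tau> *\<^sub>R y \<in> K" "\<tau> \<in> {1..<2}" if "\<tau> \<in> T" for \<tau> using that G(2) unfolding T_def by auto
        have pow: "\<tau> ^ m \<le> 2 ^ n" if "\<tau> \<in> {1..2}" "m \<le> n" for \<tau> :: real and m
        proof -
          have "\<tau> ^ m \<le> \<tau> ^ n" using that by (intro power_increasing) auto
          also have "\<dots> \<le> 2 ^ n" using that by (intro power_mono) auto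
          finally show ?thesis .
        qed
        have bd: "\<bar>\<psi> \<tau>\<bar> \<le> A" "\<bar>\<psi>' \<tau>\<bar> \<le> B" if \<tau>: "\<tau> \<in> {1..2}" "a + \<tau> *\<^sub>R y \<in> K" for \<tau>
        proof -
          show "\<bar>\<psi> \<tau>\<bar> \<le> A"
            unfolding \<psi>_def A_def abs_mult using \<tau> A0 pow[OF \<tau>(1), of n] by (intro mult_mono) auto
          have "\<bar>blinfun_apply (\<phi>' (a + \<tau> *\<^sub>R y)) y\<bar> \<le> norm (\<phi>' (a + \<tau> *\<^sub>R y)) * norm y"
            using norm_blinfun[of "\<phi>' (a + \<tau> *\<^sub>R y)" y] by simp
          also have "\<dots> \<le> B0 * \<bar>R\<bar>" using B0 \<tau> y by (intro mult_mono) auto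
          finally have "\<bar>\<tau> ^ n * blinfun_apply (\<phi>' (a + \<tau> *\<^sub>R y)) y\<bar> \<le> 2 ^ n * (B0 * \<bar>R\<bar>)"
            unfolding abs_mult using \<tau> pow[OF \<tau>(1), of n] by (intro mult_mono) auto
          moreover have "\<bar>real n * \<tau> ^ (n - 1) * \<phi> (a + \<tau> *\<^sub>R y)\<bar> \<le> real n * 2 ^ n * A0"
            unfolding abs_mult using \<tau> A0 pow[OF \<tau>(1), of "n - 1"] by (intro mult_mono) auto
          ultimately show "\<bar>\<psi>' \<tau>\<bar> \<le> B" unfolding \<psi>'_def B_def by linarith
        qed
        have cont_\<zeta>: "continuous_on T \<zeta>"
          unfolding \<zeta>_def \<psi>_def
          by (intro continuous_intros continuous_on_compose2[OF continuous_on_phase]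
              continuous_on_compose2[OF cont_\<phi>]) (use TK K_U in auto)
        have \<zeta>_bd: "norm (\<zeta> \<tau>) \<le> A" if "\<tau> \<in> T" for \<tau>
          using bd(1)[OF _ TK(1)[OF that]] TK(2)[OF that] unfolding \<zeta>_def by (simp add: norm_mult norm_e)
        have int_dom: "integrable lborel (\<lambda>\<tau>. A * indicator {1..<2::real} \<tau>)"
          by (intro integrable_mult_right integrable_real_indicator) auto
        have T_borel: "T \<in> sets borel" unfolding \<F>(4)[symmetric]
          using \<F>(1,5) by (intro sets.finite_Union) (auto intro: real_interval_borel_measurable)
        have int: "integrable lborel (\<lambda>\<tau>. indicator X \<tau> *\<^sub>R \<zeta> \<tau>)" if X: "X \<in> sets borel" "X \<subseteq> T" for X
        proof (rule Bochner_Integration.integrable_bound[OF int_dom])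
          show "(\<lambda>\<tau>. indicator X \<tau> *\<^sub>R \<zeta> \<tau>) \<in> borel_measurable lborel"
            using borel_measurable_continuous_on_indicator[OF X(1) continuous_on_subset[OF cont_\<zeta> X(2)]] by simp
          show "AE \<tau> in lborel. norm (indicator X \<tau> *\<^sub>R \<zeta> \<tau>) \<le> norm (A * indicator {1..<2::real} \<tau>)"
            using X(2) \<zeta>_bd TK AB by (intro AE_I2) (auto simp: indicator_def)
        qed
        have "norm (\<integral>\<tau>. indicator T \<tau> *\<^sub>R \<zeta> \<tau> \<partial>lborel) \<le> (\<integral>\<tau>. A * indicator {1..<2::real} \<tau> \<partial>lborel)"
          by (rule Bochner_Integration.integral_norm_bound_integral[OF int[OF T_borel order_refl] int_dom])
            (use \<zeta>_bd TK AB in \<open>auto simp: indicator_def\<close>)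
        then have triv: "norm (\<integral>\<tau>. indicator T \<tau> *\<^sub>R \<zeta> \<tau> \<partial>lborel) \<le> A" by simp
        have "norm (\<integral>\<tau>. indicator T \<tau> *\<^sub>R \<zeta> \<tau> \<partial>lborel) \<le> D * decay (\<Lambda> * (phase v (a + y) - phase v a))"
        proof (cases "\<Lambda> * (phase v (a + y) - phase v a) \<le> 1")
          case True
          then show ?thesis using triv D by (simp add: decay_def)
        next
          case False
          then have "\<Lambda> * (phase v (a + y) - phase v a) > 0" by linarith
          then have Q: "phase v (a + y) - phase v a > 0" using \<Lambda> by (simp add: zero_less_mult_iff)
          have X_borel: "X \<in> sets borel" if "X \<in> \<F>" for X
            using \<F>(5) that by (auto intro: real_interval_borel_measurable)
          have "indicator T \<tau> *\<^sub>R \<zeta> \<tau> = (\<Sum>X\<in>\<F>. indicator X \<tau> *\<^sub>R \<zeta> \<tau>)" for \<tau>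
          proof -
            have "indicator (\<Union>X\<in>\<F>. X) \<tau> = (\<Sum>X\<in>\<F>. indicator X \<tau> :: real)"
              using \<F>(3) by (intro indicator_UN_disjoint \<F>(1)) (auto simp: disjoint_family_on_def pairwise_def disjnt_def)
            then show ?thesis unfolding \<F>(4)[symmetric] scaleR_sum_left[symmetric] by simp
          qed
          then have "(\<integral>\<tau>. indicator T \<tau> *\<^sub>R \<zeta> \<tau> \<partial>lborel) = (\<Sum>X\<in>\<F>. \<integral>\<tau>. indicator X \<tau> *\<^sub>R \<zeta> \<tau> \<partial>lborel)"
            using int[OF X_borel XT] by (simp add: Bochner_Integration.integral_sum)
          also have "norm \<dots> \<le> (\<Sum>X\<in>\<F>. (3 * A + B) / (\<Lambda> * (phase v (a + y) - phase v a)))"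
          proof (rule sum_norm_le)
            fix X assume X: "X \<in> \<F>"
            have "set_integrable lborel X \<zeta>" unfolding set_integrable_def by (rule int[OF X_borel[OF X] XT[OF X]])
            then have "(\<integral>\<tau>. indicator X \<tau> *\<^sub>R \<zeta> \<tau> \<partial>lborel) = integral X \<zeta>"
              using set_borel_integral_eq_integral(2)[of X \<zeta>] unfolding set_lebesgue_integral_def by simp
            also have "norm \<dots> \<le> (3 * A + B) / (\<Lambda> * (phase v (a + y) - phase v a))"
              unfolding \<zeta>_def
            proof (rule ray_integral_bound[OF v a \<Lambda> Q, where \<psi>' = \<psi>'])
              show "\<bar>\<psi> \<tau>\<bar> \<le> A" "\<bar>\<psi>' \<tau>\<bar> \<le> B" if "\<tau> \<in> {1..2}" "a + \<tau> *\<^sub>R y \<in> K" for \<tau>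
                by (rule bd[OF that])+
              show "is_interval X" using \<F>(5) X by blast
              show "X \<subseteq> {1..<2}" using XT[OF X] TK(2) by blast
              show "a + \<tau> *\<^sub>R y \<in> K" if "\<tau> \<in> X" for \<tau> using XT[OF X] TK(1) that by blast
              show "continuous_on {1..2} \<psi>'"
                unfolding \<psi>'_def
                by (intro continuous_intros continuous_on_compose2[OF cont_\<phi>'] continuous_on_compose2[OF cont_\<phi>]) auto
              show "(\<psi> has_real_derivative \<psi>' \<tau>) (at \<tau>)" for \<tau>
              proof -
                have "((\<lambda>\<tau>. \<phi> (a + \<tau> *\<^sub>R y)) has_real_derivative blinfun_apply (\<phi>' (a + \<tau> *\<^sub>R y)) y) (at \<tau>)"
                  using has_vector_derivative_along_line[OF \<phi>] by (simp add: has_real_derivative_iff_has_vector_derivative)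
                then show ?thesis
                  unfolding \<psi>_def[abs_def] \<psi>'_def by (auto intro!: derivative_eq_intros)
              qed
            qed (rule AB)+
            finally show "norm (\<integral>\<tau>. indicator X \<tau> *\<^sub>R \<zeta> \<tau> \<partial>lborel) \<le> (3 * A + B) / (\<Lambda> * (phase v (a + y) - phase v a))" .
          qed
          also have "\<dots> = (real (card \<F>) * (3 * A + B)) / (\<Lambda> * (phase v (a + y) - phase v a))" by simp
          also have "\<dots> \<le> D / (\<Lambda> * (phase v (a + y) - phase v a))"
          proof (rule divide_right_mono)
            have "real (card \<F>) * (3 * A + B) \<le> real N * (3 * A + B)"
              using \<F>(2) AB by (intro mult_right_mono) auto
            then show "real (card \<F>) * (3 * A + B) \<le> D" using D(3) by linarith
          qed (use Q \<Lambda> in simp)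
          finally show ?thesis using False by (simp add: decay_def)
        qed
        then have "ennreal (norm (\<integral>\<tau>. indicator T \<tau> *\<^sub>R \<zeta> \<tau> \<partial>lborel)) \<le> ennreal (D * decay (\<Lambda> * P (a + y)))"
          using ay by (intro ennreal_leI) (simp add: P_def)
        also have "\<dots> = ennreal D * w (a + y)"
          unfolding w_def using ay D(1) by (simp add: ennreal_mult decay_def)
        finally show ?thesis unfolding eq .
      qed
    qed
    have "ennreal (norm (\<integral>x. F x \<partial>lborel)) \<le>
        (\<integral>\<^sup>+y. ennreal (norm (\<integral>\<tau>. indicator {1..<2} \<tau> *\<^sub>R (\<tau> ^ DIM('a) *\<^sub>R F (a + \<tau> *\<^sub>R y)) \<partial>lborel)) \<partial>lborel)"
      by (rule norm_integral_le_dilations[OF F_meas F_bd F_supp])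
    also have "\<dots> \<le> (\<integral>\<^sup>+y. ennreal D * w (a + y) \<partial>lborel)" by (rule nn_integral_mono) (rule inner)
    also have "\<dots> = ennreal D * (\<integral>\<^sup>+y. w (a + y) \<partial>lborel)"
      by (intro nn_integral_cmult) measurable
    also have "(\<integral>\<^sup>+y. w (a + y) \<partial>lborel) = (\<integral>\<^sup>+x. w x \<partial>distr lborel borel ((+) a))"
      by (simp add: nn_integral_distr)
    also have "\<dots> = (\<integral>\<^sup>+x. w x \<partial>lborel)" by (simp add: lborel_distr_plus)
    finally show "ennreal (norm (\<integral>x. indicator G x *\<^sub>R (?e x * complex_of_real (\<phi> x)) \<partial>lborel))
      \<le> ennreal D * (\<integral>\<^sup>+x. ennreal (decay (\<Lambda> * (indicator K x * (phase v x - phase v a)))) * indicator K x \<partial>lborel)"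
      unfolding F_def w_def P_def .
  qed
qed

section \<open>The decay estimate\<close>

text \<open>Complex conjugation reflects the frequency, so it is enough to treat
  \<open>snd \<xi> \<ge> 0\<close>, the half space covered by the sublevel hypothesis.\<close>

lemma norm_oscillatory_integral_uminus:
  "norm (oscillatory_integral D q g f \<phi> (- \<xi>)) = norm (oscillatory_integral D q g f \<phi> \<xi>)"
proof -
  have "oscillatory_integral D q g f \<phi> (- \<xi>) = cnj (oscillatory_integral D q g f \<phi> \<xi>)"
    unfolding oscillatory_integral_def set_lebesgue_integral_def Bochner_Integration.integral_cnj[symmetric]
    by (intro Bochner_Integration.integral_cong refl) (simp add: exp_cnj)
  then show ?thesis by simp
qed

text \<open>Surface measure has density at least 1 over the base, so projecting the cap to
  \<open>K\<close> cannot increase its measure. Minimality of \<open>a\<close> identifies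
  \<open>phase v a\<close> with the support minimum.\<close>

lemma (in convex_graph) emeasure_sublevel_le_graph_measure:
  assumes a: "a \<in> K" "\<And>x. x \<in> K \<Longrightarrow> phase v a \<le> phase v x" and u: "u \<ge> 0"
  shows "emeasure lborel {x \<in> K. indicator K x * (phase v x - phase v a) \<le> u}
    \<le> emeasure (graph_measure U f) {p \<in> graph_over U f. fst p \<in> K \<and>
        support_min (graph_over U f) K v \<le> p \<bullet> v \<and> p \<bullet> v \<le> support_min (graph_over U f) K v + u}"
proof -
  define s where "s = support_min (graph_over U f) K v"
  have s: "s = phase v a"
  proof -
    obtain p where p: "p \<in> graph_over U f" "fst p \<in> K" "s = p \<bullet> v"
      "\<And>p'. p' \<in> graph_over U f \<Longrightarrow> fst p' \<in> K \<Longrightarrow> p \<bullet> v \<le> p' \<bullet> v"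
      unfolding s_def using support_min_attained[OF compact_K _ K_U cont_f, of v] a(1) by blast
    have "p \<bullet> v = phase v (fst p)" using p(1) unfolding graph_over_def phase_def by auto
    moreover have "p \<bullet> v \<le> phase v a"
      unfolding phase_def by (rule p(4)) (use a(1) K_U in \<open>auto simp: graph_over_def\<close>)
    ultimately show ?thesis using a(2)[OF p(2)] p(3) by simp
  qed
  let ?A = "{p \<in> graph_over U f. fst p \<in> K \<and> s \<le> p \<bullet> v \<and> p \<bullet> v \<le> s + u}"
  let ?S = "{x \<in> K. phase v x \<le> s + u}"
  have "closed ?S"
  proof -
    have "closed (K \<inter> phase v -` {..s + u})"
      by (intro continuous_closed_preimage continuous_on_subset[OF continuous_on_phase K_U] compact_imp_closed[OF compact_K]) auto
    then show ?thesis by (simp add: Int_def vimage_def)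
  qed
  then have "compact ?S" using compact_K compact_Int_closed[of K ?S] by (simp add: Int_def conj_commute)
  have A: "?A = (\<lambda>x. (x, f x)) ` ?S"
    using K_U a(2) s unfolding graph_over_def phase_def by (auto simp: image_iff)
  have "compact ?A"
    unfolding A using \<open>compact ?S\<close> K_U
    by (intro compact_continuous_image continuous_intros continuous_on_subset[OF cont_f]) auto
  then have A_borel: "?A \<in> sets borel" by (simp add: compact_imp_closed)
  have US: "{x \<in> U. (x, f x) \<in> ?A} = ?S" unfolding A using K_U by auto
  have "C1_on U f"
    unfolding C1_on_def
    by (intro exI[of _ f'] conjI ballI f' continuous_at_imp_continuous_on has_derivative_continuous[OF f''])
  have "{x \<in> K. indicator K x * (phase v x - phase v a) \<le> u} = ?S" unfolding s by auto
  then have "emeasure lborel {x \<in> K. indicator K x * (phase v x - phase v a) \<le> u} = (\<integral>\<^sup>+x. indicator ?S x \<partial>lborel)"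
    using \<open>closed ?S\<close> by simp
  also have "\<dots> \<le> (\<integral>\<^sup>+x\<in>?S. ennreal (sqrt (1 + (norm (gradient f x))\<^sup>2)) \<partial>lborel)"
  proof (rule nn_integral_mono)
    fix x
    have "ennreal 1 \<le> ennreal (sqrt (1 + (norm (gradient f x))\<^sup>2))" by (rule ennreal_leI) simp
    then show "indicator ?S x \<le> ennreal (sqrt (1 + (norm (gradient f x))\<^sup>2)) * indicator ?S x"
      by (simp add: indicator_def)
  qed
  also have "\<dots> = emeasure (graph_measure U f) ?A"
    unfolding emeasure_graph_measure[OF open_U \<open>C1_on U f\<close> A_borel] US ..
  finally show ?thesis unfolding s_def .
qed

theorem theorem1p3:
  fixes r0 :: real
    and f \<phi> :: "real ^ 'n \<Rightarrow> real"
    and U :: "(real ^ 'n) set"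
    and q :: nat
    and g :: "nat \<Rightarrow> real ^ 'n \<Rightarrow> real"
    and V :: "nat \<Rightarrow> (real ^ 'n) set"
    and C \<alpha> :: real
  assumes "r0 > 0"
    and "open U" and "cball 0 r0 \<subseteq> U"
    and "convex_on U f" and "C2_on U f"
    and "f 0 = 0" and "gradient f 0 = 0"
    and "C1_on UNIV \<phi>" and "closure {x. \<phi> x \<noteq> 0} \<subseteq> ball 0 r0"
    and "\<And>i. i \<in> {1..q} \<Longrightarrow> open (V i) \<and> cball 0 r0 \<subseteq> V i"
    and "\<And>i. i \<in> {1..q} \<Longrightarrow> real_analytic_on (V i) (g i)"
    and "\<And>i. i \<in> {1..q} \<Longrightarrow> \<exists>x \<in> V i. g i x \<noteq> 0"
    and "C > 0" and "0 < \<alpha>" and "\<alpha> < 1"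
    and "\<And>(t :: real) (v :: (real ^ 'n) \<times> real).
           t \<noteq> 0 \<Longrightarrow> norm v = 1 \<Longrightarrow> snd v \<ge> 0 \<Longrightarrow>
           emeasure (graph_measure U f)
             {p \<in> graph_over U f. fst p \<in> cball 0 r0 \<and>
                support_min (graph_over U f) (cball 0 r0) v \<le> p \<bullet> v \<and>
                p \<bullet> v \<le> support_min (graph_over U f) (cball 0 r0) v + inverse \<bar>t\<bar>}
           \<le> ennreal (C * \<bar>t\<bar> powr (- \<alpha>))"
  shows "\<exists>C' :: real. \<forall>\<xi> :: (real ^ 'n) \<times> real. \<xi> \<noteq> 0 \<longrightarrow>
           norm (oscillatory_integral (ball 0 r0) q g f \<phi> \<xi>) \<le> C' * norm \<xi> powr (- \<alpha>)"
proof -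
  define K :: "(real ^ 'n) set" where "K = cball 0 r0"
  note level = assms(16)[folded K_def]
  have K: "compact K" "convex K" "K \<subseteq> U" "0 \<in> K" using assms(1,3) unfolding K_def by auto
  obtain f' :: "real ^ 'n \<Rightarrow> (real ^ 'n) \<Rightarrow>\<^sub>L real" where
    f': "\<And>x. x \<in> U \<Longrightarrow> (f has_derivative blinfun_apply (f' x)) (at x)" and "C1_on U f'"
    using assms(5) unfolding C2_on_def by blast
  then obtain f'' :: "real ^ 'n \<Rightarrow> (real ^ 'n) \<Rightarrow>\<^sub>L ((real ^ 'n) \<Rightarrow>\<^sub>L real)" where
    f'': "\<And>x. x \<in> U \<Longrightarrow> (f' has_derivative blinfun_apply (f'' x)) (at x)" "continuous_on U f''"
    unfolding C1_on_def by blast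
  obtain \<phi>' :: "real ^ 'n \<Rightarrow> (real ^ 'n) \<Rightarrow>\<^sub>L real" where
    \<phi>': "\<And>x. (\<phi> has_derivative blinfun_apply (\<phi>' x)) (at x)" "continuous_on UNIV \<phi>'"
    using assms(8) unfolding C1_on_def by blast
  interpret convex_graph U K f f' f''
    by unfold_locales (use assms(2,4) K f' f'' in auto)
  \<comment> \<open>The closed ball replaces the open one because the bound on the number of pieces
    rests on compactness; in \<open>osc\<close> below the integrals agree because \<phi> vanishes
    off the open ball.\<close>
  define G where "G = {x \<in> K. \<forall>i\<in>{1..q}. g i x < 0}"
  have G_borel: "G \<in> sets borel"
  proof -
    have "{x \<in> K. g i x < 0} \<in> sets borel" if i: "i \<in> {1..q}" for i
    proof -
      have "continuous_on K (g i)"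
        using real_analytic_on_imp_continuous_on[of "V i" "g i"] assms(10,11)[OF i]
        unfolding K_def by (auto intro: continuous_on_subset)
      then obtain W where W: "open W" "W \<inter> K = g i -` {..<0} \<inter> K"
        unfolding continuous_on_open_invariant using open_lessThan by blast
      have "{x \<in> K. g i x < 0} = W \<inter> K" unfolding W(2) by auto
      then show ?thesis using W(1) K(1) by (simp add: compact_imp_closed)
    qed
    then have "K \<inter> (\<Inter>i\<in>{1..q}. {x \<in> K. g i x < 0}) \<in> sets borel" if "q \<ge> 1"
      using that K(1) by (intro sets.Int sets.finite_INT) (auto simp: compact_imp_closed)
    moreover have "G = K \<inter> (\<Inter>i\<in>{1..q}. {x \<in> K. g i x < 0})" unfolding G_def by auto
    moreover have "G = K" if "\<not> q \<ge> 1" using that unfolding G_def by auto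
    ultimately show ?thesis using K(1) by (cases "q \<ge> 1") (auto simp: compact_imp_closed)
  qed
  have "\<exists>N. \<forall>a y. norm y \<le> 2 * r0 \<longrightarrow>
      interval_union N {\<tau> \<in> {1..<2}. a + \<tau> *\<^sub>R y \<in> K \<and> (\<forall>i\<in>{1..q}. g i (a + \<tau> *\<^sub>R y) < 0)}"
    by (rule analytic_family_ray_interval_union[OF K(1,2), where V = V])
      (use assms(10,11) in \<open>auto simp: K_def\<close>)
  then obtain N where N: "\<And>a y. norm y \<le> 2 * r0 \<Longrightarrow> interval_union N {\<tau> \<in> {1..<2}. a + \<tau> *\<^sub>R y \<in> G}"
    unfolding G_def by auto
  have diam: "dist a b \<le> 2 * r0" if "a \<in> K" "b \<in> K" for a b
    using that norm_triangle_ineq4[of a b] unfolding K_def by (simp add: dist_norm)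
  have "G \<subseteq> K" unfolding G_def by blast
  from cut_integral_bound[OF \<phi>' G_borel this N diam] obtain D where D: "D \<ge> 0"
    "\<And>v \<Lambda> a. snd v \<ge> 0 \<Longrightarrow> \<Lambda> > 0 \<Longrightarrow> a \<in> K \<Longrightarrow> \<forall>x\<in>K. phase v a \<le> phase v x \<Longrightarrow>
      ennreal (norm (\<integral>x. indicator G x *\<^sub>R (exp (- \<i> * complex_of_real (\<Lambda> * phase v x)) * complex_of_real (\<phi> x)) \<partial>lborel))
      \<le> ennreal D * (\<integral>\<^sup>+x. ennreal (decay (\<Lambda> * (indicator K x * (phase v x - phase v a)))) * indicator K x \<partial>lborel)"
    by auto
  define C' where "C' = D * (C * 2 powr \<alpha> / (1 - 2 powr (\<alpha> - 1)))"
  have C': "C' \<ge> 0"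
  proof -
    have "2 powr (\<alpha> - 1) \<le> (1 :: real)" using powr_mono[of "\<alpha> - 1" 0 2] assms(15) by simp
    then show ?thesis unfolding C'_def using D(1) assms(13) by simp
  qed
  have main: "norm (oscillatory_integral (ball 0 r0) q g f \<phi> \<xi>) \<le> C' * norm \<xi> powr (- \<alpha>)"
    if \<xi>: "\<xi> \<noteq> 0" "snd \<xi> \<ge> 0" for \<xi>
  proof -
    define \<Lambda> where "\<Lambda> = norm \<xi>"
    define v where "v = (1 / \<Lambda>) *\<^sub>R \<xi>"
    have \<Lambda>: "\<Lambda> > 0" unfolding \<Lambda>_def using \<xi> by simp
    have v: "norm v = 1" "snd v \<ge> 0" "\<xi> = \<Lambda> *\<^sub>R v" unfolding v_def using \<Lambda> \<xi> by (auto simp: \<Lambda>_def)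
    obtain a where a: "a \<in> K" "\<forall>x\<in>K. phase v a \<le> phase v x"
      using continuous_attains_inf[OF K(1) _ continuous_on_subset[OF continuous_on_phase K(3)]] K(4) by blast
    let ?P = "\<lambda>x. indicator K x * (phase v x - phase v a)"
    have "(\<lambda>x. indicator K x *\<^sub>R (phase v x - phase v a)) \<in> borel_measurable borel"
      using K(1) by (intro borel_measurable_continuous_on_indicator continuous_intros
          continuous_on_subset[OF continuous_on_phase K(3)]) (auto simp: compact_imp_closed)
    then have P: "?P \<in> borel_measurable borel" by simp
    have osc: "oscillatory_integral (ball 0 r0) q g f \<phi> \<xi>
        = (\<integral>x. indicator G x *\<^sub>R (exp (- \<i> * complex_of_real (\<Lambda> * phase v x)) * complex_of_real (\<phi> x)) \<partial>lborel)"
      unfolding oscillatory_integral_def set_lebesgue_integral_def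
    proof (intro Bochner_Integration.integral_cong refl)
      fix x
      have ph: "\<xi> \<bullet> (x, f x) = \<Lambda> * phase v x" unfolding v(3) phase_def by (simp add: inner_commute)
      show "indicator {x \<in> ball 0 r0. \<forall>i\<in>{1..q}. g i x < 0} x *\<^sub>R
          (exp (- \<i> * complex_of_real (\<xi> \<bullet> (x, f x))) * complex_of_real (\<phi> x)) =
        indicator G x *\<^sub>R (exp (- \<i> * complex_of_real (\<Lambda> * phase v x)) * complex_of_real (\<phi> x))"
      proof (cases "\<phi> x = 0")
        case False
        then have "x \<in> ball 0 r0" using assms(9) closure_subset[of "{x. \<phi> x \<noteq> 0}"] by blast
        then have "x \<in> K" unfolding K_def by simp
        then show ?thesis using \<open>x \<in> ball 0 r0\<close> unfolding ph G_def by (simp add: indicator_def)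
      qed simp
    qed
    have "ennreal (norm (oscillatory_integral (ball 0 r0) q g f \<phi> \<xi>))
        \<le> ennreal D * (\<integral>\<^sup>+x. ennreal (decay (\<Lambda> * ?P x)) * indicator K x \<partial>lborel)"
      unfolding osc by (rule D(2)[OF v(2) \<Lambda> a])
    also have "\<dots> \<le> ennreal D * ennreal (C * 2 powr \<alpha> / (1 - 2 powr (\<alpha> - 1)) * \<Lambda> powr - \<alpha>)"
    proof (intro mult_left_mono nn_integral_decay_bound P \<Lambda> assms(15))
      show "K \<in> sets borel" using K(1) by (simp add: compact_imp_closed)
      show "C \<ge> 0" using assms(13) by simp
      fix t :: real assume t: "t > 0"
      have "emeasure lborel {x \<in> K. ?P x \<le> inverse t} \<le> emeasure (graph_measure U f)
          {p \<in> graph_over U f. fst p \<in> K \<and> support_min (graph_over U f) K v \<le> p \<bullet> v \<and>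
            p \<bullet> v \<le> support_min (graph_over U f) K v + inverse t}"
        by (rule emeasure_sublevel_le_graph_measure) (use a t in auto)
      also have "\<dots> \<le> ennreal (C * t powr - \<alpha>)"
        using level[of t v] t v(1,2) by simp
      finally show "emeasure lborel {x \<in> K. ?P x \<le> inverse t} \<le> ennreal (C * t powr - \<alpha>)" .
    qed simp
    also have "\<dots> = ennreal (C' * \<Lambda> powr - \<alpha>)"
      unfolding C'_def using D(1) by (simp add: ennreal_mult'[symmetric] mult.assoc)
    finally have "norm (oscillatory_integral (ball 0 r0) q g f \<phi> \<xi>) \<le> C' * \<Lambda> powr - \<alpha>"
      using C' by (subst (asm) ennreal_le_iff) auto
    then show ?thesis unfolding \<Lambda>_def .
  qed
  show ?thesis
  proof (intro exI[of _ C'] allI impI)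
    fix \<xi> :: "(real ^ 'n) \<times> real" assume \<xi>: "\<xi> \<noteq> 0"
    show "norm (oscillatory_integral (ball 0 r0) q g f \<phi> \<xi>) \<le> C' * norm \<xi> powr (- \<alpha>)"
    proof (cases "snd \<xi> \<ge> 0")
      case True
      then show ?thesis using main \<xi> by blast
    next
      case False
      then show ?thesis using main[of "- \<xi>"] \<xi> by (simp add: norm_oscillatory_integral_uminus)
    qed
  qed
qed

end
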